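(* Let $G$ be a subgroup of $S_{\mathbb N}$. If $A\in\{\mathscr W_G,\mathscr A_G,\mathscr H^\infty_G\}$, then $$A^{-1}=\big\{f\in A:\ \inf_{\mathbb C_+}|f|>0\big\},$$ and $$(\mathscr O_{b,G})^{-1}=\{f\in\mathscr O_{b,G}:\ f_r\in(\mathscr H^\infty_G)^{-1}\ \text{for all } r\in(0,1)\}.$$ Moreover, if $A\in\{\mathscr W_G,\mathscr A_G,\mathscr O_{b,G}\}$, then $A^{-1}=e^A$.
   Context: For a unital commutative complex Banach or Fréchet algebra $A$, $A^{-1}$ is the multiplicative group of invertible elements of $A$ and $e^A$ is its subgroup of elements of the form $e^a$, $a\in A$. Let $\mathbb C_+=\{\mathrm{Re}\,s>0\}$. $\mathscr O_u$ is the algebra of holomorphic functions on $\mathbb C_+$ that are limits of Dirichlet series $\sum_{n\ge1}a_nn^{-s}$ converging uniformly on each half-plane $\{\mathrm{Re}\,s>\varepsilon\}$, $\varepsilon>0$ (the series is unique). $\Omega(n)$ is the number of prime factors of $n$ counted with multiplicity; for $f\in\mathscr O_u$ with Dirichlet series $\sum a_nn^{-s}$ and $r\in(0,1)$, $f_r\in\mathscr O_u$ is the limit function of $\sum r^{\Omega(n)}a_nn^{-s}$. - $\mathscr O_b$: all $f\in\mathscr O_u$ with $P_r(f)=\sup_{\mathbb C_+}|f_r|<\infty$ for every $r\in(0,1)$; a Fréchet algebra with the seminorms $P_r$. - $\mathscr H^\infty$: bounded functions in $\mathscr O_u$, with the supremum norm. - $\mathscr W$: limit functions of Dirichlet series with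 $\sum|a_n|<\infty$, with norm $\|f\|_1=\sum|a_n|$. - $\mathscr A$: the closure of $\mathscr W$ in $\mathscr H^\infty$, with the supremum norm. $S_{\mathbb N}$ is the group of all permutations of $\mathbb N=\{1,2,\dots\}$; $p_1<p_2<\cdots$ are the primes, $\nu_p(n)$ the exponent of $p$ in $n$; for $\sigma\in S_{\mathbb N}$, $\hat\sigma(n)=\prod_ip_{\sigma(i)}^{\nu_{p_i}(n)}$. For $\mathbb A\in\{\mathscr O_b,\mathscr W,\mathscr A,\mathscr H^\infty\}$, $\mathbb A_G$ (written $\mathscr O_{b,G}$ for $\mathscr O_b$) is the closed subalgebra of those $f\in\mathbb A$ whose Dirichlet series satisfies $a_{\hat\sigma(n)}=a_n$ for all $n\in\mathbb N$, $\sigma\in G$. *)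

theory Defs
  imports
    "HOL-Complex_Analysis.Complex_Analysis"
    "HOL-Computational_Algebra.Primes"
    "HOL-Library.Infinite_Set"
    "HOL-Algebra.Bij"
    "HOL-Algebra.Ring"
begin

section \<open>Dirichlet series on the right half-plane\<close>

definition right_halfplane :: "complex set" where
  "right_halfplane = {s. Re s > 0}"

text \<open>Coefficient sequences are indexed by all of \<open>nat\<close>; only the indices \<open>n \<ge> 1\<close> matter.\<close>

definition dirichlet_partial :: "(nat \<Rightarrow> complex) \<Rightarrow> nat \<Rightarrow> complex \<Rightarrow> complex" where
  "dirichlet_partial a N s = (\<Sum>n=1..N. a n * of_nat n powr (- s))"

definition has_dirichlet_series :: "(complex \<Rightarrow> complex) \<Rightarrow> (nat \<Rightarrow> complex) \<Rightarrow> bool" where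
  "has_dirichlet_series f a \<longleftrightarrow>
     (\<forall>\<epsilon>>0. uniform_limit {s. Re s > \<epsilon>} (dirichlet_partial a) f sequentially)"

text \<open>Functions on the half-plane are represented by elements of
  \<open>extensional right_halfplane\<close>, so that equality of such functions is HOL equality.\<close>

definition dirichlet_limit :: "(nat \<Rightarrow> complex) \<Rightarrow> complex \<Rightarrow> complex" where
  "dirichlet_limit a = (\<lambda>s\<in>right_halfplane. lim (\<lambda>N. dirichlet_partial a N s))"

definition Ou :: "(complex \<Rightarrow> complex) set" where
  "Ou = {f \<in> extensional right_halfplane.
           f holomorphic_on right_halfplane \<and> (\<exists>a. has_dirichlet_series f a)}"

text \<open>The irrelevant entry at index \<open>0\<close> is normalised to make the sequence unique; see
  \<open>dirichlet_coeff_eq\<close> below.\<close>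

definition dirichlet_coeff :: "(complex \<Rightarrow> complex) \<Rightarrow> nat \<Rightarrow> complex" where
  "dirichlet_coeff f = (THE a. has_dirichlet_series f a \<and> a 0 = 0)"

text \<open>The function written \<open>f\<^sub>r\<close> in the literature; the exponent is \<open>\<Omega>(n)\<close>.\<close>

definition dilate :: "real \<Rightarrow> (complex \<Rightarrow> complex) \<Rightarrow> complex \<Rightarrow> complex" where
  "dilate r f = dirichlet_limit
     (\<lambda>n. of_real r ^ size (prime_factorization n) * dirichlet_coeff f n)"

section \<open>The algebras and their seminorms\<close>

definition sup_norm :: "(complex \<Rightarrow> complex) \<Rightarrow> real" where
  "sup_norm f = (SUP s\<in>right_halfplane. cmod (f s))"

definition l1_norm :: "(complex \<Rightarrow> complex) \<Rightarrow> real" where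
  "l1_norm f = (\<Sum>n. cmod (dirichlet_coeff f n))"

definition dilate_seminorm :: "real \<Rightarrow> (complex \<Rightarrow> complex) \<Rightarrow> real" where
  "dilate_seminorm r f = sup_norm (dilate r f)"

text \<open>Finiteness of a supremum is expressed by \<^const>\<open>bounded\<close>, since \<^const>\<open>Sup\<close> on the
  reals is a junk value for unbounded sets.\<close>

definition Ob :: "(complex \<Rightarrow> complex) set" where
  "Ob = {f \<in> Ou. \<forall>r\<in>{0<..<1}. bounded (dilate r f ` right_halfplane)}"

definition Hinf :: "(complex \<Rightarrow> complex) set" where
  "Hinf = {f \<in> Ou. bounded (f ` right_halfplane)}"

definition Wie :: "(complex \<Rightarrow> complex) set" where
  "Wie = {dirichlet_limit a | a. summable (\<lambda>n. cmod (a n))}"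

definition Adir :: "(complex \<Rightarrow> complex) set" where
  "Adir = {f \<in> Hinf. \<forall>\<epsilon>>0. \<exists>g\<in>Wie. sup_norm (\<lambda>s\<in>right_halfplane. f s - g s) < \<epsilon>}"

section \<open>Invertible elements and exponentials\<close>

text \<open>A set of functions on the half-plane with the pointwise operations, as a ring record.\<close>

definition fun_ring :: "(complex \<Rightarrow> complex) set \<Rightarrow> (complex \<Rightarrow> complex) ring" where
  "fun_ring A =
    \<lparr>carrier = A,
     mult = (\<lambda>f g. \<lambda>s\<in>right_halfplane. f s * g s),
     one = (\<lambda>s\<in>right_halfplane. 1),
     zero = (\<lambda>s\<in>right_halfplane. 0),
     add = (\<lambda>f g. \<lambda>s\<in>right_halfplane. f s + g s)\<rparr>"

text \<open>The set of all \<open>e\<^sup>a\<close>, \<open>a \<in> A\<close>, where the exponential series is summed in the topology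
  on \<open>A\<close> given by the family \<open>P\<close> of seminorms.\<close>

definition is_exp :: "((complex \<Rightarrow> complex) \<Rightarrow> real) set \<Rightarrow>
    (complex \<Rightarrow> complex) \<Rightarrow> (complex \<Rightarrow> complex) \<Rightarrow> bool" where
  "is_exp P a f \<longleftrightarrow>
     (\<forall>p\<in>P. (\<lambda>N. p (\<lambda>s\<in>right_halfplane. f s - (\<Sum>k<N. a s ^ k / fact k))) \<longlonglongrightarrow> 0)"

definition exp_set :: "((complex \<Rightarrow> complex) \<Rightarrow> real) set \<Rightarrow>
    (complex \<Rightarrow> complex) set \<Rightarrow> (complex \<Rightarrow> complex) set" where
  "exp_set P A = {f \<in> A. \<exists>a\<in>A. is_exp P a f}"

section \<open>Permutation symmetry\<close>

definition nth_prime :: "nat \<Rightarrow> nat" where  \<comment> \<open>\<open>nth_prime 1 = 2\<close>\<close>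
  "nth_prime i = enumerate {p. prime p} (i - 1)"

text \<open>The product runs over the finitely many indices with nonzero exponent (for \<open>n \<ge> 1\<close>).\<close>

definition perm_hat :: "(nat \<Rightarrow> nat) \<Rightarrow> nat \<Rightarrow> nat" where
  "perm_hat \<sigma> n =
     (\<Prod>i\<in>{i. i \<ge> 1 \<and> nth_prime i dvd n}. nth_prime (\<sigma> i) ^ multiplicity (nth_prime i) n)"

definition invariants ::
    "(nat \<Rightarrow> nat) set \<Rightarrow> (complex \<Rightarrow> complex) set \<Rightarrow> (complex \<Rightarrow> complex) set" where
  "invariants G A =
     {f \<in> A. \<forall>\<sigma>\<in>G. \<forall>n\<ge>1. dirichlet_coeff f (perm_hat \<sigma> n) = dirichlet_coeff f n}"

section \<open>Uniqueness of the coefficients\<close>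

lemma dirichlet_null:
  assumes "has_dirichlet_series (\<lambda>_. 0) c" and "n \<ge> 1"
  shows "c n = 0"
proof (rule ccontr)
  assume nz: "c n \<noteq> 0"
  define m where "m = (LEAST n. n \<ge> 1 \<and> c n \<noteq> 0)"
  have m: "m \<ge> 1" "c m \<noteq> 0"
    using LeastI[of "\<lambda>n. n \<ge> 1 \<and> c n \<noteq> 0" n] nz assms(2) by (auto simp: m_def)
  have below: "c k = 0" if "k \<ge> 1" "k < m" for k
    using not_less_Least[of k "\<lambda>n. n \<ge> 1 \<and> c n \<noteq> 0"] that by (auto simp: m_def)
  define t where "t = (\<lambda>x::real. \<lambda>n. c (Suc n) * of_nat (Suc n) powr (- of_real x))"
  have sums: "t x sums 0" if "x > 0" for x
  proof -
    have "uniform_limit {s. Re s > x/2} (dirichlet_partial c) (\<lambda>_. 0) sequentially"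
      using assms(1) that half_gt_zero[OF that] unfolding has_dirichlet_series_def by blast
    hence "(\<lambda>N. dirichlet_partial c N (of_real x)) \<longlonglongrightarrow> 0"
      by (rule tendsto_uniform_limitI) (use that in auto)
    moreover have "dirichlet_partial c N (of_real x) = (\<Sum>k<N. t x k)" for N
      unfolding dirichlet_partial_def t_def
      by (rule sum.reindex_bij_witness[of _ Suc "\<lambda>k. k - 1"]) auto
    ultimately show ?thesis by (simp add: sums_def)
  qed
  have npowr: "cmod (of_nat (Suc k) powr (- of_real x)) = real (Suc k) powr (- x)" for x k
    by (simp add: norm_powr_real_powr)
  have "t 1 \<longlonglongrightarrow> 0" using sums[of 1] by (auto dest: sums_summable summable_LIMSEQ_zero)
  hence "Bseq (t 1)" by (intro convergent_imp_Bseq) (auto simp: convergent_def)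
  then obtain K where K: "K > 0" "\<And>k. norm (t 1 k) \<le> K" by (auto simp: Bseq_def)
  have cbound: "cmod (c (Suc k)) \<le> K * real (Suc k)" for k
  proof -
    have "cmod (c (Suc k)) * real (Suc k) powr (- 1) \<le> K"
      using K(2)[of k] unfolding t_def norm_mult npowr .
    thus ?thesis by (simp add: powr_minus field_simps del: of_nat_Suc)
  qed
  define S where "S = (\<Sum>k. 1 / real (Suc k)^2)"
  have S: "summable (\<lambda>k. 1 / real (Suc k)^2)"
    using summable_Suc_iff[of "\<lambda>k. 1 / real k ^ 2"] inverse_power_summable[of 2, where 'a = real]
    by (simp add: field_simps)
  define q where "q = real m / real (Suc m)"
  have q: "0 < q" "q < 1" using m by (auto simp: q_def)
  have main: "cmod (c m) \<le> (K * real m ^ 3 * S) * q ^ j" for j :: nat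
  proof -
    define x where "x = real j + 3"
    have s0: "t x sums 0" using sums[of x] by (simp add: x_def)
    define u where "u = (\<lambda>k. of_nat m powr (of_real x) * (if k = m - 1 then 0 else t x k))"
    have "(\<lambda>k. if k = m - 1 then t x k else 0) sums t x (m - 1)" by (rule sums_single)
    moreover have "(\<lambda>k. t x k - (if k = m - 1 then t x k else 0)) =
        (\<lambda>k. if k = m - 1 then 0 else t x k)" by auto
    ultimately have "(\<lambda>k. if k = m - 1 then 0 else t x k) sums (- t x (m - 1))"
      using sums_diff[OF s0] by fastforce
    hence "u sums (of_nat m powr (of_real x) * (- t x (m - 1)))"
      unfolding u_def by (rule sums_mult)
    also have "of_nat m powr (of_real x) * (- t x (m - 1)) = - c m"
      using m by (simp add: t_def powr_minus)
    finally have us: "u sums (- c m)" .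
    have ub: "norm (u k) \<le> (K * real m ^ 3 * q ^ j) * (1 / real (Suc k)^2)" for k
    proof (cases "k < m")
      case True
      hence "u k = 0" using below[of "Suc k"] by (auto simp: u_def t_def)
      thus ?thesis using K q by auto
    next
      case False
      have xj: "x = real (j + 3)" by (simp add: x_def)
      have pw: "real m powr x = real m ^ j * real m ^ 3"
        using m unfolding xj by (subst powr_realpow) (auto simp: power_add)
      have pn: "real (Suc k) powr (- x) = 1 / (real (Suc k) ^ j * real (Suc k) ^ 3)"
        unfolding xj powr_minus_divide
        by (subst powr_realpow) (auto simp: power_add simp del: of_nat_Suc)
      have "norm (u k) \<le> real m powr x * (K * real (Suc k) * real (Suc k) powr (-x))"
        using m False cbound[of k] npowr[of k x]
        by (auto simp: u_def t_def norm_mult norm_powr_real_powr simp del: of_nat_Suc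
              intro!: mult_left_mono mult_right_mono)
      also have "\<dots> = K * real m ^ 3 * (real m / real (Suc k)) ^ j * (1 / real (Suc k)^2)"
        unfolding pw by (simp add: pn power_divide divide_simps power_numeral_reduce del: of_nat_Suc)
      also have "\<dots> \<le> K * real m ^ 3 * q ^ j * (1 / real (Suc k)^2)"
      proof -
        have "(real m / real (Suc k)) ^ j \<le> q ^ j"
          using m False unfolding q_def by (intro power_mono divide_left_mono) auto
        thus ?thesis using K(1) by (intro mult_left_mono mult_right_mono) auto
      qed
      finally show ?thesis .
    qed
    have bs: "(\<lambda>k. (K * real m ^ 3 * q ^ j) * (1 / real (Suc k)^2)) sums ((K * real m ^ 3 * q ^ j) * S)"
      unfolding S_def by (rule sums_mult[OF summable_sums[OF S]])
    have "norm (suminf u) \<le> (\<Sum>k. (K * real m ^ 3 * q ^ j) * (1 / real (Suc k)^2))"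
      by (rule norm_suminf_le[OF ub sums_summable[OF bs]])
    hence "cmod (- c m) \<le> (K * real m ^ 3 * q ^ j) * S"
      unfolding sums_unique[OF us, symmetric] sums_unique[OF bs, symmetric] .
    thus ?thesis by (simp add: mult_ac)
  qed
  have "(\<lambda>j. (K * real m ^ 3 * S) * q ^ j) \<longlonglongrightarrow> (K * real m ^ 3 * S) * 0"
    using q by (intro tendsto_intros LIMSEQ_realpow_zero) auto
  hence "cmod (c m) \<le> (K * real m ^ 3 * S) * 0"
    by (rule LIMSEQ_le_const) (use main in auto)
  with m show False by simp
qed

lemma dirichlet_coeff_eq:
  assumes "has_dirichlet_series f a"
  shows "dirichlet_coeff f = a(0 := 0)"
  unfolding dirichlet_coeff_def
proof (rule the_equality)
  have [simp]: "dirichlet_partial (a(0 := 0)) = dirichlet_partial a"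
    by (auto simp: dirichlet_partial_def fun_eq_iff intro!: sum.cong)
  show "has_dirichlet_series f (a(0 := 0)) \<and> (a(0 := 0)) 0 = 0"
    using assms by (simp add: has_dirichlet_series_def)
next
  fix b assume b: "has_dirichlet_series f b \<and> b 0 = 0"
  have eq: "dirichlet_partial (\<lambda>n. b n - a n) N s = dirichlet_partial b N s - dirichlet_partial a N s" for N s
    by (simp add: dirichlet_partial_def algebra_simps sum_subtractf)
  have "has_dirichlet_series (\<lambda>_. 0) (\<lambda>n. b n - a n)"
    unfolding has_dirichlet_series_def
  proof safe
    fix \<epsilon> :: real assume "\<epsilon> > 0"
    hence "uniform_limit {s. \<epsilon> < Re s} (\<lambda>N s. dirichlet_partial b N s - dirichlet_partial a N s)
             (\<lambda>s. f s - f s) sequentially"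
      using assms b by (intro uniform_limit_minus) (auto simp: has_dirichlet_series_def)
    thus "uniform_limit {s. \<epsilon> < Re s} (dirichlet_partial (\<lambda>n. b n - a n)) (\<lambda>_. 0) sequentially"
      by (simp add: eq[abs_def])
  qed
  from dirichlet_null[OF this] b show "b = a(0 := 0)"
    by (auto simp: fun_eq_iff)
qed

end

theory Submission
  imports Defs
begin

text \<open>
The proof avoids Gelfand theory: whenever an element \<open>f\<close> of one of the algebras is to be inverted, a logarithm \<open>A\<close> is
constructed within the algebra (within \<^const>\<open>Ou\<close>, in the case of \<^const>\<open>Hinf\<close>), and the inverse is \<open>exp (- A)\<close>. Thus the two kinds of
statements, on inverses and on exponentials, have a common source.

Everything is expressed by uniform approximation by Dirichlet polynomials on the right half-plane. The link to convergent
Dirichlet series is Bohr's theorem (\<open>bohr_inequality\<close>, \<open>bohr_limit\<close>): the partial sums of a Dirichlet polynomial are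
bounded, on each smaller half-plane, by a constant multiple of its supremum. Hence uniform limits of Dirichlet polynomials have
Dirichlet series that converge uniformly on smaller half-planes, with coefficients that depend continuously on the
function. Consequently \<^const>\<open>Adir\<close> is the algebra of uniform limits, and a function lies in \<^const>\<open>Ou\<close> if and only if all its shifts to
the right are such limits.

For a uniform limit \<open>F\<close> with \<open>\<bar>F\<bar> \<ge> \<delta> > 0\<close> the path of shifts \<open>F (s + t)\<close>, \<open>0 \<le> t < \<infinity>\<close>, joins \<open>F\<close> to a nonzero
constant, and logarithms are continued along it (\<open>dap_log\<close>). For absolutely convergent series this is combined with a
Cauchy estimate for functions that involve finitely many primes (\<open>wap_log\<close>). For bounded functions it is applied
to the shifts (\<open>has_series_log\<close>).

The algebra \<^const>\<open>Ob\<close> needs Bohr's correspondence. By Kronecker's theorem and the maximum principle, multiplying the coefficients by a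
completely multiplicative function of modulus at most 1 does not increase the supremum (\<open>twist_bound\<close>). The shift of \<open>f\<close> by
\<open>t\<close> is such a twist of the dilation \<open>f\<^sub>r\<close> with \<open>r = 2 powr (-t)\<close>; therefore invertible dilations make the shifts
bounded below (\<open>Ob_log\<close>). The resulting logarithm has bounded dilations because the dilations by complex numbers in the disc
are again twists, so that the Borel-Caratheodory inequality bounds the logarithm by its real part (\<open>Ob_log_bounded\<close>).

Invariance under permutations of the primes is a matter of coefficients. The coefficients of \<open>exp A\<close> are
given by the exponential series with respect to Dirichlet convolution, with which the permutations commute, and they determine the coefficients of
\<open>A\<close> apart from the first one, which is fixed by all permutations (\<open>exp_coefficients_inject\<close>).
\<close>

section \<open>Bohr's inequality for partial sums\<close>

text \<open>One majorant, up to a constant, for all the kernels that follow: the constant carries the dependence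
on the kernel, the decay exponent \<open>1 + d\<close> only has to exceed 1.\<close>
lemma integrable_power_tail:
  assumes "d > (0::real)"
  shows "integrable lborel (\<lambda>t::real. if \<bar>t\<bar> \<le> 1 then 1 else \<bar>t\<bar> powr (-1-d))"
proof -
  define g where "g = (\<lambda>t::real. t powr (-1-d) * indicator {1..} t)"
  have "(\<integral>\<^sup>+t. ennreal (t powr (-1-d)) * indicator {1..} t \<partial>lborel) = 0 - (-(1 powr (-d))/d)"
  proof (rule nn_integral_FTC_atLeast)
    show "((\<lambda>t. - (t powr (-d)) / d) \<longlongrightarrow> 0) at_top"
      using tendsto_divide[OF tendsto_minus[OF tendsto_neg_powr[OF _ filterlim_ident, of "-d"]] tendsto_const, of d] assms
      by simp
    show "DERIV (\<lambda>t. - (t powr (-d)) / d) t :> t powr (-1-d)" if "1 \<le> t" for t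
      using that assms by (auto intro!: derivative_eq_intros simp: field_simps powr_diff powr_minus)
  qed auto
  hence "(\<integral>\<^sup>+t. ennreal (g t) \<partial>lborel) < \<infinity>"
    by (simp add: g_def ennreal_indicator ennreal_mult' flip: ennreal_mult'')
  hence g: "integrable lborel g"
    by (intro integrableI_nonneg) (auto simp: g_def)
  have "integrable lborel (\<lambda>t. g (0 + (-1) * t))"
    by (rule lborel_integrable_real_affine[OF g]) simp
  hence g': "integrable lborel (\<lambda>t. g (- t))" by simp
  have "integrable lborel (indicator {-1..1::real} :: real \<Rightarrow> real)" by simp
  from Bochner_Integration.integrable_add[OF this Bochner_Integration.integrable_add[OF g g']]
  show ?thesis
    by (rule Bochner_Integration.integrable_bound)
       (auto simp: g_def indicator_def)
qed

lemma one_minus_cos_le: "1 - cos x \<le> x\<^sup>2 / 2" for x :: real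
proof -
  have "1 - cos x = 2 * (sin (x/2))\<^sup>2"
    using cos_double_sin[of "x/2"] by simp
  also have "(sin (x/2))\<^sup>2 \<le> (x/2)\<^sup>2"
    using abs_sin_x_le_abs_x[of "x/2"] by (simp only: abs_le_square_iff)
  finally show ?thesis by (simp add: power2_eq_square)
qed

lemma integrable_cos_kernel: "integrable lborel (\<lambda>t::real. (1 - cos t) / t\<^sup>2)"
proof (rule Bochner_Integration.integrable_bound)
  show "integrable lborel (\<lambda>t::real. 2 * (if \<bar>t\<bar> \<le> 1 then 1 else \<bar>t\<bar> powr (-1-1)))"
    by (intro Bochner_Integration.integrable_mult_right integrable_power_tail) auto
  have "norm ((1 - cos t) / t\<^sup>2) \<le> norm (2 * (if \<bar>t\<bar> \<le> 1 then 1 else \<bar>t\<bar> powr (-1-1)))" for t :: real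
  proof (cases "\<bar>t\<bar> \<le> 1")
    case True
    moreover have "1 - cos t \<le> 2 * t\<^sup>2"
      using one_minus_cos_le[of t] zero_le_power2[of t] by linarith
    ultimately show ?thesis by (cases "t = 0") (auto simp: divide_simps)
  next
    case False
    have "\<bar>t\<bar> powr (-2) = inverse (t\<^sup>2)"
      using False by (simp add: powr_minus powr_realpow)
    moreover have "0 \<le> 1 + cos t" using cos_ge_minus_one[of t] by linarith
    ultimately show ?thesis using False by (auto simp: field_simps)
  qed
  thus "AE t::real in lborel. norm ((1 - cos t) / t\<^sup>2) \<le> norm (2 * (if \<bar>t\<bar> \<le> 1 then 1 else \<bar>t\<bar> powr (-1-1)) :: real)"
    by (intro AE_I2)
qed measurable

text \<open>The normalising constant of the kernels below (its value is \<open>\<pi>\<close>).\<close>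
definition cos_mass :: real where "cos_mass = (\<integral>t. (1 - cos t) / t\<^sup>2 \<partial>lborel)"

lemma cos_mass_pos: "cos_mass > 0"
proof -
  have c1: "cos (1::real) < 1"
    using cos_monotone_0_pi[of 0 1] pi_gt3 by simp
  have "0 < (1 - cos 1) / (4::real)" using c1 by simp
  also have "\<dots> = (\<integral>t. (1 - cos 1) / 4 * indicator {1..2::real} t \<partial>lborel)"
    by simp
  also have "\<dots> \<le> cos_mass"
    unfolding cos_mass_def
  proof (rule integral_mono[OF _ integrable_cos_kernel])
    fix t :: real
    show "(1 - cos 1) / 4 * indicator {1..2::real} t \<le> (1 - cos t) / t\<^sup>2"
    proof (cases "t \<in> {1..2}")
      case True
      have "cos t \<le> cos 1" using True pi_gt3 by (intro cos_monotone_0_pi_le) auto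
      moreover have "t\<^sup>2 \<le> 2\<^sup>2" using True by (intro power_mono) auto
      ultimately have "(1 - cos 1) / 4 \<le> (1 - cos t) / t\<^sup>2"
        using c1 True by (intro frac_le) auto
      thus ?thesis using True by simp
    qed simp
  qed simp
  finally show ?thesis .
qed

text \<open>Substituting \<open>a * t\<close> for \<open>t\<close> shows how the integral scales. Since \<open>\<bar>a\<bar>\<close> comes out, every even piecewise
linear function of compact support is the cosine transform of an explicit kernel.\<close>
lemma has_integral_cos_kernel:
  "has_bochner_integral lborel (\<lambda>t. (1 - cos (a * t)) / t\<^sup>2) (\<bar>a\<bar> * cos_mass)" for a :: real
proof (cases "a = 0")
  case False
  have "has_bochner_integral lborel (\<lambda>t. (1 - cos t) / t\<^sup>2) cos_mass"
    unfolding cos_mass_def by (rule has_bochner_integral_integrable[OF integrable_cos_kernel])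
  from this[THEN lborel_has_bochner_integral_real_affine_iff[OF False, of _ _ 0, THEN iffD1]]
  have "has_bochner_integral lborel (\<lambda>t. (1 - cos (a * t)) / (a * t)\<^sup>2) (cos_mass /\<^sub>R \<bar>a\<bar>)"
    by simp
  from has_bochner_integral_mult_right[OF this, of "a\<^sup>2"]
  have "has_bochner_integral lborel (\<lambda>t. a\<^sup>2 * ((1 - cos (a * t)) / (a * t)\<^sup>2)) (a\<^sup>2 * (cos_mass /\<^sub>R \<bar>a\<bar>))"
    by simp
  moreover have "a\<^sup>2 * ((1 - cos (a * t)) / (a * t)\<^sup>2) = (1 - cos (a * t)) / t\<^sup>2" for t
    using False by (simp add: power_mult_distrib)
  moreover have "a\<^sup>2 * (cos_mass /\<^sub>R \<bar>a\<bar>) = \<bar>a\<bar> * cos_mass"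
  proof -
    have "a\<^sup>2 = \<bar>a\<bar> * \<bar>a\<bar>" by (simp add: power2_eq_square)
    thus ?thesis using False by (simp only: scaleR_conv_of_real) (simp add: field_simps)
  qed
  ultimately show ?thesis by (simp only:)
qed (simp add: has_bochner_integral_zero)

text \<open>Four shifted absolute values combine to a trapezoid: for \<open>0 \<le> L\<close> the value is 1 for \<open>\<bar>x\<bar> \<le> L\<close>, 0 for
\<open>\<bar>x\<bar> \<ge> L'\<close> and linear in between. With \<open>L = ln N\<close> and \<open>L' = ln (N + 1)\<close> no frequency \<open>ln n\<close> lies on the
slopes, so integration against this kernel cuts a Dirichlet polynomial off exactly after \<open>n = N\<close>.\<close>
lemma trapezoid_transform:
  fixes L L' x :: real
  assumes "L < L'"
  defines "K \<equiv> (\<lambda>t. (cos (L * t) - cos (L' * t)) / (cos_mass * (L' - L) * t\<^sup>2))"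
  shows "has_bochner_integral lborel (\<lambda>t. K t * cos (x * t))
           ((\<bar>L' - x\<bar> + \<bar>L' + x\<bar> - \<bar>L - x\<bar> - \<bar>L + x\<bar>) / (2 * (L' - L)))"
proof -
  define k where "k = 1 / (2 * cos_mass * (L' - L))"
  note I = has_integral_cos_kernel
  have "has_bochner_integral lborel
     (\<lambda>t. k * ((1 - cos ((L' - x) * t)) / t\<^sup>2 + (1 - cos ((L' + x) * t)) / t\<^sup>2
         - (1 - cos ((L - x) * t)) / t\<^sup>2 - (1 - cos ((L + x) * t)) / t\<^sup>2))
     (k * (\<bar>L' - x\<bar> * cos_mass + \<bar>L' + x\<bar> * cos_mass - \<bar>L - x\<bar> * cos_mass - \<bar>L + x\<bar> * cos_mass))"
    by (intro has_bochner_integral_mult_right has_bochner_integral_diff has_bochner_integral_add I)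
  moreover have "k * ((1 - cos ((L' - x) * t)) / t\<^sup>2 + (1 - cos ((L' + x) * t)) / t\<^sup>2
         - (1 - cos ((L - x) * t)) / t\<^sup>2 - (1 - cos ((L + x) * t)) / t\<^sup>2) = K t * cos (x * t)" for t
  proof -
    have sums: "cos ((L - x) * t) + cos ((L + x) * t) = 2 * cos (L * t) * cos (x * t)"
         "cos ((L' - x) * t) + cos ((L' + x) * t) = 2 * cos (L' * t) * cos (x * t)"
      by (simp_all add: algebra_simps cos_add cos_diff)
    define E where "E = cos (L * t) - cos (L' * t)"
    have "(cos ((L - x) * t) + cos ((L + x) * t) - (cos ((L' - x) * t) + cos ((L' + x) * t))) 
        = 2 * E * cos (x * t)" using sums by (simp add: algebra_simps E_def)
    moreover have "(1 - cos ((L' - x) * t)) / t\<^sup>2 + (1 - cos ((L' + x) * t)) / t\<^sup>2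
         - (1 - cos ((L - x) * t)) / t\<^sup>2 - (1 - cos ((L + x) * t)) / t\<^sup>2 =
         (cos ((L - x) * t) + cos ((L + x) * t) - (cos ((L' - x) * t) + cos ((L' + x) * t))) / t\<^sup>2"
      by (simp add: add_divide_distrib diff_divide_distrib)
    ultimately show ?thesis by (simp add: k_def K_def flip: E_def)
  qed
  moreover have "k * (\<bar>L' - x\<bar> * cos_mass + \<bar>L' + x\<bar> * cos_mass - \<bar>L - x\<bar> * cos_mass - \<bar>L + x\<bar> * cos_mass)
     = (\<bar>L' - x\<bar> + \<bar>L' + x\<bar> - \<bar>L - x\<bar> - \<bar>L + x\<bar>) / (2 * (L' - L))"
    using cos_mass_pos assms(1) by (simp add: k_def divide_simps) (simp add: algebra_simps)
  ultimately show ?thesis by simp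
qed

text \<open>The slopes have width \<open>h \<approx> 1 / N\<close>. The numerator is at most \<open>min 2 (h * \<bar>t\<bar>)\<close>, hence at most
\<open>2 * (h * \<bar>t\<bar>) powr (1 - d)\<close>, which costs a factor \<open>N powr d\<close> only and leaves the integrable majorant above.\<close>
lemma trapezoid_kernel_bound:
  fixes t d :: real and N :: nat
  assumes d: "0 < d" "d \<le> 1" and N: "N \<ge> 1"
  defines "L \<equiv> ln (real N)" and "L' \<equiv> ln (real (N + 1))"
  shows "\<bar>(cos (L * t) - cos (L' * t)) / (cos_mass * (L' - L) * t\<^sup>2)\<bar> \<le>
     (2 / (d * cos_mass) * real (N + 1) powr d) * (if \<bar>t\<bar> \<le> 1 then 1 else \<bar>t\<bar> powr (-1-d))"
proof -
  define h where "h = L' - L"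
  have L: "0 \<le> L" using N by (simp add: L_def)
  have hN: "h \<ge> 1 / real (N + 1)"
  proof -
    have "ln (real N / real (N+1)) \<le> real N / real (N+1) - 1"
      using N by (intro ln_le_minus_one) auto
    also have "\<dots> = - 1 / real (N + 1)" by (simp add: field_simps)
    also have "ln (real N / real (N+1)) = - h"
      using N unfolding h_def L_def L'_def by (subst ln_div) auto
    finally show ?thesis by simp
  qed
  hence h: "h > 0" by (rule less_le_trans[rotated]) auto
  have L': "L' \<le> real (N + 1) powr d / d"
    unfolding L'_def using d by (intro ln_powr_bound) auto
  have c: "cos_mass > 0" by (rule cos_mass_pos)
  have prod: "cos (L * t) - cos (L' * t) = 2 * sin ((L + L') * t / 2) * sin (h * t / 2)"
    unfolding cos_diff_cos by (simp add: h_def algebra_simps add_divide_distrib)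
  show ?thesis
  proof (cases "\<bar>t\<bar> \<le> 1")
    case True
    have "\<bar>cos (L * t) - cos (L' * t)\<bar> \<le> 2 * \<bar>(L + L') * t / 2\<bar> * \<bar>h * t / 2\<bar>"
      unfolding prod abs_mult by (intro mult_mono abs_sin_x_le_abs_x) auto
    also have "\<dots> = (L + L') * h * t\<^sup>2 / 2"
      using L h by (simp add: abs_mult power2_eq_square h_def)
    also have "\<dots> \<le> (L' + L') * h * t\<^sup>2 / 2"
      using h by (intro divide_right_mono mult_right_mono) (auto simp: h_def)
    finally have "\<bar>cos (L * t) - cos (L' * t)\<bar> \<le> L' * h * t\<^sup>2" by simp
    hence "\<bar>cos (L * t) - cos (L' * t)\<bar> / (cos_mass * h * t\<^sup>2) \<le> L' * h * t\<^sup>2 / (cos_mass * h * t\<^sup>2)"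
      using h c by (intro divide_right_mono) auto
    also have "\<dots> \<le> L' / cos_mass"
      using h c L by (cases "t = 0") (auto simp: h_def)
    finally have "\<bar>(cos (L * t) - cos (L' * t)) / (cos_mass * h * t\<^sup>2)\<bar> \<le> L' / cos_mass"
      using h c by (simp add: abs_mult)
    also have "\<dots> \<le> (real (N + 1) powr d / d) / cos_mass"
      using L' c by (intro divide_right_mono) auto
    also have "\<dots> \<le> 2 / (d * cos_mass) * real (N + 1) powr d"
      using d c by (simp add: field_simps)
    finally show ?thesis using True by (simp add: h_def)
  next
    case False
    hence t: "\<bar>t\<bar> > 1" "t \<noteq> 0" by auto
    define x where "x = h * \<bar>t\<bar>"
    have x: "x > 0" using h t by (auto simp: x_def)
    have "\<bar>cos (L * t) - cos (L' * t)\<bar> \<le> 2 * 1 * \<bar>h * t / 2\<bar>"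
      unfolding prod abs_mult by (intro mult_mono abs_sin_x_le_abs_x) (auto simp: abs_sin_le_one)
    hence 1: "\<bar>cos (L * t) - cos (L' * t)\<bar> \<le> x" using h by (simp add: x_def abs_mult)
    have 2: "\<bar>cos (L * t) - cos (L' * t)\<bar> \<le> 2"
      using abs_cos_le_one[of "L * t"] abs_cos_le_one[of "L' * t"] by linarith
    have "\<bar>cos (L * t) - cos (L' * t)\<bar> \<le> 2 * x powr (1 - d)"
    proof (cases "x \<le> 1")
      case True
      have "x powr 1 \<le> x powr (1 - d)" using True x d by (intro powr_mono') auto
      thus ?thesis using 1 x powr_ge_zero[of x "1-d"] by simp
    next
      case False
      have "1 \<le> x powr (1 - d)" using False d by (intro ge_one_powr_ge_zero) auto
      thus ?thesis using 2 by simp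
    qed
    also have "x powr (1 - d) = h powr (1 - d) * \<bar>t\<bar> powr (1 - d)"
      using h by (simp add: x_def powr_mult)
    finally have "\<bar>(cos (L * t) - cos (L' * t)) / (cos_mass * h * t\<^sup>2)\<bar> 
        \<le> 2 * (h powr (1 - d) * \<bar>t\<bar> powr (1 - d)) / (cos_mass * h * t\<^sup>2)"
      unfolding abs_divide using h c t by (intro frac_le) (auto simp: abs_mult zero_less_mult_iff)
    also have "\<dots> = 2 / cos_mass * (h powr (1-d) / h) * (\<bar>t\<bar> powr (1-d) / t\<^sup>2)"
      by simp
    also have "h powr (1-d) / h = h powr (-d)"
      using h powr_diff[of h "1-d" 1] by simp
    also have "\<bar>t\<bar> powr (1-d) / t\<^sup>2 = \<bar>t\<bar> powr (-1-d)"
      using t powr_diff[of "\<bar>t\<bar>" "1-d" 2] by (simp add: powr_realpow)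
    also have "2 / cos_mass * h powr (-d) * \<bar>t\<bar> powr (-1-d)
        \<le> 2 / (d * cos_mass) * real (N+1) powr d * \<bar>t\<bar> powr (-1-d)"
    proof (intro mult_right_mono mult_mono)
      have "h powr (-d) \<le> (1 / real (N+1)) powr (-d)"
        using hN d h by (intro powr_mono2') auto
      also have "\<dots> = real (N+1) powr d"
        by (simp add: powr_divide powr_minus field_simps)
      finally show "h powr (-d) \<le> real (N+1) powr d" .
      show "2 / cos_mass \<le> 2 / (d * cos_mass)" using d c by (simp add: field_simps)
    qed (use d c in auto)
    finally show ?thesis using t by (simp add: h_def)
  qed
qed

text \<open>Averaging the shifts by \<open>\<i> * t\<close> and \<open>- \<i> * t\<close> leaves cosines alone, so that only the cosine transform of the
kernel matters.\<close>
lemma cos_average_npow: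
  assumes "n \<ge> 1"
  shows "(of_nat n powr (-(s + \<i> * of_real t)) + of_nat n powr (-(s - \<i> * of_real t))) / 2
         = of_nat n powr (-s) * of_real (cos (ln (real n) * t))"
proof -
  have "of_nat n powr (-(s + \<i> * of_real t)) = of_nat n powr (-s) * exp (- (\<i> * of_real (ln (real n) * t)))"
       "of_nat n powr (-(s - \<i> * of_real t)) = of_nat n powr (-s) * exp (\<i> * of_real (ln (real n) * t))"
    using assms by (auto simp: powr_def exp_add [symmetric] Ln_of_nat algebra_simps)
  thus ?thesis by (simp add: cos_of_real[symmetric] cos_exp_eq field_simps)
qed

text \<open>The partial sum is the integral of the averaged vertical shifts of the polynomial against the trapezoid
kernel; the shifts are bounded by \<open>B\<close>, and the kernel has \<open>L\<^sup>1\<close> norm of order \<open>N powr d\<close>.\<close>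
lemma partial_sum_bound:
  assumes d: "0 < d" "d \<le> 1"
  shows "\<exists>C\<ge>0. \<forall>a M N B s. N \<le> M \<longrightarrow> (\<forall>s. Re s > 0 \<longrightarrow> cmod (dirichlet_partial a M s) \<le> B) \<longrightarrow> Re s > 0
           \<longrightarrow> cmod (dirichlet_partial a N s) \<le> C * real (N + 1) powr d * B"
proof -
  define w where "w = (\<lambda>t::real. if \<bar>t\<bar> \<le> 1 then 1 else \<bar>t\<bar> powr (-1-d))"
  have w: "integrable lborel w" unfolding w_def by (rule integrable_power_tail) fact
  have w0: "w t \<ge> 0" for t by (simp add: w_def)
  have c: "cos_mass > 0" by (rule cos_mass_pos)
  define C where "C = 2 / (d * cos_mass) * (\<integral>t. w t \<partial>lborel)"
  have C0: "C \<ge> 0" using d c w0 unfolding C_def by (intro mult_nonneg_nonneg) auto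
  have "cmod (dirichlet_partial a N s) \<le> C * real (N + 1) powr d * B"
    if NM: "N \<le> M" and B: "\<And>s. Re s > 0 \<Longrightarrow> cmod (dirichlet_partial a M s) \<le> B" and s: "Re s > 0" for a M N B s
  proof (cases "N = 0")
    case True
    have "B \<ge> 0" using B[OF s] norm_ge_zero order_trans by blast
    thus ?thesis using True C0 by (simp add: dirichlet_partial_def)
  next
    case False
    hence N: "N \<ge> 1" by simp
    define L L' where "L = ln (real N)" and "L' = ln (real (N + 1))"
    have LL: "L < L'" "L \<ge> 0" using N by (auto simp: L_def L'_def)
    define K where "K = (\<lambda>t. (cos (L * t) - cos (L' * t)) / (cos_mass * (L' - L) * t\<^sup>2))"
    define A where "A = (\<lambda>t. (dirichlet_partial a M (s + \<i> * of_real t) + dirichlet_partial a M (s - \<i> * of_real t)) / 2)"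
    have A_bound: "cmod (A t) \<le> B" for t
    proof -
      have "cmod (A t) \<le> (cmod (dirichlet_partial a M (s + \<i> * of_real t)) + cmod (dirichlet_partial a M (s - \<i> * of_real t))) / 2"
        unfolding A_def by (simp add: norm_divide norm_triangle_ineq)
      also have "\<dots> \<le> B" using B[of "s + \<i> * of_real t"] B[of "s - \<i> * of_real t"] s by simp
      finally show ?thesis .
    qed
    have A_eq: "A t = (\<Sum>n=1..M. a n * of_nat n powr (-s) * of_real (cos (ln (real n) * t)))" for t
    proof -
      have "A t = (\<Sum>n=1..M. a n * ((of_nat n powr (-(s + \<i> * of_real t)) + of_nat n powr (-(s - \<i> * of_real t))) / 2))"
        unfolding A_def dirichlet_partial_def by (simp add: sum.distrib sum_divide_distrib distrib_left add_divide_distrib)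
      also have "\<dots> = (\<Sum>n=1..M. a n * (of_nat n powr (-s) * of_real (cos (ln (real n) * t))))"
        by (intro sum.cong refl arg_cong2[of _ _ _ _ "(*)"] cos_average_npow) auto
      finally show ?thesis by (simp add: mult.assoc)
    qed
    have T: "has_bochner_integral lborel (\<lambda>t. K t * cos (ln (real n) * t)) (if n \<le> N then 1 else 0)" if "n \<ge> 1" for n
    proof -
      define x where "x = ln (real n)"
      have x: "x \<ge> 0" using that by (simp add: x_def)
      have "(\<bar>L' - x\<bar> + \<bar>L' + x\<bar> - \<bar>L - x\<bar> - \<bar>L + x\<bar>) / (2 * (L' - L)) = (if n \<le> N then 1 else 0)"
      proof (cases "n \<le> N")
        case True
        hence "x \<le> L" using that by (simp add: x_def L_def)
        thus ?thesis using True LL x by simp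
      next
        case False
        hence "x \<ge> L'" using that N unfolding x_def L'_def by (subst ln_le_cancel_iff) auto
        thus ?thesis using False LL x by simp
      qed
      with trapezoid_transform[OF LL(1), of x] show ?thesis unfolding K_def x_def by simp
    qed
    have "has_bochner_integral lborel (\<lambda>t. \<Sum>n=1..M. (a n * of_nat n powr (-s)) * of_real (K t * cos (ln (real n) * t)))
            (\<Sum>n=1..M. (a n * of_nat n powr (-s)) * of_real (if n \<le> N then 1 else 0))"
      by (intro has_bochner_integral_sum has_bochner_integral_mult_right has_bochner_integral_of_real T) auto
    also have "(\<lambda>t. \<Sum>n=1..M. (a n * of_nat n powr (-s)) * of_real (K t * cos (ln (real n) * t))) = (\<lambda>t. of_real (K t) * A t)"
      unfolding A_eq sum_distrib_left by (simp add: mult_ac)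
    also have "(\<Sum>n=1..M. (a n * of_nat n powr (-s)) * of_real (if n \<le> N then 1 else 0)) = dirichlet_partial a N s"
      unfolding dirichlet_partial_def using NM
      by (intro sum.mono_neutral_cong_right) auto
    finally have I: "has_bochner_integral lborel (\<lambda>t. of_real (K t) * A t) (dirichlet_partial a N s)" .
    have "cmod (dirichlet_partial a N s) = cmod (\<integral>t. of_real (K t) * A t \<partial>lborel)"
      using I by (simp add: has_bochner_integral_iff)
    also have "\<dots> \<le> (\<integral>t. cmod (of_real (K t) * A t) \<partial>lborel)"
      by (rule integral_norm_bound)
    also have "\<dots> \<le> (\<integral>t. (2 / (d * cos_mass) * real (N + 1) powr d * w t) * B \<partial>lborel)"
    proof (rule integral_mono)
      show "integrable lborel (\<lambda>t. cmod (of_real (K t) * A t))"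
        using I by (intro integrable_norm) (rule integrable.intros)
      show "integrable lborel (\<lambda>t. (2 / (d * cos_mass) * real (N + 1) powr d * w t) * B)"
        using w by (intro Bochner_Integration.integrable_mult_left Bochner_Integration.integrable_mult_right)
      fix t :: real
      have "\<bar>K t\<bar> \<le> 2 / (d * cos_mass) * real (N + 1) powr d * w t"
        unfolding K_def L_def L'_def w_def by (rule trapezoid_kernel_bound[OF d N])
      thus "cmod (of_real (K t) * A t) \<le> (2 / (d * cos_mass) * real (N + 1) powr d * w t) * B"
        unfolding norm_mult norm_of_real using A_bound[of t] by (intro mult_mono) (auto simp: w0 order_trans[OF abs_ge_zero])
    qed
    also have "\<dots> = C * real (N + 1) powr d * B" by (simp add: C_def)
    finally show ?thesis .
  qed
  thus ?thesis using C0 by blast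
qed

text \<open>The factor \<open>N powr d\<close> of the previous bound is absorbed by moving to the right by \<open>2 * d\<close> and summing by
parts. With \<open>x j = j powr (-d)\<close> the weights are \<open>(x j)\<^sup>2 - (x (j+1))\<^sup>2\<close>, while the partial sums grow like
\<open>1 / x (j+1)\<close>; the quotient is of order \<open>x j - x (j+1)\<close>, so the sum telescopes. The constant does not depend on
the polynomial, nor on the place of the cut.\<close>
theorem bohr_inequality:
  assumes e: "e > 0"
  shows "\<exists>C\<ge>0. \<forall>a M N B s. N \<le> M \<longrightarrow> (\<forall>s. Re s > 0 \<longrightarrow> cmod (dirichlet_partial a M s) \<le> B) \<longrightarrow> Re s > e
           \<longrightarrow> cmod (dirichlet_partial a N s) \<le> C * B"
proof -
  define d where "d = min 1 (e / 2)"
  have d: "0 < d" "d \<le> 1" "2 * d \<le> e" using e by (auto simp: d_def)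
  obtain C where C: "C \<ge> 0" "\<And>a M N B s. N \<le> M \<Longrightarrow> (\<And>s. Re s > 0 \<Longrightarrow> cmod (dirichlet_partial a M s) \<le> B) \<Longrightarrow> Re s > 0
           \<Longrightarrow> cmod (dirichlet_partial a N s) \<le> C * real (N + 1) powr d * B"
    using partial_sum_bound[OF d(1,2)] by blast
  have "cmod (dirichlet_partial a N s) \<le> 5 * C * B"
    if NM: "N \<le> M" and B: "\<And>s. Re s > 0 \<Longrightarrow> cmod (dirichlet_partial a M s) \<le> B" and s: "Re s > e" for a M N B s
  proof -
    define z where "z = s - of_real (2 * d)"
    have z: "Re z > 0" using s d by (simp add: z_def)
    have B0: "B \<ge> 0" using B[OF z] norm_ge_zero order_trans by blast
    define S where "S = (\<lambda>n. dirichlet_partial a n z)"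
    define x where "x = (\<lambda>n::nat. real n powr (-d))"
    have S: "cmod (S n) \<le> C * real (n + 1) powr d * B" if "n \<le> N" for n
      unfolding S_def using C(2)[OF order_trans[OF that NM] B z] by simp
    have term_eq: "a n * of_nat n powr (-s) = (S n - S (n - 1)) * of_real ((x n)\<^sup>2)" if "n \<ge> 1" for n
    proof -
      have "S n - S (n - 1) = a n * of_nat n powr (-z)"
        using that by (cases n) (auto simp: S_def dirichlet_partial_def)
      moreover have "of_real ((x n)\<^sup>2) = (of_nat n powr (- of_real (2 * d)) :: complex)"
      proof -
        have "(x n)\<^sup>2 = real n powr (- (2 * d))"
          by (simp add: x_def power2_eq_square powr_add[symmetric])
        thus ?thesis using that by (simp add: powr_of_real[symmetric])
      qed
      ultimately show ?thesis by (simp add: z_def powr_add[symmetric])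
    qed
    \<comment> \<open>summation by parts; the constant term of the sum is \<open>S 0 = 0\<close>\<close>
    have abel: "dirichlet_partial a n s = S n * of_real ((x n)\<^sup>2) + (\<Sum>j=1..<n. S j * of_real ((x j)\<^sup>2 - (x (Suc j))\<^sup>2))" for n
    proof (induction n)
      case 0
      thus ?case by (simp add: dirichlet_partial_def S_def)
    next
      case (Suc n)
      have "dirichlet_partial a (Suc n) s = dirichlet_partial a n s + (S (Suc n) - S n) * of_real ((x (Suc n))\<^sup>2)"
        using term_eq[of "Suc n"] by (simp add: dirichlet_partial_def)
      also note Suc.IH
      finally show ?case
        by (cases "n = 0") (auto simp: algebra_simps S_def dirichlet_partial_def)
    qed
    have x_pos: "x n > 0" if "n \<ge> 1" for n using that by (simp add: x_def)
    have x_le: "x n \<le> 1" if "n \<ge> 1" for n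
      using that d powr_mono[of "-d" 0 "real n"] by (simp add: x_def)
    have x_mono: "x (Suc n) \<le> x n" if "n \<ge> 1" for n
      using that d unfolding x_def by (intro powr_mono2') auto
    have x_half: "real (n + 1) powr d * x n \<le> 2" if "n \<ge> 1" for n
    proof -
      have "real (n + 1) powr d \<le> (2 * real n) powr d" using that d by (intro powr_mono2) auto
      also have "\<dots> = 2 powr d * real n powr d" by (simp add: powr_mult)
      also have "2 powr d \<le> 2 powr (1::real)" using d by (intro powr_mono) auto
      finally have "real (n + 1) powr d * x n \<le> 2 * real n powr d * x n"
        by (intro mult_right_mono) (auto simp: x_def mult_right_mono)
      moreover have "real n powr d > 0" using that by simp
      ultimately show ?thesis using that by (simp add: x_def powr_minus divide_simps)
    qed
    have 1: "cmod (S n * of_real ((x n)\<^sup>2)) \<le> 2 * C * B" if "n \<le> N" for n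
    proof (cases "n = 0")
      case False
      hence n: "n \<ge> 1" by simp
      have "cmod (S n * of_real ((x n)\<^sup>2)) \<le> (C * real (n + 1) powr d * B) * (x n)\<^sup>2"
        using S[OF that] unfolding norm_mult norm_of_real abs_power2 by (intro mult_right_mono) auto
      also have "\<dots> = C * B * (real (n + 1) powr d * x n) * x n" by (simp add: power2_eq_square)
      also have "\<dots> \<le> C * B * 2 * 1"
        using x_half[OF n] x_le[OF n] x_pos[OF n] C B0 by (intro mult_mono) auto
      finally show ?thesis by simp
    qed (use C B0 in \<open>auto simp: x_def\<close>)
    have 2: "cmod (S j * of_real ((x j)\<^sup>2 - (x (Suc j))\<^sup>2)) \<le> 3 * C * B * (x j - x (Suc j))"
      if "j \<ge> 1" "j < N" for j
    proof -
      have "(x j)\<^sup>2 - (x (Suc j))\<^sup>2 = (x j + x (Suc j)) * (x j - x (Suc j))"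
        by (simp add: power2_eq_square algebra_simps)
      hence eq: "\<bar>(x j)\<^sup>2 - (x (Suc j))\<^sup>2\<bar> = (x j + x (Suc j)) * (x j - x (Suc j))"
        using x_mono[of j] x_pos[of j] x_pos[of "Suc j"] that by simp
      have "real (j + 1) powr d * x (Suc j) = 1"
        by (simp add: x_def powr_minus)
      hence *: "real (j + 1) powr d * (x j + x (Suc j)) \<le> 3"
        using x_half[of j] that by (simp add: distrib_left)
      have "cmod (S j * of_real ((x j)\<^sup>2 - (x (Suc j))\<^sup>2)) \<le> (C * real (j + 1) powr d * B) * ((x j + x (Suc j)) * (x j - x (Suc j)))"
        unfolding norm_mult norm_of_real eq using S[of j] that x_mono[of j] x_pos[of j] x_pos[of "Suc j"]
        by (intro mult_right_mono) auto
      also have "\<dots> = C * B * (real (j + 1) powr d * (x j + x (Suc j))) * (x j - x (Suc j))" by simp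
      also have "\<dots> \<le> C * B * 3 * (x j - x (Suc j))"
        using * C B0 x_mono[of j] that by (intro mult_right_mono mult_left_mono) auto
      finally show ?thesis by simp
    qed
    have "cmod (dirichlet_partial a N s) \<le> cmod (S N * of_real ((x N)\<^sup>2)) + (\<Sum>j=1..<N. cmod (S j * of_real ((x j)\<^sup>2 - (x (Suc j))\<^sup>2)))"
      unfolding abel[of N] by (intro order_trans[OF norm_triangle_ineq] add_left_mono sum_norm_le) simp
    also have "\<dots> \<le> 2 * C * B + (\<Sum>j=1..<N. 3 * C * B * (x j - x (Suc j)))"
      using 1[of N] 2 by (intro add_mono sum_mono) auto
    also have "(\<Sum>j=1..<N. 3 * C * B * (x j - x (Suc j))) \<le> 3 * C * B"
    proof (cases "N \<ge> 1")
      case True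
      have "(\<Sum>j=1..<N. x j - x (Suc j)) = x 1 - x N"
        using sum_Suc_diff'[OF True, of "\<lambda>j. - x j"] by simp
      also have "\<dots> \<le> 1" using x_pos[OF True] by (simp add: x_def)
      finally show ?thesis using C B0 by (simp add: sum_distrib_left[symmetric] mult_left_le)
    qed (use C B0 in auto)
    finally show ?thesis by (simp add: algebra_simps)
  qed
  thus ?thesis using C(1) by (intro exI[of _ "5 * C"]) auto
qed

section \<open>Uniform approximation by Dirichlet polynomials\<close>

lemma norm_npow: "n \<ge> 1 \<Longrightarrow> cmod (of_nat n powr (-s)) = real n powr (- Re s)"
  using norm_powr_real_powr[of "of_nat n" "-s"] by simp

lemma norm_npow_le_1: "n \<ge> 1 \<Longrightarrow> Re s \<ge> 0 \<Longrightarrow> cmod (of_nat n powr (-s)) \<le> 1"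
  using powr_mono[of "- Re s" 0 "real n"] by (simp add: norm_npow)

lemma dirichlet_partial_norm_le:
  "Re s \<ge> 0 \<Longrightarrow> cmod (dirichlet_partial a N s) \<le> (\<Sum>n=1..N. cmod (a n))"
  unfolding dirichlet_partial_def
  by (intro sum_norm_le) (auto simp: norm_mult intro!: mult_left_le norm_npow_le_1)

lemma dirichlet_partial_shift:
  "dirichlet_partial a N (s + z) = dirichlet_partial (\<lambda>n. a n * of_nat n powr (-z)) N s"
  unfolding dirichlet_partial_def
  by (intro sum.cong refl) (simp add: powr_diff powr_minus field_simps powr_add)

lemma dirichlet_partial_diff:
  "dirichlet_partial a N s - dirichlet_partial b N s = dirichlet_partial (\<lambda>n. a n - b n) N s"
  by (simp add: dirichlet_partial_def algebra_simps sum_subtractf)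

lemma dirichlet_partial_extend:
  assumes "\<And>n. n > N \<Longrightarrow> a n = 0" "N \<le> K"
  shows "dirichlet_partial a K s = dirichlet_partial a N s"
  unfolding dirichlet_partial_def using assms by (intro sum.mono_neutral_right) auto

lemma dirichlet_partial_cong:
  "(\<And>n. 1 \<le> n \<Longrightarrow> n \<le> N \<Longrightarrow> a n = b n) \<Longrightarrow> dirichlet_partial a N s = dirichlet_partial b N s"
  unfolding dirichlet_partial_def by (intro sum.cong) auto

lemma npow_mult: "of_nat (m * n) powr z = (of_nat m powr z * of_nat n powr z :: complex)"
  using powr_times_real[of "of_nat m" "of_nat n" z] by simp

definition trunc :: "nat \<Rightarrow> (nat \<Rightarrow> complex) \<Rightarrow> nat \<Rightarrow> complex" where
  "trunc N a n = (if n \<le> N then a n else 0)"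

lemma dirichlet_partial_trunc: "N \<le> K \<Longrightarrow> dirichlet_partial (trunc N a) K s = dirichlet_partial a N s"
  by (subst dirichlet_partial_extend[of N]) (auto simp: trunc_def intro!: dirichlet_partial_cong)

lemma sum_norm_trunc: "N \<le> K \<Longrightarrow> (\<Sum>n=1..K. cmod (trunc N a n)) = (\<Sum>n=1..N. cmod (a n))"
  by (rule sum.mono_neutral_cong_right) (auto simp: trunc_def)

definition mult_closed :: "nat set \<Rightarrow> bool" where
  "mult_closed S \<longleftrightarrow> 1 \<in> S \<and> (\<forall>m\<in>S. \<forall>n\<in>S. m * n \<in> S)"

lemma mult_closed_UNIV [simp]: "mult_closed UNIV" by (simp add: mult_closed_def)

text \<open>The support \<open>S\<close>, the bound \<open>M\<close> for the absolute sum of the coefficients and the error \<open>e\<close> are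
separate parameters, so that one set of closure properties serves the two notions that follow. A support smaller
than \<open>UNIV\<close> occurs in Wiener's lemma, where only finitely many primes are involved.\<close>
definition near :: "nat set \<Rightarrow> real \<Rightarrow> real \<Rightarrow> (complex \<Rightarrow> complex) \<Rightarrow> bool" where
  "near S M e F \<longleftrightarrow> (\<exists>a N. (\<forall>n. n \<notin> S \<longrightarrow> a n = 0) \<and> (\<Sum>n=1..N. cmod (a n)) \<le> M \<and>
     (\<forall>s. Re s > 0 \<longrightarrow> cmod (F s - dirichlet_partial a N s) \<le> e))"

text \<open>Dirichlet almost periodic functions: uniform limits on the half-plane of Dirichlet polynomials with frequencies
in \<open>S\<close>. For \<open>S = UNIV\<close> this is the algebra \<^const>\<open>Adir\<close>.\<close>
definition dap :: "nat set \<Rightarrow> (complex \<Rightarrow> complex) \<Rightarrow> bool" where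
  "dap S F \<longleftrightarrow> (\<forall>e>0. \<exists>M. near S M e F)"

text \<open>The approximating polynomials now have coefficient sums bounded by a fixed \<open>M\<close>: for \<open>S = UNIV\<close> this is the closed
ball of radius \<open>M\<close> in \<^const>\<open>Wie\<close>. In this form the ball is visibly closed under uniform limits, and products and
series of its members need no rearrangement of double series.\<close>
definition wap :: "nat set \<Rightarrow> real \<Rightarrow> (complex \<Rightarrow> complex) \<Rightarrow> bool" where
  "wap S M F \<longleftrightarrow> (\<forall>e>0. near S M e F)"

lemma nearI:
  assumes "\<And>n. n \<notin> S \<Longrightarrow> a n = 0" "(\<Sum>n=1..N. cmod (a n)) \<le> M"
    "\<And>s. Re s > 0 \<Longrightarrow> cmod (F s - dirichlet_partial a N s) \<le> e"
  shows "near S M e F"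
  using assms unfolding near_def by blast

lemma nearE:
  assumes "near S M e F"
  obtains a N where "\<And>n. n \<notin> S \<Longrightarrow> a n = 0" "(\<Sum>n=1..N. cmod (a n)) \<le> M"
    "\<And>s. Re s > 0 \<Longrightarrow> cmod (F s - dirichlet_partial a N s) \<le> e"
  using assms unfolding near_def by blast

lemma near_cong:
  "(\<And>s. Re s > 0 \<Longrightarrow> F s = G s) \<Longrightarrow> near S M e F \<longleftrightarrow> near S M e G"
  by (simp add: near_def cong: conj_cong imp_cong)

lemma dap_cong: "(\<And>s. Re s > 0 \<Longrightarrow> F s = G s) \<Longrightarrow> dap S F \<longleftrightarrow> dap S G"
  unfolding dap_def by (simp add: near_cong[of F G])

lemma wap_cong: "(\<And>s. Re s > 0 \<Longrightarrow> F s = G s) \<Longrightarrow> wap S M F \<longleftrightarrow> wap S M G"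
  unfolding wap_def by (simp add: near_cong[of F G])

lemma near_approx:
  assumes "near S M e G" "\<And>s. Re s > 0 \<Longrightarrow> cmod (F s - G s) \<le> e'"
  shows "near S M (e + e') F"
proof -
  from assms(1) obtain a N where a: "\<And>n. n \<notin> S \<Longrightarrow> a n = 0" "(\<Sum>n=1..N. cmod (a n)) \<le> M"
    "\<And>s. Re s > 0 \<Longrightarrow> cmod (G s - dirichlet_partial a N s) \<le> e" by (rule nearE) blast
  show ?thesis
  proof (rule nearI[OF a(1,2)])
    fix s :: complex assume s: "Re s > 0"
    show "cmod (F s - dirichlet_partial a N s) \<le> e + e'"
      using norm_triangle_ineq[of "F s - G s" "G s - dirichlet_partial a N s"] a(3)[OF s] assms(2)[OF s] by simp
  qed
qed

lemma near_mono: "near S M e F \<Longrightarrow> M \<le> M' \<Longrightarrow> e \<le> e' \<Longrightarrow> S \<subseteq> S' \<Longrightarrow> near S' M' e' F"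
  unfolding near_def by (meson order_trans subsetD)

lemma near_poly:
  assumes "\<And>n. n \<notin> S \<Longrightarrow> a n = 0" "e \<ge> 0"
  shows "near S (\<Sum>n=1..N. cmod (a n)) e (dirichlet_partial a N)"
  using assms by (intro nearI[of _ a N]) auto

lemma near_add:
  assumes "near S M e F" "near S M' e' G"
  shows "near S (M + M') (e + e') (\<lambda>s. F s + G s)"
proof -
  from assms(1) obtain a N where a: "\<And>n. n \<notin> S \<Longrightarrow> a n = 0" "(\<Sum>n=1..N. cmod (a n)) \<le> M"
    "\<And>s. Re s > 0 \<Longrightarrow> cmod (F s - dirichlet_partial a N s) \<le> e" by (rule nearE) blast
  from assms(2) obtain b K where b: "\<And>n. n \<notin> S \<Longrightarrow> b n = 0" "(\<Sum>n=1..K. cmod (b n)) \<le> M'"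
    "\<And>s. Re s > 0 \<Longrightarrow> cmod (G s - dirichlet_partial b K s) \<le> e'" by (rule nearE) blast
  define L where "L = max N K"
  define c where "c = (\<lambda>n. trunc N a n + trunc K b n)"
  have eq: "dirichlet_partial c L s = dirichlet_partial a N s + dirichlet_partial b K s" for s
    using dirichlet_partial_trunc[of N L a s] dirichlet_partial_trunc[of K L b s]
    by (simp add: c_def dirichlet_partial_def L_def distrib_right sum.distrib)
  show ?thesis
  proof (rule nearI)
    show "c n = 0" if "n \<notin> S" for n using a(1) b(1) that by (simp add: c_def trunc_def)
    have "(\<Sum>n=1..L. cmod (c n)) \<le> (\<Sum>n=1..L. cmod (trunc N a n)) + (\<Sum>n=1..L. cmod (trunc K b n))"
      unfolding c_def sum.distrib[symmetric] by (intro sum_mono norm_triangle_ineq)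
    also have "\<dots> \<le> M + M'"
      using a(2) b(2) sum_norm_trunc[of N L a] sum_norm_trunc[of K L b] by (simp add: L_def)
    finally show "(\<Sum>n=1..L. cmod (c n)) \<le> M + M'" .
    fix s :: complex assume s: "Re s > 0"
    show "cmod (F s + G s - dirichlet_partial c L s) \<le> e + e'"
      unfolding eq using norm_triangle_ineq[of "F s - dirichlet_partial a N s" "G s - dirichlet_partial b K s"] a(3)[OF s] b(3)[OF s]
      by (simp add: algebra_simps)
  qed
qed

definition poly_conv :: "nat \<Rightarrow> nat \<Rightarrow> (nat \<Rightarrow> complex) \<Rightarrow> (nat \<Rightarrow> complex) \<Rightarrow> nat \<Rightarrow> complex" where
  "poly_conv N K a b n = (\<Sum>p\<in>{p \<in> {1..N} \<times> {1..K}. fst p * snd p = n}. a (fst p) * b (snd p))"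

lemma dirichlet_partial_mult:
  fixes N K :: nat and a b :: "nat \<Rightarrow> complex"
  defines "c \<equiv> poly_conv N K a b"
  shows "dirichlet_partial a N s * dirichlet_partial b K s = dirichlet_partial c (N * K) s"
    and "(\<Sum>n=1..N*K. cmod (c n)) \<le> (\<Sum>n=1..N. cmod (a n)) * (\<Sum>n=1..K. cmod (b n))"
proof -
  let ?X = "{1..N} \<times> {1..K}"
  have sub: "(\<lambda>p. fst p * snd p) ` ?X \<subseteq> {1..N*K}"
    by (auto intro: mult_le_mono simp: Suc_le_eq)
  have "dirichlet_partial a N s * dirichlet_partial b K s =
      (\<Sum>p\<in>?X. (a (fst p) * b (snd p)) * of_nat (fst p * snd p) powr (-s))"
    unfolding dirichlet_partial_def sum_product sum.cartesian_product
    by (intro sum.cong refl) (auto simp: npow_mult mult_ac simp del: of_nat_mult)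
  also have "\<dots> = (\<Sum>n\<in>{1..N*K}. \<Sum>p\<in>{p \<in> ?X. fst p * snd p = n}. (a (fst p) * b (snd p)) * of_nat (fst p * snd p) powr (-s))"
    by (rule sum.group[symmetric]) (use sub in auto)
  also have "\<dots> = dirichlet_partial c (N * K) s"
    unfolding dirichlet_partial_def c_def poly_conv_def sum_distrib_right by (intro sum.cong refl) auto
  finally show "dirichlet_partial a N s * dirichlet_partial b K s = dirichlet_partial c (N * K) s" .
  have "(\<Sum>n=1..N*K. cmod (c n)) \<le> (\<Sum>n\<in>{1..N*K}. \<Sum>p\<in>{p \<in> ?X. fst p * snd p = n}. cmod (a (fst p)) * cmod (b (snd p)))"
    unfolding c_def poly_conv_def by (intro sum_mono sum_norm_le) (simp add: norm_mult)
  also have "\<dots> = (\<Sum>p\<in>?X. cmod (a (fst p)) * cmod (b (snd p)))"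
    by (rule sum.group) (use sub in auto)
  also have "\<dots> = (\<Sum>n=1..N. cmod (a n)) * (\<Sum>n=1..K. cmod (b n))"
    unfolding sum_product sum.cartesian_product by (intro sum.cong refl) auto
  finally show "(\<Sum>n=1..N*K. cmod (c n)) \<le> (\<Sum>n=1..N. cmod (a n)) * (\<Sum>n=1..K. cmod (b n))" .
qed

lemma near_mult:
  assumes S: "mult_closed S" and F: "near S M e F" and G: "near S M' e' G"
    and B: "\<And>s. Re s > 0 \<Longrightarrow> cmod (F s) \<le> B" and B': "\<And>s. Re s > 0 \<Longrightarrow> cmod (G s) \<le> B'"
  shows "near S (M * M') (e * B' + (B + e) * e') (\<lambda>s. F s * G s)"
proof -
  from F obtain a N where a: "\<And>n. n \<notin> S \<Longrightarrow> a n = 0" "(\<Sum>n=1..N. cmod (a n)) \<le> M"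
    "\<And>s. Re s > 0 \<Longrightarrow> cmod (F s - dirichlet_partial a N s) \<le> e" by (rule nearE) blast
  from G obtain b K where b: "\<And>n. n \<notin> S \<Longrightarrow> b n = 0" "(\<Sum>n=1..K. cmod (b n)) \<le> M'"
    "\<And>s. Re s > 0 \<Longrightarrow> cmod (G s - dirichlet_partial b K s) \<le> e'" by (rule nearE) blast
  define c where "c = poly_conv N K a b"
  note c = dirichlet_partial_mult[where a = a and N = N and b = b and K = K, folded c_def]
  show ?thesis
  proof (rule nearI)
    show "c n = 0" if "n \<notin> S" for n
      unfolding c_def poly_conv_def using a(1) b(1) that S by (intro sum.neutral) (auto simp: mult_closed_def)
    have "(\<Sum>n=1..N*K. cmod (c n)) \<le> (\<Sum>n=1..N. cmod (a n)) * (\<Sum>n=1..K. cmod (b n))" by (rule c(2))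
    also have "\<dots> \<le> M * M'"
      using a(2) b(2) order_trans[OF sum_nonneg a(2)] by (intro mult_mono sum_nonneg) auto
    finally show "(\<Sum>n=1..N*K. cmod (c n)) \<le> M * M'" .
    fix s :: complex assume s: "Re s > 0"
    define P Q where "P = dirichlet_partial a N s" and "Q = dirichlet_partial b K s"
    have P: "cmod P \<le> B + e"
      using norm_triangle_ineq4[of "F s" "F s - P"] a(3)[OF s] B[OF s] by (simp add: P_def)
    have "F s * G s - P * Q = (F s - P) * G s + P * (G s - Q)" by (simp add: algebra_simps)
    also have "cmod \<dots> \<le> cmod (F s - P) * cmod (G s) + cmod P * cmod (G s - Q)"
      by (metis norm_mult norm_triangle_ineq)
    also have "\<dots> \<le> e * B' + (B + e) * e'"
      using a(3)[OF s] b(3)[OF s] P B'[OF s] order_trans[OF norm_ge_zero P] order_trans[OF norm_ge_zero a(3)[OF s]]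
      unfolding P_def Q_def by (intro add_mono mult_mono) auto
    finally show "cmod (F s * G s - dirichlet_partial c (N * K) s) \<le> e * B' + (B + e) * e'"
      unfolding c(1)[symmetric] P_def Q_def .
  qed
qed

lemma near_shift:
  assumes "near S M e F" "t \<ge> 0"
  shows "near S M e (\<lambda>s. F (s + of_real t))"
proof -
  from assms(1) obtain a N where a: "\<And>n. n \<notin> S \<Longrightarrow> a n = 0" "(\<Sum>n=1..N. cmod (a n)) \<le> M"
    "\<And>s. Re s > 0 \<Longrightarrow> cmod (F s - dirichlet_partial a N s) \<le> e" by (rule nearE) blast
  show ?thesis
  proof (rule nearI)
    show "a n * of_nat n powr (- of_real t) = 0" if "n \<notin> S" for n using a(1) that by simp
    have "(\<Sum>n=1..N. cmod (a n * of_nat n powr (- of_real t))) \<le> (\<Sum>n=1..N. cmod (a n))"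
      using assms(2) by (intro sum_mono) (auto simp: norm_mult intro!: mult_left_le norm_npow_le_1)
    thus "(\<Sum>n=1..N. cmod (a n * of_nat n powr (- of_real t))) \<le> M" using a(2) by simp
    fix s :: complex assume s: "Re s > 0"
    thus "cmod (F (s + of_real t) - dirichlet_partial (\<lambda>n. a n * of_nat n powr (- of_real t)) N s) \<le> e"
      using a(3)[of "s + of_real t"] assms(2) by (simp add: dirichlet_partial_shift)
  qed
qed

lemma dap_shift: "dap S F \<Longrightarrow> t \<ge> 0 \<Longrightarrow> dap S (\<lambda>s. F (s + of_real t))"
  unfolding dap_def using near_shift by blast

lemma wap_mono: "wap S M F \<Longrightarrow> S \<subseteq> S' \<Longrightarrow> M \<le> M' \<Longrightarrow> wap S' M' F"
  unfolding wap_def by (meson near_mono order_refl)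

lemma wap_imp_dap: "wap S M F \<Longrightarrow> dap S F"
  unfolding wap_def dap_def by blast

lemma near_bound:
  assumes "near S M e F" "Re s > 0" shows "cmod (F s) \<le> M + e"
proof -
  from assms(1) obtain a N where a: "(\<Sum>n=1..N. cmod (a n)) \<le> M"
    "\<And>s. Re s > 0 \<Longrightarrow> cmod (F s - dirichlet_partial a N s) \<le> e" by (rule nearE) blast
  have "cmod (dirichlet_partial a N s) \<le> M"
    using dirichlet_partial_norm_le[of s a N] a(1) assms(2) by simp
  thus ?thesis using a(2)[OF assms(2)] norm_triangle_ineq[of "F s - dirichlet_partial a N s" "dirichlet_partial a N s"]
    by simp
qed

lemma wap_bound:
  assumes "wap S M F" "Re s > 0" shows "cmod (F s) \<le> M"
proof (rule field_le_epsilon)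
  fix e :: real assume "e > 0"
  hence "near S M e F" using assms(1) unfolding wap_def by blast
  from near_bound[OF this assms(2)] show "cmod (F s) \<le> M + e" .
qed

lemma dap_bound:
  assumes "dap S F" obtains B where "B > 0" "\<And>s. Re s > 0 \<Longrightarrow> cmod (F s) \<le> B"
proof -
  obtain M where "near S M 1 F" using assms unfolding dap_def by (meson zero_less_one)
  from near_bound[OF this] have "\<And>s. Re s > 0 \<Longrightarrow> cmod (F s) \<le> max 1 (M + 1)" by (simp add: le_max_iff_disj)
  thus ?thesis by (intro that[of "max 1 (M + 1)"]) auto
qed

lemma near_const:
  assumes "mult_closed S" "e \<ge> 0"
  shows "near S (cmod c) e (\<lambda>_. c)"
proof (rule nearI[of _ "\<lambda>n. if n = 1 then c else 0" 1])
  show "(\<lambda>n. if n = 1 then c else 0) n = 0" if "n \<notin> S" for n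
    using that assms(1) by (auto simp: mult_closed_def)
qed (use assms in \<open>auto simp: dirichlet_partial_def\<close>)

lemma wap_const: "mult_closed S \<Longrightarrow> wap S (cmod c) (\<lambda>_. c)"
  unfolding wap_def by (simp add: near_const)

lemma dap_const: "mult_closed S \<Longrightarrow> dap S (\<lambda>_. c)"
  using wap_const wap_imp_dap by blast

lemma wap_add: "wap S M F \<Longrightarrow> wap S M' G \<Longrightarrow> wap S (M + M') (\<lambda>s. F s + G s)"
  unfolding wap_def using near_add[of S M _ F M' _ G] by (metis field_sum_of_halves half_gt_zero)

lemma dap_add: "dap S F \<Longrightarrow> dap S G \<Longrightarrow> dap S (\<lambda>s. F s + G s)"
  unfolding dap_def using near_add[of S _ _ F _ _ G] by (metis field_sum_of_halves half_gt_zero)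

text \<open>Chooses the accuracy of the factors in \<open>near_mult\<close>.\<close>
lemma mult_error:
  fixes e B B' :: real
  assumes "e > 0" "B \<ge> 0" "B' \<ge> 0"
  obtains d where "d > 0" "d * B' + (B + d) * d \<le> e"
proof -
  define d where "d = min 1 (e / (B + B' + 1))"
  have d: "d > 0" "d \<le> 1" "d * (B + B' + 1) \<le> e"
  proof -
    have "d \<le> e / (B + B' + 1)" by (simp add: d_def)
    thus "d * (B + B' + 1) \<le> e" using assms by (subst (asm) pos_le_divide_eq) auto
  qed (use assms in \<open>auto simp: d_def intro!: divide_pos_pos\<close>)
  have "d * B' + (B + d) * d = d * (B + B' + d)" by (simp add: algebra_simps)
  also have "\<dots> \<le> d * (B + B' + 1)" using d by (intro mult_left_mono) auto
  finally show ?thesis using d by (intro that[of d]) auto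
qed

lemma dap_mult:
  assumes S: "mult_closed S" and "dap S F" "dap S G" shows "dap S (\<lambda>s. F s * G s)"
proof -
  obtain B where B: "B > 0" "\<And>s. Re s > 0 \<Longrightarrow> cmod (F s) \<le> B" using dap_bound[OF assms(2)] by blast
  obtain B' where B': "B' > 0" "\<And>s. Re s > 0 \<Longrightarrow> cmod (G s) \<le> B'" using dap_bound[OF assms(3)] by blast
  show ?thesis unfolding dap_def
  proof safe
    fix e :: real assume "e > 0"
    obtain d where d: "d > 0" "d * B' + (B + d) * d \<le> e"
      by (rule mult_error[of e B B']) (use \<open>e > 0\<close> B B' in auto)
    obtain M M' where "near S M d F" "near S M' d G" using assms d unfolding dap_def by blast
    from near_mono[OF near_mult[OF S this B(2) B'(2)] order_refl d(2) order_refl]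
    show "\<exists>M. near S M e (\<lambda>s. F s * G s)" by blast
  qed
qed

lemma wap_mult:
  assumes S: "mult_closed S" and "wap S M F" "wap S M' G" shows "wap S (M * M') (\<lambda>s. F s * G s)"
proof -
  note B = wap_bound[OF assms(2)] and B' = wap_bound[OF assms(3)]
  have 0: "M \<ge> 0" "M' \<ge> 0"
    using order_trans[OF norm_ge_zero B[of 1]] order_trans[OF norm_ge_zero B'[of 1]] by auto
  show ?thesis unfolding wap_def
  proof safe
    fix e :: real assume "e > 0"
    obtain d where d: "d > 0" "d * M' + (M + d) * d \<le> e"
      by (rule mult_error[of e M M']) (use \<open>e > 0\<close> 0 in auto)
    have "near S M d F" "near S M' d G" using assms d unfolding wap_def by auto
    from near_mono[OF near_mult[OF S this B B'] order_refl d(2) order_refl]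
    show "near S (M * M') e (\<lambda>s. F s * G s)" by blast
  qed
qed

lemma wap_power: "mult_closed S \<Longrightarrow> wap S M F \<Longrightarrow> wap S (M ^ k) (\<lambda>s. F s ^ k)"
proof (induction k)
  case 0
  thus ?case using wap_const[of S 1] by simp
next
  case (Suc k)
  thus ?case using wap_mult[of S M F "M ^ k" "\<lambda>s. F s ^ k"] by simp
qed

lemma dap_power: "mult_closed S \<Longrightarrow> dap S F \<Longrightarrow> dap S (\<lambda>s. F s ^ k)"
proof (induction k)
  case 0
  thus ?case using dap_const[of S 1] by simp
next
  case (Suc k)
  thus ?case using dap_mult[of S F "\<lambda>s. F s ^ k"] by simp
qed

lemma wap_cmult: "mult_closed S \<Longrightarrow> wap S M F \<Longrightarrow> wap S (cmod c * M) (\<lambda>s. c * F s)"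
  by (rule wap_mult) (auto intro: wap_const)

lemma dap_cmult: "mult_closed S \<Longrightarrow> dap S F \<Longrightarrow> dap S (\<lambda>s. c * F s)"
  by (rule dap_mult) (auto intro: dap_const)

lemma dap_diff: "mult_closed S \<Longrightarrow> dap S F \<Longrightarrow> dap S G \<Longrightarrow> dap S (\<lambda>s. F s - G s)"
  using dap_add[of S F "\<lambda>s. (-1) * G s"] dap_cmult[of S G "-1"] by simp

lemma dap_limit:
  assumes "\<And>e. e > 0 \<Longrightarrow> \<exists>G. dap S G \<and> (\<forall>s. Re s > 0 \<longrightarrow> cmod (F s - G s) \<le> e)"
  shows "dap S F"
  unfolding dap_def
proof safe
  fix e :: real assume "e > 0"
  then obtain G where G: "dap S G" "\<And>s. Re s > 0 \<Longrightarrow> cmod (F s - G s) \<le> e/2" using assms[of "e/2"] by auto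
  obtain M where "near S M (e/2) G" using G(1) \<open>e > 0\<close> unfolding dap_def by (meson half_gt_zero)
  from near_approx[OF this G(2)] show "\<exists>M. near S M e F" by auto
qed

lemma wap_limit:
  assumes "\<And>e. e > 0 \<Longrightarrow> \<exists>G. wap S M G \<and> (\<forall>s. Re s > 0 \<longrightarrow> cmod (F s - G s) \<le> e)"
  shows "wap S M F"
  unfolding wap_def
proof safe
  fix e :: real assume "e > 0"
  then obtain G where G: "wap S M G" "\<And>s. Re s > 0 \<Longrightarrow> cmod (F s - G s) \<le> e/2" using assms[of "e/2"] by auto
  have "near S M (e/2) G" using G(1) \<open>e > 0\<close> unfolding wap_def by (meson half_gt_zero)
  from near_approx[OF this G(2)] show "near S M e F" by auto
qed

lemma dap_sum: "mult_closed S \<Longrightarrow> (\<And>k. dap S (f k)) \<Longrightarrow> dap S (\<lambda>s. \<Sum>k<(K::nat). f k s)"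
proof (induction K)
  case 0
  thus ?case using dap_const[of S 0] by simp
next
  case (Suc K)
  thus ?case using dap_add[of S "\<lambda>s. \<Sum>k<K. f k s" "f K"] by simp
qed

lemma wap_sum: "mult_closed S \<Longrightarrow> (\<And>k. wap S (m k) (f k)) \<Longrightarrow> wap S (\<Sum>k<(K::nat). m k) (\<lambda>s. \<Sum>k<K. f k s)"
proof (induction K)
  case 0
  thus ?case using wap_const[of S 0] by simp
next
  case (Suc K)
  thus ?case using wap_add[of S "\<Sum>k<K. m k" "\<lambda>s. \<Sum>k<K. f k s" "m K" "f K"] by simp
qed

text \<open>The Weierstrass test, as it is needed to take series of almost periodic functions.\<close>
lemma series_tail_uniform:
  fixes f :: "nat \<Rightarrow> complex \<Rightarrow> complex"
  assumes "\<And>k s. Re s > 0 \<Longrightarrow> cmod (f k s) \<le> m k" "summable m" "e > 0"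
  shows "\<exists>K. \<forall>s. Re s > 0 \<longrightarrow> cmod ((\<Sum>k. f k s) - (\<Sum>k<K. f k s)) \<le> e"
proof -
  have "uniform_limit {s. Re s > 0} (\<lambda>n s. \<Sum>k<n. f k s) (\<lambda>s. \<Sum>k. f k s) sequentially"
    by (rule Weierstrass_m_test) (use assms in auto)
  from uniform_limitD[OF this \<open>e > 0\<close>] obtain K where "\<And>s. Re s > 0 \<Longrightarrow> dist (\<Sum>k<K. f k s) (\<Sum>k. f k s) < e"
    by (auto simp: eventually_sequentially)
  thus ?thesis by (intro exI[of _ K]) (simp add: dist_norm norm_minus_commute less_imp_le)
qed

lemma dap_series:
  assumes S: "mult_closed S" and "\<And>k. dap S (f k)" "\<And>k s. Re s > 0 \<Longrightarrow> cmod (f k s) \<le> m k" "summable m"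
  shows "dap S (\<lambda>s. \<Sum>k. f k s)"
proof (rule dap_limit)
  fix e :: real assume "e > 0"
  have "\<exists>K. \<forall>s. Re s > 0 \<longrightarrow> cmod ((\<Sum>k. f k s) - (\<Sum>k<K. f k s)) \<le> e"
    by (rule series_tail_uniform[of f m]) (use assms(3,4) \<open>e > 0\<close> in auto)
  then obtain K where "\<forall>s. Re s > 0 \<longrightarrow> cmod ((\<Sum>k. f k s) - (\<Sum>k<K. f k s)) \<le> e" ..
  thus "\<exists>G. dap S G \<and> (\<forall>s. Re s > 0 \<longrightarrow> cmod ((\<Sum>k. f k s) - G s) \<le> e)"
    using dap_sum[OF S assms(2)] by (intro exI[of _ "\<lambda>s. \<Sum>k<K. f k s"] conjI)
qed

lemma wap_series:
  assumes S: "mult_closed S" and w: "\<And>k. wap S (m k) (f k)" and m: "summable m"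
  shows "wap S (\<Sum>k. m k) (\<lambda>s. \<Sum>k. f k s)"
proof (rule wap_limit)
  fix e :: real assume "e > 0"
  note B = wap_bound[OF w]
  have 0: "m k \<ge> 0" for k using order_trans[OF norm_ge_zero B[of 1 k]] by simp
  have "\<exists>K. \<forall>s. Re s > 0 \<longrightarrow> cmod ((\<Sum>k. f k s) - (\<Sum>k<K. f k s)) \<le> e"
    by (rule series_tail_uniform[of f m]) (use B m \<open>e > 0\<close> in auto)
  then obtain K where "\<forall>s. Re s > 0 \<longrightarrow> cmod ((\<Sum>k. f k s) - (\<Sum>k<K. f k s)) \<le> e" ..
  moreover have "wap S (\<Sum>k. m k) (\<lambda>s. \<Sum>k<K. f k s)"
    using wap_mono[OF wap_sum[OF S w] order_refl] sum_le_suminf[OF m, of "{..<K}"] 0 by auto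
  ultimately show "\<exists>G. wap S (\<Sum>k. m k) G \<and> (\<forall>s. Re s > 0 \<longrightarrow> cmod ((\<Sum>k. f k s) - G s) \<le> e)"
    by (intro exI[of _ "\<lambda>s. \<Sum>k<K. f k s"] conjI)
qed

lemma poly_bohr:
  assumes "e > 0"
  obtains C where "C \<ge> 0" "\<And>a M B N s. (\<And>n. n > M \<Longrightarrow> a n = 0) \<Longrightarrow>
      (\<And>s. Re s > 0 \<Longrightarrow> cmod (dirichlet_partial a M s) \<le> B) \<Longrightarrow> Re s > e \<Longrightarrow>
      cmod (dirichlet_partial a N s) \<le> C * B"
proof -
  obtain C where C: "C \<ge> 0" "\<And>a M N B s. N \<le> M \<Longrightarrow> (\<And>s. Re s > 0 \<Longrightarrow> cmod (dirichlet_partial a M s) \<le> B) \<Longrightarrow> Re s > e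
           \<Longrightarrow> cmod (dirichlet_partial a N s) \<le> C * B"
    using bohr_inequality[OF assms] by blast
  show ?thesis
  proof (rule that[OF C(1)])
    fix a :: "nat \<Rightarrow> complex" and M B N s
    assume 0: "\<And>n. n > M \<Longrightarrow> a n = 0" and B: "\<And>s. Re s > 0 \<Longrightarrow> cmod (dirichlet_partial a M s) \<le> B" and s: "Re s > e"
    show "cmod (dirichlet_partial a N s) \<le> C * B"
      by (rule C(2)[of N "max M N"]) (use B s 0 in \<open>auto simp: dirichlet_partial_extend[of M a "max M N"]\<close>)
  qed
qed

text \<open>A single term is the difference of two consecutive partial sums, both controlled by Bohr's inequality.\<close>
lemma poly_coeff_bound:
  assumes "e > 0"
  obtains C where "C \<ge> 0" "\<And>a M B n. (\<And>n. n > M \<Longrightarrow> a n = 0) \<Longrightarrow>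
      (\<And>s. Re s > 0 \<Longrightarrow> cmod (dirichlet_partial a M s) \<le> B) \<Longrightarrow> n \<ge> 1 \<Longrightarrow>
      cmod (a n) \<le> C * real n powr e * B"
proof -
  obtain C where C: "C \<ge> 0" "\<And>a M B N s. (\<And>n. n > M \<Longrightarrow> a n = 0) \<Longrightarrow>
      (\<And>s. Re s > 0 \<Longrightarrow> cmod (dirichlet_partial a M s) \<le> B) \<Longrightarrow> Re s > e/2 \<Longrightarrow>
      cmod (dirichlet_partial a N s) \<le> C * B"
    using poly_bohr[of "e/2"] assms by auto
  show ?thesis
  proof (rule that[of "2 * C"])
    fix a :: "nat \<Rightarrow> complex" and M B and n :: nat
    assume 0: "\<And>n. n > M \<Longrightarrow> a n = 0" and B: "\<And>s. Re s > 0 \<Longrightarrow> cmod (dirichlet_partial a M s) \<le> B" and n: "n \<ge> 1"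
    have eq: "dirichlet_partial a n e - dirichlet_partial a (n - 1) e = a n * of_nat n powr (- of_real e)"
      using n by (cases n) (auto simp: dirichlet_partial_def)
    have "cmod (dirichlet_partial a n e) \<le> C * B" "cmod (dirichlet_partial a (n-1) e) \<le> C * B"
      by (rule C(2)[OF 0 B]; use assms in simp)+
    hence "cmod (a n * of_nat n powr (- of_real e)) \<le> C * B + C * B"
      unfolding eq[symmetric] using norm_triangle_ineq4[of "dirichlet_partial a n e" "dirichlet_partial a (n - 1) e"] by linarith
    also have "cmod (a n * of_nat n powr (- of_real e)) = cmod (a n) * real n powr (-e)"
      using n norm_npow[of n "of_real e"] by (simp add: norm_mult)
    finally have "cmod (a n) * real n powr (-e) * real n powr e \<le> (C * B + C * B) * real n powr e"
      by (intro mult_right_mono) auto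
    thus "cmod (a n) \<le> 2 * C * real n powr e * B"
      using n by (simp add: powr_minus algebra_simps)
  qed (use C in auto)
qed

text \<open>Bohr's theorem. Differences of the approximating polynomials are small on the half-plane, so by Bohr's
inequality their coefficients converge, and all their partial sums are close to those of the limit series, uniformly
in the length \<open>m\<close>. For \<open>m\<close> beyond the length of a good approximant, the partial sum of the approximant is the
approximant itself.\<close>
theorem bohr_limit:
  fixes c :: "nat \<Rightarrow> nat \<Rightarrow> complex" and N :: "nat \<Rightarrow> nat" and d :: "nat \<Rightarrow> real"
  assumes c0: "\<And>k n. n > N k \<Longrightarrow> c k n = 0"
    and cF: "\<And>k s. Re s > 0 \<Longrightarrow> cmod (F s - dirichlet_partial (c k) (N k) s) \<le> d k"
    and d: "d \<longlonglongrightarrow> 0"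
  shows "\<exists>a. has_dirichlet_series F a \<and> (\<forall>n\<ge>1. (\<lambda>k. c k n) \<longlonglongrightarrow> a n)"
proof -
  have d0: "d k \<ge> 0" for k using order_trans[OF norm_ge_zero cF[of 1 k]] by simp
  define K where "K = (\<lambda>k l. max (N k) (N l))"
  have diff: "cmod (dirichlet_partial (\<lambda>n. c k n - c l n) (K k l) s) \<le> d k + d l" if s: "Re s > 0" for k l s
  proof -
    have "dirichlet_partial (\<lambda>n. c k n - c l n) (K k l) s =
        (F s - dirichlet_partial (c l) (N l) s) - (F s - dirichlet_partial (c k) (N k) s)"
      using dirichlet_partial_extend[of "N k" "c k" "K k l" s] dirichlet_partial_extend[of "N l" "c l" "K k l" s] c0
      by (simp add: dirichlet_partial_diff[symmetric] K_def)
    also have "cmod \<dots> \<le> d l + d k"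
      by (rule order_trans[OF norm_triangle_ineq4 add_mono[OF cF[OF s] cF[OF s]]])
    finally show ?thesis by simp
  qed
  have K0: "c k n - c l n = 0" if "n > K k l" for k l n using that c0 by (simp add: K_def)
  have "convergent (\<lambda>k. c k n)" if n: "n \<ge> 1" for n
  proof -
    obtain C where C: "C \<ge> 0" "\<And>a M B n. (\<And>n. n > M \<Longrightarrow> a n = 0) \<Longrightarrow>
      (\<And>s. Re s > 0 \<Longrightarrow> cmod (dirichlet_partial a M s) \<le> B) \<Longrightarrow> n \<ge> 1 \<Longrightarrow>
      cmod (a n) \<le> C * real n powr 1 * B"
      using poly_coeff_bound[of 1] by auto
    have *: "cmod (c k n - c l n) \<le> C * real n * (d k + d l)" for k l
      using C(2)[where a = "\<lambda>n. c k n - c l n", OF K0[of k l] diff n] n by simp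
    have "Cauchy (\<lambda>k. c k n)"
    proof (rule metric_CauchyI)
      fix e :: real assume e: "e > 0"
      have "(\<lambda>k. C * real n * (d k + d k)) \<longlonglongrightarrow> C * real n * (0 + 0)" by (intro tendsto_intros d)
      hence "(\<lambda>k. 2 * (C * real n * d k)) \<longlonglongrightarrow> 0" by (simp add: algebra_simps)
      from order_tendstoD(2)[OF this e] obtain k0 where k0: "\<And>k. k \<ge> k0 \<Longrightarrow> 2 * (C * real n * d k) < e"
        by (auto simp: eventually_sequentially)
      have "dist (c k n) (c l n) < e" if "k \<ge> k0" "l \<ge> k0" for k l
        using *[of k l] k0[OF that(1)] k0[OF that(2)] by (simp add: dist_norm algebra_simps)
      thus "\<exists>M. \<forall>m\<ge>M. \<forall>p\<ge>M. dist (c m n) (c p n) < e" by blast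
    qed
    thus ?thesis by (rule Cauchy_convergent)
  qed
  then obtain a where a: "\<And>n. n \<ge> 1 \<Longrightarrow> (\<lambda>k. c k n) \<longlonglongrightarrow> a n"
    unfolding convergent_def by metis
  have "has_dirichlet_series F a"
    unfolding has_dirichlet_series_def
  proof safe
    fix e :: real assume e: "e > 0"
    obtain C where C: "C \<ge> 0" "\<And>a M B N s. (\<And>n. n > M \<Longrightarrow> a n = 0) \<Longrightarrow>
      (\<And>s. Re s > 0 \<Longrightarrow> cmod (dirichlet_partial a M s) \<le> B) \<Longrightarrow> Re s > e \<Longrightarrow>
      cmod (dirichlet_partial a N s) \<le> C * B"
      using poly_bohr[OF e] by auto
    have lim: "cmod (dirichlet_partial (c k) m s - dirichlet_partial a m s) \<le> C * d k" if s: "Re s > e" for k m s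
    proof (rule LIMSEQ_le)
      show "(\<lambda>l. cmod (dirichlet_partial (c k) m s - dirichlet_partial (c l) m s)) \<longlonglongrightarrow> cmod (dirichlet_partial (c k) m s - dirichlet_partial a m s)"
        unfolding dirichlet_partial_def by (intro tendsto_intros a) auto
      have "(\<lambda>l. C * (d k + d l)) \<longlonglongrightarrow> C * (d k + 0)" by (intro tendsto_intros d)
      thus "(\<lambda>l. C * (d k + d l)) \<longlonglongrightarrow> C * d k" by simp
      show "\<exists>N. \<forall>l\<ge>N. cmod (dirichlet_partial (c k) m s - dirichlet_partial (c l) m s) \<le> C * (d k + d l)"
        using C(2)[where a = "\<lambda>n. c k n - c l n" for l, OF K0 diff s] unfolding dirichlet_partial_diff by blast
    qed
    show "uniform_limit {s. e < Re s} (dirichlet_partial a) F sequentially"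
    proof (rule uniform_limitI)
      fix h :: real assume h: "h > 0"
      have "(\<lambda>k. C * d k + d k) \<longlonglongrightarrow> C * 0 + 0" by (intro tendsto_intros d)
      hence "(\<lambda>k. C * d k + d k) \<longlonglongrightarrow> 0" by simp
      from order_tendstoD(2)[OF this h] obtain k where k: "C * d k + d k < h"
        by (auto simp: eventually_sequentially)
      have "dist (dirichlet_partial a m s) (F s) < h" if m: "m \<ge> N k" and s: "e < Re s" for m s
      proof -
        have "dirichlet_partial (c k) m s = dirichlet_partial (c k) (N k) s"
          using m c0 by (intro dirichlet_partial_extend) auto
        hence "cmod (F s - dirichlet_partial (c k) m s) \<le> d k" using cF[of s k] s e by simp
        moreover have "cmod (dirichlet_partial (c k) m s - dirichlet_partial a m s) \<le> C * d k" by (rule lim[OF s])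
        ultimately have "cmod (F s - dirichlet_partial a m s) \<le> d k + C * d k"
          using norm_triangle_ineq[of "F s - dirichlet_partial (c k) m s" "dirichlet_partial (c k) m s - dirichlet_partial a m s"] by simp
        thus ?thesis using k by (simp add: dist_norm norm_minus_commute)
      qed
      thus "\<forall>\<^sub>F n in sequentially. \<forall>x\<in>{s. e < Re s}. dist (dirichlet_partial a n x) (F x) < h"
        unfolding eventually_sequentially by blast
    qed
  qed
  thus ?thesis using a by blast
qed

theorem dap_has_series:
  assumes "dap S F"
  shows "\<exists>a. has_dirichlet_series F a \<and> (\<forall>n. n \<notin> S \<longrightarrow> n \<ge> 1 \<longrightarrow> a n = 0)"
proof -
  have "\<exists>a N. (\<forall>n. n \<notin> S \<longrightarrow> a n = 0) \<and> (\<forall>s. Re s > 0 \<longrightarrow> cmod (F s - dirichlet_partial a N s) \<le> 1 / real (Suc k))" for k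
  proof -
    have "1 / real (Suc k) > 0" by simp
    thus ?thesis using assms unfolding dap_def near_def by blast
  qed
  then obtain a N where a: "\<And>k n. n \<notin> S \<Longrightarrow> a k n = 0"
    "\<And>k s. Re s > 0 \<Longrightarrow> cmod (F s - dirichlet_partial (a k) (N k) s) \<le> 1 / real (Suc k)" by metis
  have "\<exists>b. has_dirichlet_series F b \<and> (\<forall>n\<ge>1. (\<lambda>k. trunc (N k) (a k) n) \<longlonglongrightarrow> b n)"
    by (rule bohr_limit[of N "\<lambda>k. trunc (N k) (a k)" F "\<lambda>k. 1 / real (Suc k)"])
       (use a(2) LIMSEQ_Suc[OF lim_1_over_n] in \<open>auto simp: dirichlet_partial_trunc trunc_def simp del: of_nat_Suc\<close>)
  then obtain b where b: "has_dirichlet_series F b" "\<And>n. n \<ge> 1 \<Longrightarrow> (\<lambda>k. trunc (N k) (a k) n) \<longlonglongrightarrow> b n" by blast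
  have "b n = 0" if "n \<notin> S" "n \<ge> 1" for n
  proof -
    have "(\<lambda>k. trunc (N k) (a k) n) = (\<lambda>_. 0)" using a(1)[OF that(1)] by (auto simp: trunc_def)
    thus ?thesis using b(2)[OF that(2)] by (simp add: LIMSEQ_const_iff)
  qed
  with b(1) show ?thesis by blast
qed

text \<open>The coefficient sums of the approximants stay below \<open>M\<close> and pass to the limit as in Fatou's lemma.\<close>
theorem wap_has_series:
  assumes "wap S M F"
  shows "\<exists>a. has_dirichlet_series F a \<and> (\<forall>K. (\<Sum>n=1..K. cmod (a n)) \<le> M)"
proof -
  have "\<exists>a N. (\<Sum>n=1..N. cmod (a n)) \<le> M \<and> (\<forall>s. Re s > 0 \<longrightarrow> cmod (F s - dirichlet_partial a N s) \<le> 1 / real (Suc k))" for k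
  proof -
    have "1 / real (Suc k) > 0" by simp
    thus ?thesis using assms unfolding wap_def near_def by blast
  qed
  then obtain a N where a: "\<And>k. (\<Sum>n=1..N k. cmod (a k n)) \<le> M"
    "\<And>k s. Re s > 0 \<Longrightarrow> cmod (F s - dirichlet_partial (a k) (N k) s) \<le> 1 / real (Suc k)" by metis
  have "\<exists>b. has_dirichlet_series F b \<and> (\<forall>n\<ge>1. (\<lambda>k. trunc (N k) (a k) n) \<longlonglongrightarrow> b n)"
    by (rule bohr_limit[of N "\<lambda>k. trunc (N k) (a k)" F "\<lambda>k. 1 / real (Suc k)"])
       (use a(2) LIMSEQ_Suc[OF lim_1_over_n] in \<open>auto simp: dirichlet_partial_trunc trunc_def simp del: of_nat_Suc\<close>)
  then obtain b where b: "has_dirichlet_series F b" "\<And>n. n \<ge> 1 \<Longrightarrow> (\<lambda>k. trunc (N k) (a k) n) \<longlonglongrightarrow> b n" by blast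
  have "(\<Sum>n=1..K. cmod (b n)) \<le> M" for K
  proof (rule LIMSEQ_le_const2)
    show "(\<lambda>k. \<Sum>n=1..K. cmod (trunc (N k) (a k) n)) \<longlonglongrightarrow> (\<Sum>n=1..K. cmod (b n))"
      by (intro tendsto_intros b(2)) auto
    have "(\<Sum>n=1..K. cmod (trunc (N k) (a k) n)) \<le> (\<Sum>n=1..max K (N k). cmod (trunc (N k) (a k) n))" for k
      by (intro sum_mono2) auto
    also have "(\<Sum>n=1..max K (N k). cmod (trunc (N k) (a k) n)) = (\<Sum>n=1..N k. cmod (a k n))" for k
      by (rule sum_norm_trunc) simp
    finally have "(\<Sum>n=1..K. cmod (trunc (N k) (a k) n)) \<le> M" for k using a(1)[of k] order_trans by blast
    thus "\<exists>N'. \<forall>k\<ge>N'. (\<Sum>n=1..K. cmod (trunc (N k) (a k) n)) \<le> M" by blast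
  qed
  with b(1) show ?thesis by blast
qed

section \<open>Exponentials and logarithms of almost periodic functions\<close>

lemma exp_term_norm: "cmod (z ^ k /\<^sub>R fact k) = cmod z ^ k / fact k" for z :: complex
  by (simp add: norm_power divide_inverse)

lemma dap_exp:
  assumes S: "mult_closed S" and F: "dap S F" shows "dap S (\<lambda>s. exp (F s))"
proof -
  obtain B where B: "B > 0" "\<And>s. Re s > 0 \<Longrightarrow> cmod (F s) \<le> B" by (rule dap_bound[OF F]) blast
  have "dap S (\<lambda>s. \<Sum>k. F s ^ k /\<^sub>R fact k)"
  proof (rule dap_series[OF S])
    show "dap S (\<lambda>s. F s ^ k /\<^sub>R fact k)" for k
      unfolding scaleR_conv_of_real by (intro dap_cmult dap_power S F)
    show "cmod (F s ^ k /\<^sub>R fact k) \<le> B ^ k /\<^sub>R fact k" if "Re s > 0" for k s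
      unfolding exp_term_norm using B(2)[OF that] by (simp add: divide_inverse power_mono mult_right_mono mult.commute)
    show "summable (\<lambda>k. B ^ k /\<^sub>R fact k)" by (rule summable_exp_generic)
  qed
  thus ?thesis by (simp add: exp_def)
qed

lemma wap_exp:
  assumes S: "mult_closed S" and F: "wap S M F" shows "wap S (exp M) (\<lambda>s. exp (F s))"
proof -
  have "wap S (\<Sum>k. M ^ k /\<^sub>R fact k) (\<lambda>s. \<Sum>k. F s ^ k /\<^sub>R fact k)"
  proof (rule wap_series[OF S])
    show "wap S (M ^ k /\<^sub>R fact k) (\<lambda>s. F s ^ k /\<^sub>R fact k)" for k
      using wap_cmult[OF S wap_power[OF S F, of k], of "of_real (inverse (fact k))"]
      by (simp add: scaleR_conv_of_real norm_inverse)
    show "summable (\<lambda>k. M ^ k /\<^sub>R fact k)" by (rule summable_exp_generic)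
  qed
  thus ?thesis by (simp add: exp_def)
qed

lemma ln_coeff_norm: "cmod ((- 1) ^ Suc n / of_nat n) \<le> 1"
  by (cases n) (auto simp: norm_divide norm_power simp del: of_nat_Suc)

lemma dap_ln_one_plus:
  assumes S: "mult_closed S" and u: "dap S u" and q: "\<And>s. Re s > 0 \<Longrightarrow> cmod (u s) \<le> q" "q < 1"
  shows "dap S (\<lambda>s. ln (1 + u s))"
proof -
  have q0: "q \<ge> 0" using order_trans[OF norm_ge_zero q(1)[of 1]] by simp
  have "dap S (\<lambda>s. \<Sum>n. (- 1) ^ Suc n / of_nat n * u s ^ n)"
  proof (rule dap_series[OF S])
    show "dap S (\<lambda>s. (- 1) ^ Suc n / of_nat n * u s ^ n)" for n
      by (intro dap_cmult dap_power S u)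
    show "cmod ((- 1) ^ Suc n / of_nat n * u s ^ n) \<le> q ^ n" if "Re s > 0" for n s
    proof -
      have "cmod ((- 1) ^ Suc n / of_nat n) * cmod (u s ^ n) \<le> 1 * q ^ n"
        using q(1)[OF that] by (intro mult_mono ln_coeff_norm) (auto simp: norm_power power_mono)
      thus ?thesis unfolding norm_mult by simp
    qed
    show "summable (\<lambda>n. q ^ n)" using q q0 by (intro summable_geometric) auto
  qed
  also have "?this \<longleftrightarrow> ?thesis"
  proof (rule dap_cong)
    fix s :: complex assume "Re s > 0"
    hence "cmod (u s) < 1" using q by (meson le_less_trans)
    from Ln_series[OF this] show "(\<Sum>n. (- 1) ^ Suc n / of_nat n * u s ^ n) = ln (1 + u s)"
      by (simp add: sums_iff)
  qed
  finally show ?thesis .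
qed

lemma wap_ln_one_plus:
  assumes S: "mult_closed S" and u: "\<And>k. wap S (m k) (\<lambda>s. u s ^ k)" "summable m"
    and q: "\<And>s. Re s > 0 \<Longrightarrow> cmod (u s) < 1"
  shows "wap S (\<Sum>k. m k) (\<lambda>s. ln (1 + u s))"
proof -
  have m0: "m k \<ge> 0" for k
    using order_trans[OF norm_ge_zero wap_bound[OF u(1), of 1 k]] by simp
  have "wap S (\<Sum>k. m k) (\<lambda>s. \<Sum>n. (- 1) ^ Suc n / of_nat n * u s ^ n)"
  proof (rule wap_series[OF S _ u(2)])
    fix n
    have "cmod ((- 1) ^ Suc n / of_nat n) * m n \<le> m n"
      using mult_right_mono[OF ln_coeff_norm m0, of n n] by simp
    from wap_mono[OF wap_cmult[OF S u(1)] order_refl this]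
    show "wap S (m n) (\<lambda>s. (- 1) ^ Suc n / of_nat n * u s ^ n)" .
  qed
  also have "?this \<longleftrightarrow> ?thesis"
  proof (rule wap_cong)
    fix s :: complex assume "Re s > 0"
    from Ln_series[OF q[OF this]] show "(\<Sum>n. (- 1) ^ Suc n / of_nat n * u s ^ n) = ln (1 + u s)"
      by (simp add: sums_iff)
  qed
  finally show ?thesis .
qed

lemma exp_ln_one_plus: "cmod u < 1 \<Longrightarrow> exp (ln (1 + u)) = 1 + u"
  by (rule exp_Ln) (metis add.inverse_unique add.commute less_irrefl norm_minus_cancel norm_one)

text \<open>All terms of a Dirichlet polynomial except the constant one are uniformly small far to the right.\<close>
lemma dap_at_infinity:
  assumes F: "dap S F" and e: "e > 0"
  shows "\<exists>T>0. \<exists>c. \<forall>s. Re s > 0 \<longrightarrow> cmod (F (s + of_real T) - c) \<le> e"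
proof -
  have "\<exists>M. near S M (e/2) F" using F e unfolding dap_def by simp
  then obtain M where "near S M (e/2) F" ..
  then obtain p N where p: "(\<Sum>n=1..N. cmod (p n)) \<le> M"
    "\<And>s. Re s > 0 \<Longrightarrow> cmod (F s - dirichlet_partial p N s) \<le> e/2" by (rule nearE) blast
  have M: "M \<ge> 0" using order_trans[OF sum_nonneg p(1)] by simp
  have "((\<lambda>T. M * 2 powr (-T)) \<longlongrightarrow> M * 0) at_top" by (intro tendsto_intros) real_asymp
  hence "\<forall>\<^sub>F T in at_top. M * 2 powr (-T) < e/2" using e by (intro order_tendstoD(2)) auto
  with eventually_gt_at_top[of 0] have "\<forall>\<^sub>F T in at_top. 0 < T \<and> M * 2 powr (-T) < e/2"
    by eventually_elim auto
  then obtain T :: real where T: "T > 0" "M * 2 powr (-T) < e/2"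
    by (auto simp: eventually_at_top_linorder)
  define c where "c = (if N \<ge> 1 then p 1 else 0)"
  have "cmod (F (s + of_real T) - c) \<le> e" if s: "Re s > 0" for s
  proof -
    have "dirichlet_partial p N (s + of_real T) - c = (\<Sum>n=2..N. p n * of_nat n powr (- (s + of_real T)))"
      by (cases "N \<ge> 1") (auto simp: dirichlet_partial_def c_def sum.atLeast_Suc_atMost numeral_2_eq_2)
    also have "cmod \<dots> \<le> (\<Sum>n=2..N. cmod (p n) * 2 powr (-T))"
    proof (rule sum_norm_le)
      fix n assume n: "n \<in> {2..N}"
      have "cmod (of_nat n powr (- (s + of_real T))) = real n powr (- (Re s + T))"
        using n by (subst norm_npow) auto
      also have "\<dots> \<le> real n powr (-T)" using n s by (intro powr_mono) auto
      also have "\<dots> \<le> 2 powr (-T)" using n T by (intro powr_mono2') auto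
      finally show "cmod (p n * of_nat n powr (- (s + of_real T))) \<le> cmod (p n) * 2 powr (-T)"
        by (simp add: norm_mult mult_left_mono)
    qed
    also have "\<dots> = (\<Sum>n=2..N. cmod (p n)) * 2 powr (-T)" by (simp add: sum_distrib_right)
    also have "\<dots> \<le> M * 2 powr (-T)"
    proof (rule mult_right_mono)
      have "(\<Sum>n=2..N. cmod (p n)) \<le> (\<Sum>n=1..N. cmod (p n))" by (rule sum_mono2) auto
      thus "(\<Sum>n=2..N. cmod (p n)) \<le> M" using p(1) by simp
    qed simp
    finally have "cmod (dirichlet_partial p N (s + of_real T) - c) \<le> e/2" using T by simp
    moreover have "cmod (F (s + of_real T) - dirichlet_partial p N (s + of_real T)) \<le> e/2"
      using p(2)[of "s + of_real T"] s T by simp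
    ultimately show ?thesis
      using norm_triangle_ineq[of "F (s + of_real T) - dirichlet_partial p N (s + of_real T)" "dirichlet_partial p N (s + of_real T) - c"]
      by simp
  qed
  thus ?thesis using T by blast
qed

lemma dap_uniformly_continuous:
  assumes F: "dap S F" and e: "e > 0"
  shows "\<exists>\<tau>>0. \<forall>h s. 0 \<le> h \<longrightarrow> h \<le> \<tau> \<longrightarrow> Re s > 0 \<longrightarrow> cmod (F (s + of_real h) - F s) \<le> e"
proof -
  have "\<exists>M. near S M (e/3) F" using F e unfolding dap_def by simp
  then obtain M where "near S M (e/3) F" ..
  then obtain p N where p: "\<And>s. Re s > 0 \<Longrightarrow> cmod (F s - dirichlet_partial p N s) \<le> e/3" by (rule nearE) blast
  define L where "L = (\<Sum>n=1..N. cmod (p n) * ln (real n)) + 1"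
  have "(\<Sum>n=1..N. cmod (p n) * ln (real n)) \<ge> 0" by (intro sum_nonneg) auto
  hence L: "L > 0" by (simp add: L_def)
  have "cmod (F (s + of_real h) - F s) \<le> e" if h: "0 \<le> h" "h \<le> e / (3 * L)" and s: "Re s > 0" for h s
  proof -
    have "dirichlet_partial p N (s + of_real h) - dirichlet_partial p N s
        = (\<Sum>n=1..N. p n * (of_nat n powr (- (s + of_real h)) - of_nat n powr (- s)))"
      by (simp add: dirichlet_partial_def right_diff_distrib sum_subtractf)
    also have "cmod \<dots> \<le> (\<Sum>n=1..N. cmod (p n) * (h * ln (real n)))"
    proof (rule sum_norm_le)
      fix n assume n: "n \<in> {1..N}"
      have "of_nat n powr (- (s + of_real h)) - of_nat n powr (- s) = of_nat n powr (-s) * (of_real (real n powr (-h)) - 1)"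
        using n by (simp add: powr_of_real[symmetric] powr_add[symmetric] algebra_simps)
      hence "cmod (of_nat n powr (- (s + of_real h)) - of_nat n powr (- s)) = cmod (of_nat n powr (-s)) * \<bar>real n powr (-h) - 1\<bar>"
        by (metis norm_mult norm_of_real of_real_1 of_real_diff)
      also have "\<dots> \<le> 1 * \<bar>real n powr (-h) - 1\<bar>"
        using n s by (intro mult_right_mono norm_npow_le_1) auto
      also have "real n powr (-h) \<le> 1" using n h powr_mono[of "-h" 0 "real n"] by simp
      hence "\<bar>real n powr (-h) - 1\<bar> = 1 - real n powr (-h)" by simp
      also have "\<dots> \<le> h * ln (real n)"
        using n exp_ge_add_one_self[of "- h * ln (real n)"] by (simp add: powr_def)
      finally show "cmod (p n * (of_nat n powr (- (s + of_real h)) - of_nat n powr (- s))) \<le> cmod (p n) * (h * ln (real n))"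
        by (simp add: norm_mult mult_left_mono)
    qed
    also have "\<dots> = h * (\<Sum>n=1..N. cmod (p n) * ln (real n))" by (simp add: sum_distrib_left mult_ac)
    also have "\<dots> \<le> h * L" using h by (intro mult_left_mono) (auto simp: L_def)
    also have "\<dots> \<le> e / (3 * L) * L" using h L by (intro mult_right_mono) auto
    also have "\<dots> = e/3" using L by simp
    finally have 1: "cmod (dirichlet_partial p N (s + of_real h) - dirichlet_partial p N s) \<le> e/3" .
    have 2: "cmod (F (s + of_real h) - dirichlet_partial p N (s + of_real h)) \<le> e/3" using p[of "s + of_real h"] s h by simp
    have "F (s + of_real h) - F s = (F (s + of_real h) - dirichlet_partial p N (s + of_real h))
        + (dirichlet_partial p N (s + of_real h) - dirichlet_partial p N s) - (F s - dirichlet_partial p N s)" by simp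
    also have "cmod \<dots> \<le> e/3 + e/3 + e/3"
      by (intro norm_triangle_le_diff norm_triangle_le add_mono 1 2 p s)
    finally show ?thesis by simp
  qed
  moreover have "e / (3 * L) > 0" using e L by simp
  ultimately show ?thesis by blast
qed

text \<open>A path to a constant replaces Gelfand theory. The shifts \<open>F (s + t)\<close> are bounded below by \<open>\<delta>\<close> for all \<open>t\<close>, depend
uniformly continuously on \<open>t\<close>, and are close to a nonzero constant for \<open>t = T\<close>. There a logarithm is given by the
power series of \<open>ln (1 + u)\<close>. Going back from \<open>T\<close> to 0 in short steps, the quotient of consecutive shifts is again
\<open>1 + u\<close> with \<open>\<bar>u\<bar> \<le> 1/2\<close>, and the logarithms of the quotients are added up.\<close>
theorem dap_log:
  assumes S: "mult_closed S" and F: "dap S F" and \<delta>: "\<delta> > 0" "\<And>s. Re s > 0 \<Longrightarrow> cmod (F s) \<ge> \<delta>"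
  shows "\<exists>a. dap S a \<and> (\<forall>s. Re s > 0 \<longrightarrow> F s = exp (a s))"
proof -
  obtain T c where T: "T > 0" and c: "\<And>s. Re s > 0 \<Longrightarrow> cmod (F (s + of_real T) - c) \<le> \<delta> / 4"
    using dap_at_infinity[OF F, of "\<delta> / 4"] \<delta> by auto
  obtain \<tau> where \<tau>: "\<tau> > 0" and uc: "\<And>h s. 0 \<le> h \<Longrightarrow> h \<le> \<tau> \<Longrightarrow> Re s > 0 \<Longrightarrow> cmod (F (s + of_real h) - F s) \<le> \<delta> / 2"
    using dap_uniformly_continuous[OF F, of "\<delta> / 2"] \<delta> by auto
  \<comment> \<open>the number of steps from \<open>T\<close> down to 0; \<open>u\<close> below is the relative change in one step\<close>
  define K where "K = nat \<lceil>T / \<tau>\<rceil>"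
  have K: "real K \<ge> T / \<tau>" unfolding K_def by linarith
  hence "real K > 0" using T \<tau> by (meson divide_pos_pos less_le_trans)
  define h where "h = T / real K"
  have h: "h > 0" "h \<le> \<tau>" "real K * h = T"
    using K T \<tau> \<open>real K > 0\<close> by (auto simp: h_def field_simps)
  have "\<exists>a. dap S a \<and> (\<forall>s. Re s > 0 \<longrightarrow> F (s + of_real (T - real j * h)) = exp (a s))" if "j \<le> K" for j
    using that
  proof (induction j)
    case 0
    have "\<delta> \<le> cmod (F (1 + of_real T))" using \<delta>(2)[of "1 + of_real T"] T by simp
    also have "\<dots> \<le> cmod c + \<delta> / 4"
      using c[of 1] norm_triangle_ineq[of "F (1 + of_real T) - c" c] by simp
    finally have cn: "cmod c \<ge> 3/4 * \<delta>" by simp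
    hence c0: "c \<noteq> 0" using \<delta> by auto
    define u where "u = (\<lambda>s. inverse c * (F (s + of_real T) - c))"
    have u: "dap S u" unfolding u_def
      by (rule dap_cmult[OF S dap_diff[OF S dap_shift[OF F less_imp_le[OF T]] dap_const[OF S]]])
    have u_le: "cmod (u s) \<le> 1/3" if "Re s > 0" for s
    proof -
      have "cmod (u s) \<le> (\<delta> / 4) / (3/4 * \<delta>)"
        unfolding u_def norm_mult norm_inverse using c[OF that] cn \<delta> 
        by (subst mult.commute, subst divide_inverse[symmetric], intro frac_le) auto
      thus ?thesis using \<delta> by simp
    qed
    have "dap S (\<lambda>s. Ln c + ln (1 + u s))"
      by (rule dap_add[OF dap_const[OF S] dap_ln_one_plus[OF S u u_le]]) auto
    moreover have "F (s + of_real T) = exp (Ln c + ln (1 + u s))" if "Re s > 0" for s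
    proof -
      have "exp (Ln c + ln (1 + u s)) = c * (1 + u s)"
        using c0 u_le[OF that] by (simp add: exp_add exp_ln_one_plus)
      also have "\<dots> = F (s + of_real T)" using c0 by (simp add: u_def field_simps)
      finally show ?thesis by simp
    qed
    ultimately show ?case by (intro exI[of _ "\<lambda>s. Ln c + ln (1 + u s)"]) auto
  next
    case (Suc j)
    then obtain a where a: "dap S a" "\<And>s. Re s > 0 \<Longrightarrow> F (s + of_real (T - real j * h)) = exp (a s)" by auto
    define t where "t = T - real (Suc j) * h"
    have "real (Suc j) * h \<le> real K * h" using Suc.prems h by (intro mult_right_mono) auto
    hence t: "t \<ge> 0" using h by (simp add: t_def)
    have th: "T - real j * h = t + h" by (simp add: t_def algebra_simps)
    define G where "G = (\<lambda>s. F (s + of_real t))"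
    have G: "dap S G" unfolding G_def by (rule dap_shift[OF F t])
    have Gh: "G (s + of_real h) = exp (a s)" if "Re s > 0" for s
      using a(2)[OF that] unfolding G_def th by (simp add: add_ac)
    define u where "u = (\<lambda>s. (G s - G (s + of_real h)) * exp ((-1) * a s))"
    have u: "dap S u" unfolding u_def
      by (rule dap_mult[OF S dap_diff[OF S G dap_shift[OF G less_imp_le[OF h(1)]]]
            dap_exp[OF S dap_cmult[OF S a(1)]]])
    have u_le: "cmod (u s) \<le> 1/2" if s: "Re s > 0" for s
    proof -
      have "cmod (exp (a s)) \<ge> \<delta>" using Gh[OF s] \<delta>(2)[of "s + of_real h + of_real t"] s t h unfolding G_def by simp
      hence "cmod (exp ((-1) * a s)) \<le> 1 / \<delta>"
        using \<delta> by (simp add: exp_minus norm_inverse divide_inverse)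
      moreover have "cmod (G s - G (s + of_real h)) \<le> \<delta> / 2"
        using uc[of h "s + of_real t"] s t h unfolding G_def by (simp add: add_ac norm_minus_commute)
      ultimately have "cmod (u s) \<le> \<delta> / 2 * (1 / \<delta>)"
        unfolding u_def norm_mult using \<delta> by (intro mult_mono) auto
      thus ?thesis using \<delta> by simp
    qed
    have "dap S (\<lambda>s. a s + ln (1 + u s))"
      by (rule dap_add[OF a(1) dap_ln_one_plus[OF S u u_le]]) auto
    moreover have "G s = exp (a s + ln (1 + u s))" if s: "Re s > 0" for s
    proof -
      have "exp (a s + ln (1 + u s)) = exp (a s) * (1 + u s)"
        using u_le[OF s] by (simp add: exp_add exp_ln_one_plus)
      also have "\<dots> = exp (a s) + (G s - G (s + of_real h)) * (exp (a s) * exp (- a s))"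
        by (simp add: u_def algebra_simps)
      also have "\<dots> = G s" using Gh[OF s] by (simp add: exp_add[symmetric])
      finally show ?thesis by simp
    qed
    ultimately show ?case unfolding t_def[symmetric] G_def
      by (intro exI[of _ "\<lambda>s. a s + ln (1 + u s)"]) auto
  qed
  from this[of K] show ?thesis using h by simp
qed

section \<open>Coefficient estimates and the Wiener algebra\<close>

lemma has_series_tendsto:
  assumes "has_dirichlet_series F a" "Re s > 0"
  shows "(\<lambda>N. dirichlet_partial a N s) \<longlonglongrightarrow> F s"
proof -
  have "uniform_limit {z. Re z > Re s / 2} (dirichlet_partial a) F sequentially"
    using assms(1) half_gt_zero[OF assms(2)] unfolding has_dirichlet_series_def by blast
  thus ?thesis by (rule tendsto_uniform_limitI) (use assms in auto)
qed

lemma has_series_approx: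
  assumes "has_dirichlet_series F a" "t > 0" "e > 0"
  shows "\<exists>N0. \<forall>N\<ge>N0. \<forall>s. Re s > 0 \<longrightarrow> cmod (F (s + of_real t) - dirichlet_partial (\<lambda>n. a n * of_nat n powr (- of_real t)) N s) < e"
proof -
  have "uniform_limit {z. Re z > t} (dirichlet_partial a) F sequentially"
    using assms unfolding has_dirichlet_series_def by simp
  from uniform_limitD[OF this \<open>e > 0\<close>] obtain N0 where N0: "\<And>N z. N \<ge> N0 \<Longrightarrow> Re z > t \<Longrightarrow> dist (dirichlet_partial a N z) (F z) < e"
    by (auto simp: eventually_sequentially)
  show ?thesis
  proof (intro exI[of _ N0] allI impI)
    fix N s assume "N \<ge> N0" "Re (s::complex) > 0"
    thus "cmod (F (s + of_real t) - dirichlet_partial (\<lambda>n. a n * of_nat n powr (- of_real t)) N s) < e"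
      using N0[of N "s + of_real t"] by (simp add: dist_norm norm_minus_commute dirichlet_partial_shift)
  qed
qed

lemma has_series_shift:
  assumes "has_dirichlet_series F a" "t \<ge> 0"
  shows "has_dirichlet_series (\<lambda>s. F (s + of_real t)) (\<lambda>n. a n * of_nat n powr (- of_real t))"
  unfolding has_dirichlet_series_def
proof safe
  fix e :: real assume e: "e > 0"
  have "uniform_limit {z. Re z > e + t} (dirichlet_partial a) F sequentially"
    using assms e unfolding has_dirichlet_series_def by simp
  hence "uniform_limit {s. e < Re s} (\<lambda>N s. dirichlet_partial a N (s + of_real t)) (\<lambda>s. F (s + of_real t)) sequentially"
    by (rule uniform_limit_compose') auto
  thus "uniform_limit {s. e < Re s} (dirichlet_partial (\<lambda>n. a n * of_nat n powr (- of_real t))) (\<lambda>s. F (s + of_real t)) sequentially"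
    by (simp add: dirichlet_partial_shift)
qed

lemma has_series_dap_shift:
  assumes "has_dirichlet_series F a" "t > 0"
  shows "dap UNIV (\<lambda>s. F (s + of_real t))"
  unfolding dap_def
proof safe
  fix e :: real assume "e > 0"
  then obtain N where N: "\<And>s. Re s > 0 \<Longrightarrow> cmod (F (s + of_real t) - dirichlet_partial (\<lambda>n. a n * of_nat n powr (- of_real t)) N s) < e"
    using has_series_approx[OF assms \<open>e > 0\<close>] by blast
  show "\<exists>M. near UNIV M e (\<lambda>s. F (s + of_real t))"
    by (rule exI, rule nearI[OF _ order_refl]) (auto intro: less_imp_le N)
qed

text \<open>The constant depends on \<open>e\<close> only. This makes coefficients continuous functionals, and it serves as the
Cauchy estimate in Wiener's lemma.\<close>
theorem series_coeff_bound:
  assumes "e > 0"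
  obtains C where "C \<ge> 0" "\<And>F a B n. has_dirichlet_series F a \<Longrightarrow>
      (\<And>s. Re s > 0 \<Longrightarrow> cmod (F s) \<le> B) \<Longrightarrow> n \<ge> 1 \<Longrightarrow>
      cmod (a n) \<le> C * real n powr e * B"
proof -
  obtain C where C: "C \<ge> 0" "\<And>a M B n. (\<And>n. n > M \<Longrightarrow> a n = 0) \<Longrightarrow>
      (\<And>s. Re s > 0 \<Longrightarrow> cmod (dirichlet_partial a M s) \<le> B) \<Longrightarrow> n \<ge> 1 \<Longrightarrow>
      cmod (a n) \<le> C * real n powr (e/2) * B"
    using poly_coeff_bound[of "e/2"] assms by auto
  show ?thesis
  proof (rule that[OF C(1)])
    fix F a B and n :: nat
    assume F: "has_dirichlet_series F a" and B: "\<And>s. Re s > 0 \<Longrightarrow> cmod (F s) \<le> B" and n: "n \<ge> 1"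
    define b where "b = (\<lambda>n. a n * of_nat n powr (- of_real (e/2)))"
    have "cmod (b n) \<le> C * real n powr (e/2) * (B + h)" if h: "h > 0" for h
    proof -
      obtain N0 where N0: "\<And>N s. N \<ge> N0 \<Longrightarrow> Re s > 0 \<Longrightarrow> cmod (F (s + of_real (e/2)) - dirichlet_partial b N s) < h"
        using has_series_approx[OF F, of "e/2" h] h assms unfolding b_def by auto
      define N where "N = max N0 n"
      have "cmod (dirichlet_partial (trunc N b) N s) \<le> B + h" if s: "Re s > 0" for s
      proof -
        have "cmod (F (s + of_real (e/2))) \<le> B" using B[of "s + of_real (e/2)"] s assms by simp
        moreover have "cmod (F (s + of_real (e/2)) - dirichlet_partial b N s) < h" using N0[OF _ s, of N] by (simp add: N_def)
        ultimately have "cmod (dirichlet_partial b N s) \<le> B + h"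
          using norm_triangle_ineq4[of "F (s + of_real (e/2))" "F (s + of_real (e/2)) - dirichlet_partial b N s"] by simp
        thus ?thesis by (simp add: dirichlet_partial_trunc)
      qed
      moreover have "trunc N b m = 0" if "m > N" for m using that by (simp add: trunc_def)
      ultimately have "cmod (trunc N b n) \<le> C * real n powr (e/2) * (B + h)" by (intro C(2)[of N]) (use n in auto)
      thus ?thesis by (simp add: trunc_def N_def)
    qed
    hence "cmod (b n) \<le> C * real n powr (e/2) * B + h" if h: "h > 0" for h
    proof -
      define D where "D = C * real n powr (e/2) + 1"
      have D: "D > 0" using C unfolding D_def by (intro add_nonneg_pos mult_nonneg_nonneg) auto
      have "cmod (b n) \<le> C * real n powr (e/2) * (B + h / D)"
        using \<open>\<And>h. h > 0 \<Longrightarrow> cmod (b n) \<le> C * real n powr (e/2) * (B + h)\<close> h D by simp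
      also have "\<dots> = C * real n powr (e/2) * B + (D - 1) * (h / D)" by (simp add: D_def algebra_simps)
      also have "(D - 1) * (h / D) \<le> h" using D h by (simp add: field_simps)
      finally show ?thesis by simp
    qed
    hence "cmod (b n) \<le> C * real n powr (e/2) * B" by (rule field_le_epsilon)
    also have "cmod (b n) = cmod (a n) * real n powr (-(e/2))"
      unfolding b_def norm_mult using n by (subst norm_npow) auto
    finally have "cmod (a n) * real n powr (-(e/2)) * real n powr (e/2) \<le> C * real n powr (e/2) * B * real n powr (e/2)"
      by (intro mult_right_mono) auto
    also have "cmod (a n) * real n powr (-(e/2)) * real n powr (e/2) = cmod (a n)"
      using n by (simp add: powr_minus)
    also have "C * real n powr (e/2) * B * real n powr (e/2) = C * real n powr e * B"
      by (simp add: powr_add[symmetric] mult_ac)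
    finally show "cmod (a n) \<le> C * real n powr e * B" .
  qed
qed

text \<open>An absolutely convergent series is uniformly close to its partial sums.\<close>
lemma wapI_series:
  assumes lim: "\<And>s. Re s > 0 \<Longrightarrow> (\<lambda>N. dirichlet_partial g N s) \<longlonglongrightarrow> F s"
    and supp: "\<And>n. n \<ge> 1 \<Longrightarrow> n \<notin> S \<Longrightarrow> g n = 0"
    and M: "\<And>N. (\<Sum>n=1..N. cmod (g n)) \<le> M"
  shows "wap S M F"
  unfolding wap_def
proof safe
  fix e :: real assume e: "e > 0"
  define T where "T = (\<lambda>N. \<Sum>n=1..N. cmod (g n))"
  have "incseq T" by (intro incseq_SucI) (simp add: T_def)
  obtain A where A: "T \<longlonglongrightarrow> A" "\<And>N. T N \<le> A"
    using incseq_convergent[OF \<open>incseq T\<close>, of M] M unfolding T_def by blast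
  from order_tendstoD(1)[OF A(1), of "A - e"] e obtain N where N: "A - e < T N"
    by (auto simp: eventually_sequentially)
  define a where "a = (\<lambda>n. if n \<in> S then g n else 0)"
  have eq: "dirichlet_partial a K s = dirichlet_partial g K s" for K s
    by (rule dirichlet_partial_cong) (use supp in \<open>auto simp: a_def\<close>)
  show "near S M e F"
  proof (rule nearI)
    show "a n = 0" if "n \<notin> S" for n using that by (simp add: a_def)
    have "(\<Sum>n=1..N. cmod (a n)) = (\<Sum>n=1..N. cmod (g n))"
      by (rule sum.cong) (use supp in \<open>auto simp: a_def\<close>)
    thus "(\<Sum>n=1..N. cmod (a n)) \<le> M" using M by simp
    fix s :: complex assume s: "Re s > 0"
    have "cmod (dirichlet_partial g K s - dirichlet_partial g N s) \<le> e" if "K \<ge> N" for K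
    proof -
      have "dirichlet_partial g K s - dirichlet_partial g N s = (\<Sum>n\<in>{Suc N..K}. g n * of_nat n powr (-s))"
        using sum.ub_add_nat[of 1 N "\<lambda>n. g n * of_nat n powr (-s)" "K - N"] that
        by (simp add: dirichlet_partial_def)
      also have "cmod \<dots> \<le> (\<Sum>n\<in>{Suc N..K}. cmod (g n))"
        using s by (intro sum_norm_le) (auto simp: norm_mult intro!: mult_left_le norm_npow_le_1)
      also have "\<dots> = T K - T N"
        using sum.ub_add_nat[of 1 N "\<lambda>n. cmod (g n)" "K - N"] that by (simp add: T_def)
      also have "\<dots> \<le> e" using A(2)[of K] N by simp
      finally show ?thesis .
    qed
    moreover have "(\<lambda>K. cmod (dirichlet_partial g K s - dirichlet_partial g N s)) \<longlonglongrightarrow> cmod (F s - dirichlet_partial g N s)"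
      by (intro tendsto_intros lim s)
    ultimately have "cmod (F s - dirichlet_partial g N s) \<le> e"
      using LIMSEQ_le_const2 by blast
    thus "cmod (F s - dirichlet_partial a N s) \<le> e" by (simp add: eq)
  qed
qed

text \<open>The multiplicative monoid generated by the primes in \<open>Q\<close>.\<close>
definition smooth :: "nat set \<Rightarrow> nat set" where
  "smooth Q = {n. n \<ge> 1 \<and> (\<forall>p. prime p \<longrightarrow> p dvd n \<longrightarrow> p \<in> Q)}"

lemma mult_closed_smooth [simp]: "mult_closed (smooth Q)"
  by (auto simp: mult_closed_def smooth_def prime_dvd_mult_iff)

lemma smooth_empty: "smooth {} = {1}"
proof -
  have "n = 1" if "\<forall>p. prime p \<longrightarrow> \<not> p dvd n" for n :: nat
    using that prime_factor_nat by blast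
  thus ?thesis by (auto simp: smooth_def)
qed

text \<open>The Euler product over finitely many primes, established one prime at a time: every number in question is a
power of \<open>p\<close> times a number without the factor \<open>p\<close>.\<close>
lemma sum_smooth_bounded:
  assumes "finite Q" "\<And>p. p \<in> Q \<Longrightarrow> prime p" and \<sigma>: "\<sigma> > 0"
  shows "\<exists>C\<ge>0. \<forall>X. finite X \<longrightarrow> X \<subseteq> smooth Q \<longrightarrow> (\<Sum>n\<in>X. real n powr (-\<sigma>)) \<le> C"
  using assms(1,2)
proof (induction Q rule: finite_induct)
  case empty
  have "(\<Sum>n\<in>X. real n powr (-\<sigma>)) \<le> 1" if "X \<subseteq> {1}" for X
    using that by (auto simp: subset_singleton_iff)
  thus ?case unfolding smooth_empty by (intro exI[of _ 1]) auto
next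
  case (insert p Q)
  then obtain C where C: "C \<ge> 0" "\<And>X. finite X \<Longrightarrow> X \<subseteq> smooth Q \<Longrightarrow> (\<Sum>n\<in>X. real n powr (-\<sigma>)) \<le> C"
    by blast
  have p: "prime p" using insert.prems by simp
  define q where "q = real p powr (-\<sigma>)"
  have "q < real p powr 0" unfolding q_def using prime_gt_1_nat[OF p] \<sigma> by (intro powr_less_mono) auto
  hence q: "0 \<le> q" "q < 1" using prime_gt_0_nat[OF p] by (auto simp: q_def)
  have "(\<Sum>n\<in>X. real n powr (-\<sigma>)) \<le> 1 / (1 - q) * C" if X: "finite X" "X \<subseteq> smooth (insert p Q)" for X
  proof -
    define r where "r = (\<lambda>n. n div p ^ multiplicity p n)"
    define K where "K = Max (multiplicity p ` X)"
    have n_eq: "n = p ^ multiplicity p n * r n" for n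
      by (simp add: r_def multiplicity_dvd)
    have r: "r n \<in> smooth Q" if "n \<in> X" for n
    proof -
      have n: "n \<in> smooth (insert p Q)" "n > 0" using X that by (auto simp: smooth_def)
      have "\<not> p dvd r n"
        unfolding r_def using n p by (intro multiplicity_decompose) (auto simp: not_prime_unit)
      moreover have "r n dvd n" using n_eq[of n] by (metis dvd_triv_right)
      moreover have "r n \<noteq> 0" using n_eq[of n] n(2) by (metis mult_is_0 not_gr_zero)
      ultimately show ?thesis using n(1) unfolding smooth_def by (auto dest: dvd_trans)
    qed
    let ?g = "\<lambda>(k, m). p ^ k * m"
    have sub: "X \<subseteq> ?g ` ({..K} \<times> r ` X)"
    proof
      fix n assume "n \<in> X"
      moreover have "multiplicity p n \<le> K" unfolding K_def using X(1) \<open>n \<in> X\<close> by (intro Max_ge) auto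
      ultimately show "n \<in> ?g ` ({..K} \<times> r ` X)"
        using n_eq[of n] by (intro image_eqI[of _ _ "(multiplicity p n, r n)"]) auto
    qed
    have "(\<Sum>n\<in>X. real n powr (-\<sigma>)) \<le> (\<Sum>n\<in>?g ` ({..K} \<times> r ` X). real n powr (-\<sigma>))"
      using X sub by (intro sum_mono2) auto
    also have "\<dots> \<le> (\<Sum>x\<in>{..K} \<times> r ` X. real (?g x) powr (-\<sigma>))"
      using sum_image_le[of "{..K} \<times> r ` X" "\<lambda>n. real n powr (-\<sigma>)" ?g] X by (simp add: o_def)
    also have "\<dots> = (\<Sum>x\<in>{..K} \<times> r ` X. q ^ fst x * real (snd x) powr (-\<sigma>))"
      using prime_gt_0_nat[OF p]
      by (intro sum.cong refl) (auto simp: q_def powr_mult powr_powr powr_realpow[symmetric] mult_ac)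
    also have "\<dots> = (\<Sum>k\<le>K. q ^ k) * (\<Sum>m\<in>r ` X. real m powr (-\<sigma>))"
      by (simp add: sum_product sum.cartesian_product case_prod_beta)
    also have "\<dots> \<le> 1 / (1 - q) * C"
    proof (intro mult_mono)
      have "(\<Sum>k\<le>K. q ^ k) \<le> (\<Sum>k. q ^ k)" using q by (intro sum_le_suminf) auto
      thus "(\<Sum>k\<le>K. q ^ k) \<le> 1 / (1 - q)" using q by (simp add: suminf_geometric)
      show "(\<Sum>m\<in>r ` X. real m powr (-\<sigma>)) \<le> C" using X r by (intro C(2)) auto
    qed (use q in \<open>auto intro: sum_nonneg\<close>)
    finally show ?thesis .
  qed
  moreover have "1 / (1 - q) * C \<ge> 0" using q C by simp
  ultimately show ?case by blast
qed

text \<open>If only finitely many primes are involved, bounded functions become absolutely convergent after an arbitrarily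
small shift, with a constant independent of the function: the coefficients grow at most like \<open>n powr (\<eta>/2)\<close>, the
shift contributes \<open>n powr (-\<eta>)\<close>, and \<open>n powr (-\<eta>/2)\<close> is summable over the smooth numbers.\<close>
lemma smooth_cauchy_estimate:
  assumes "finite Q" "\<And>p. p \<in> Q \<Longrightarrow> prime p" and \<eta>: "\<eta> > 0"
  obtains C where "C \<ge> 0" "\<And>G B. dap (smooth Q) G \<Longrightarrow> (\<And>s. Re s > 0 \<Longrightarrow> cmod (G s) \<le> B) \<Longrightarrow>
     wap (smooth Q) (C * B) (\<lambda>s. G (s + of_real \<eta>))"
proof -
  obtain D where D: "D \<ge> 0" "\<And>X. finite X \<Longrightarrow> X \<subseteq> smooth Q \<Longrightarrow> (\<Sum>n\<in>X. real n powr (-(\<eta>/2))) \<le> D"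
    using sum_smooth_bounded[OF assms(1,2), of "\<eta>/2"] \<eta> by auto
  obtain C where C: "C \<ge> 0" "\<And>F a B n. has_dirichlet_series F a \<Longrightarrow>
      (\<And>s. Re s > 0 \<Longrightarrow> cmod (F s) \<le> B) \<Longrightarrow> n \<ge> 1 \<Longrightarrow> cmod (a n) \<le> C * real n powr (\<eta>/2) * B"
    using series_coeff_bound[of "\<eta>/2"] \<eta> by auto
  show ?thesis
  proof (rule that[of "C * D"])
    fix G B assume G: "dap (smooth Q) G" and B: "\<And>s. Re s > 0 \<Longrightarrow> cmod (G s) \<le> B"
    have B0: "B \<ge> 0" using order_trans[OF norm_ge_zero B[of 1]] by simp
    obtain g where g: "has_dirichlet_series G g" "\<And>n. n \<notin> smooth Q \<Longrightarrow> n \<ge> 1 \<Longrightarrow> g n = 0"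
      using dap_has_series[OF G] by blast
    define b where "b = (\<lambda>n. g n * of_nat n powr (- of_real \<eta>))"
    show "wap (smooth Q) (C * D * B) (\<lambda>s. G (s + of_real \<eta>))"
    proof (rule wapI_series)
      show "(\<lambda>N. dirichlet_partial b N s) \<longlonglongrightarrow> G (s + of_real \<eta>)" if "Re s > 0" for s
        using has_series_tendsto[OF has_series_shift[OF g(1), of \<eta>] that] \<eta> by (simp add: b_def)
      show "b n = 0" if "n \<ge> 1" "n \<notin> smooth Q" for n using g(2) that by (simp add: b_def)
      fix N
      have "(\<Sum>n=1..N. cmod (b n)) = (\<Sum>n\<in>{1..N} \<inter> smooth Q. cmod (b n))"
        by (rule sum.mono_neutral_right) (use g(2) in \<open>auto simp: b_def\<close>)
      also have "\<dots> \<le> (\<Sum>n\<in>{1..N} \<inter> smooth Q. C * B * real n powr (-(\<eta>/2)))"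
      proof (rule sum_mono)
        fix n assume "n \<in> {1..N} \<inter> smooth Q"
        hence n: "n \<ge> 1" by simp
        have "cmod (b n) = cmod (g n) * real n powr (-\<eta>)"
          unfolding b_def norm_mult using n by (subst norm_npow) auto
        also have "\<dots> \<le> (C * real n powr (\<eta>/2) * B) * real n powr (-\<eta>)"
          by (intro mult_right_mono C(2)[OF g(1) B n]) auto
        also have "\<dots> = C * B * (real n powr (\<eta>/2) * real n powr (-\<eta>))" by simp
        also have "real n powr (\<eta>/2) * real n powr (-\<eta>) = real n powr (-(\<eta>/2))"
          by (simp add: powr_add[symmetric])
        finally show "cmod (b n) \<le> C * B * real n powr (-(\<eta>/2))" .
      qed
      also have "\<dots> = C * B * (\<Sum>n\<in>{1..N} \<inter> smooth Q. real n powr (-(\<eta>/2)))" by (simp add: sum_distrib_left)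
      also have "\<dots> \<le> C * B * D" using C B0 by (intro mult_left_mono D) auto
      finally show "(\<Sum>n=1..N. cmod (b n)) \<le> C * D * B" by (simp add: mult_ac)
    qed
  qed (use C D in auto)
qed

text \<open>Wiener's lemma, with a logarithm instead of an inverse. Approximate \<open>f\<close> by a Dirichlet polynomial \<open>P\<close>, with error
\<open>\<delta>/4\<close> in the norm of absolute sums. \<open>P\<close> remains bounded below on a slightly larger half-plane and involves finitely many primes. Hence it
has a logarithm there, and the Cauchy estimate bounds the powers \<open>P ^ (-k)\<close> by \<open>C * (2/\<delta>) ^ k\<close> in the norm of absolute
sums. So \<open>u = (f - P) / P\<close> has spectral radius at most 1/2 and \<open>ln (1 + u)\<close> converges absolutely.\<close>
theorem wap_log:
  assumes f: "wap UNIV M f" and \<delta>: "\<delta> > 0" "\<And>s. Re s > 0 \<Longrightarrow> cmod (f s) \<ge> \<delta>"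
  shows "\<exists>M' a. wap UNIV M' a \<and> (\<forall>s. Re s > 0 \<longrightarrow> f s = exp (a s))"
proof -
  obtain a where a: "has_dirichlet_series f a" "\<And>N. (\<Sum>n=1..N. cmod (a n)) \<le> M"
    using wap_has_series[OF f] by blast
  define T where "T = (\<lambda>N. \<Sum>n=1..N. cmod (a n))"
  have "incseq T" by (intro incseq_SucI) (simp add: T_def)
  obtain A where A: "T \<longlonglongrightarrow> A" "\<And>N. T N \<le> A"
    using incseq_convergent[OF \<open>incseq T\<close>, of M] a(2) unfolding T_def by blast
  from order_tendstoD(1)[OF A(1), of "A - \<delta>/4"] \<delta> obtain N where N: "A - \<delta>/4 < T N"
    by (auto simp: eventually_sequentially)
  define P where "P = dirichlet_partial a N"
  have fP: "wap UNIV (\<delta>/4) (\<lambda>s. f s - P s)"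
  proof (rule wapI_series)
    define b where "b = (\<lambda>n. if n \<le> N then 0 else a n)"
    show "(\<lambda>K. dirichlet_partial b K s) \<longlonglongrightarrow> f s - P s" if "Re s > 0" for s
    proof (rule Lim_transform_eventually)
      show "(\<lambda>K. dirichlet_partial a K s - P s) \<longlonglongrightarrow> f s - P s"
        by (intro tendsto_intros has_series_tendsto[OF a(1) that])
      have "dirichlet_partial a K s - P s = dirichlet_partial b K s" if "K \<ge> N" for K
        unfolding P_def dirichlet_partial_trunc[OF that, symmetric] dirichlet_partial_diff
        by (rule dirichlet_partial_cong) (auto simp: trunc_def b_def)
      thus "\<forall>\<^sub>F K in sequentially. dirichlet_partial a K s - P s = dirichlet_partial b K s"
        by (auto simp: eventually_sequentially)
    qed
    fix K
    have "(\<Sum>n=1..K. cmod (b n)) \<le> \<delta>/4"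
    proof (cases "K \<ge> N")
      case True
      have "(\<Sum>n=1..K. cmod (b n)) = (\<Sum>n=Suc N..K. cmod (a n))"
        by (rule sum.mono_neutral_cong_right) (auto simp: b_def)
      also have "\<dots> = T K - T N"
        using sum.ub_add_nat[of 1 N "\<lambda>n. cmod (a n)" "K - N"] True by (simp add: T_def)
      also have "\<dots> \<le> \<delta>/4" using N A(2)[of K] by simp
      finally show ?thesis .
    qed (use \<delta> in \<open>simp add: b_def\<close>)
    thus "(\<Sum>n=1..K. cmod (b n)) \<le> \<delta>/4" .
  qed auto
  define Q where "Q = {p. prime p \<and> p \<le> N}"
  have Q: "finite Q" "\<And>p. p \<in> Q \<Longrightarrow> prime p" by (auto simp: Q_def)
  define S where "S = smooth Q"
  have S: "mult_closed S" by (simp add: S_def)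
  have sm: "n \<in> S" if "1 \<le> n" "n \<le> N" for n
    using that by (auto simp: S_def smooth_def Q_def dest: dvd_imp_le)
  have "((\<lambda>\<eta>. \<Sum>n=1..N. cmod (a n) * (real n powr \<eta> - 1)) \<longlongrightarrow> (\<Sum>n=1..N. cmod (a n) * (real n powr 0 - 1))) (at_right 0)"
    by (intro tendsto_intros) auto
  hence "((\<lambda>\<eta>. \<Sum>n=1..N. cmod (a n) * (real n powr \<eta> - 1)) \<longlongrightarrow> 0) (at_right 0)" by simp
  hence "\<forall>\<^sub>F \<eta> in at_right 0. (\<Sum>n=1..N. cmod (a n) * (real n powr \<eta> - 1)) < \<delta>/4"
    using \<delta> by (intro order_tendstoD(2)) auto
  with eventually_at_right_less[of 0] have "\<forall>\<^sub>F \<eta> in at_right 0. 0 < \<eta> \<and> (\<Sum>n=1..N. cmod (a n) * (real n powr \<eta> - 1)) < \<delta>/4"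
    by eventually_elim auto
  then obtain \<eta> :: real where \<eta>: "\<eta> > 0" "(\<Sum>n=1..N. cmod (a n) * (real n powr \<eta> - 1)) < \<delta>/4"
    using eventually_happens'[OF trivial_limit_at_right_real] by blast
  \<comment> \<open>\<open>P\<close> on the larger half-plane \<open>Re s > - \<eta>\<close>, moved back to the right half-plane\<close>
  define F where "F = (\<lambda>s. P (s - of_real \<eta>))"
  have PF: "cmod (F s - P s) \<le> \<delta>/4" if s: "Re s > 0" for s
  proof -
    have "F s - P s = (\<Sum>n=1..N. a n * (of_nat n powr (- (s - of_real \<eta>)) - of_nat n powr (- s)))"
      by (simp add: F_def P_def dirichlet_partial_def right_diff_distrib sum_subtractf)
    also have "cmod \<dots> \<le> (\<Sum>n=1..N. cmod (a n) * (real n powr \<eta> - 1))"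
    proof (rule sum_norm_le)
      fix n assume n: "n \<in> {1..N}"
      have "of_nat n powr (- (s - of_real \<eta>)) - of_nat n powr (- s) = of_nat n powr (-s) * of_real (real n powr \<eta> - 1)"
        using n by (simp add: powr_of_real[symmetric] powr_add[symmetric] algebra_simps)
      hence "cmod (of_nat n powr (- (s - of_real \<eta>)) - of_nat n powr (- s)) = cmod (of_nat n powr (-s)) * \<bar>real n powr \<eta> - 1\<bar>"
        by (metis norm_mult norm_of_real)
      also have "\<dots> \<le> 1 * \<bar>real n powr \<eta> - 1\<bar>"
        using n s by (intro mult_right_mono norm_npow_le_1) auto
      also have "\<bar>real n powr \<eta> - 1\<bar> = real n powr \<eta> - 1"
        using n \<eta> ge_one_powr_ge_zero[of "real n" \<eta>] by simp
      finally show "cmod (a n * (of_nat n powr (- (s - of_real \<eta>)) - of_nat n powr (- s))) \<le> cmod (a n) * (real n powr \<eta> - 1)"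
        by (simp add: norm_mult mult_left_mono)
    qed
    finally show ?thesis using \<eta> by simp
  qed
  have P_ge: "cmod (P s) \<ge> 3/4 * \<delta>" if "Re s > 0" for s
    using \<delta>(2)[OF that] wap_bound[OF fP that] norm_triangle_ineq[of "f s - P s" "P s"] by simp
  have F_ge: "cmod (F s) \<ge> \<delta>/2" if "Re s > 0" for s
    using P_ge[OF that] PF[OF that] norm_triangle_ineq4[of "F s" "F s - P s"] by simp
  have "dap S F" unfolding dap_def
  proof safe
    fix e :: real assume e: "e > 0"
    define b where "b = (\<lambda>n. if n \<in> S then a n * of_nat n powr of_real \<eta> else 0)"
    have "F = dirichlet_partial b N"
    proof
      fix s
      have "F s = dirichlet_partial (\<lambda>n. a n * of_nat n powr of_real \<eta>) N s"
        using dirichlet_partial_shift[of a N s "- of_real \<eta>"] by (simp add: F_def P_def)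
      also have "\<dots> = dirichlet_partial b N s"
        by (rule dirichlet_partial_cong) (use sm in \<open>auto simp: b_def\<close>)
      finally show "F s = dirichlet_partial b N s" .
    qed
    thus "\<exists>M. near S M e F" using near_poly[of S b e N] e by (auto simp: b_def)
  qed
  from dap_log[OF S this _ F_ge] \<delta> obtain L where L: "dap S L" "\<And>s. Re s > 0 \<Longrightarrow> F s = exp (L s)" by auto
  obtain B where B: "B > 0" "\<And>s. Re s > 0 \<Longrightarrow> cmod (L s) \<le> B" using dap_bound[OF L(1)] by blast
  obtain C where C: "C \<ge> 0" "\<And>G B. dap S G \<Longrightarrow> (\<And>s. Re s > 0 \<Longrightarrow> cmod (G s) \<le> B) \<Longrightarrow>
     wap S (C * B) (\<lambda>s. G (s + of_real \<eta>))"
    using smooth_cauchy_estimate[OF Q \<eta>(1)] unfolding S_def by blast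
  have PL: "P s = exp (L (s + of_real \<eta>))" if "Re s > 0" for s
    using L(2)[of "s + of_real \<eta>"] that \<eta> by (simp add: F_def)
  \<comment> \<open>\<open>E\<close> is \<open>1 / F\<close>, written as an exponential so that it is almost periodic\<close>
  define E where "E = (\<lambda>s. exp ((-1) * L s))"
  have E: "dap S E" unfolding E_def by (rule dap_exp[OF S dap_cmult[OF S L(1)]])
  have E_le: "cmod (E s) \<le> 2 / \<delta>" if "Re s > 0" for s
  proof -
    have "cmod (exp (L s)) \<ge> \<delta>/2" using F_ge[OF that] L(2)[OF that] by simp
    hence "inverse (cmod (exp (L s))) \<le> inverse (\<delta>/2)" using \<delta> by (intro le_imp_inverse_le) auto
    thus ?thesis by (simp add: E_def exp_minus norm_inverse)
  qed
  define u where "u = (\<lambda>s. (f s - P s) * E (s + of_real \<eta>))"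
  have u_pow: "wap UNIV (C * (1/2) ^ k) (\<lambda>s. u s ^ k)" for k
  proof -
    have "wap S (C * (2 / \<delta>) ^ k) (\<lambda>s. E (s + of_real \<eta>) ^ k)"
      by (rule C(2)[OF dap_power[OF S E]]) (use E_le in \<open>auto simp: norm_power intro!: power_mono\<close>)
    hence "wap UNIV (C * (2 / \<delta>) ^ k) (\<lambda>s. E (s + of_real \<eta>) ^ k)" by (rule wap_mono) auto
    from wap_mult[OF mult_closed_UNIV wap_power[OF mult_closed_UNIV fP, of k] this]
    have "wap UNIV ((\<delta>/4) ^ k * (C * (2 / \<delta>) ^ k)) (\<lambda>s. u s ^ k)"
      by (simp add: u_def power_mult_distrib)
    also have "(\<delta>/4) ^ k * (C * (2 / \<delta>) ^ k) = C * ((\<delta>/4) * (2 / \<delta>)) ^ k"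
      by (simp only: power_mult_distrib mult_ac)
    also have "(\<delta>/4) * (2 / \<delta>) = 1/2" using \<delta> by simp
    finally show ?thesis .
  qed
  have u_less: "cmod (u s) < 1" if s: "Re s > 0" for s
  proof -
    have "cmod (u s) \<le> \<delta>/4 * (2/\<delta>)" unfolding u_def norm_mult
      using wap_bound[OF fP s] E_le[of "s + of_real \<eta>"] s \<eta> \<delta> by (intro mult_mono) auto
    thus ?thesis using \<delta> by simp
  qed
  have "wap UNIV (C * B + (\<Sum>k. C * (1/2) ^ k)) (\<lambda>s. L (s + of_real \<eta>) + ln (1 + u s))"
  proof (rule wap_add)
    show "wap UNIV (C * B) (\<lambda>s. L (s + of_real \<eta>))"
      by (rule wap_mono[OF C(2)[OF L(1) B(2)]]) auto
    show "wap UNIV (\<Sum>k. C * (1/2) ^ k) (\<lambda>s. ln (1 + u s))"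
      by (rule wap_ln_one_plus[OF mult_closed_UNIV u_pow _ u_less]) (auto intro!: summable_mult summable_geometric)
  qed
  moreover have "f s = exp (L (s + of_real \<eta>) + ln (1 + u s))" if s: "Re s > 0" for s
  proof -
    have "exp (L (s + of_real \<eta>) + ln (1 + u s)) = P s * (1 + u s)"
      using u_less[OF s] PL[OF s] by (simp add: exp_add exp_ln_one_plus)
    also have "\<dots> = P s + (f s - P s) * (exp (L (s + of_real \<eta>)) * E (s + of_real \<eta>))"
      using PL[OF s] by (simp add: u_def algebra_simps)
    also have "exp (L (s + of_real \<eta>)) * E (s + of_real \<eta>) = 1" by (simp add: E_def exp_add[symmetric])
    finally show ?thesis by simp
  qed
  ultimately show ?thesis by blast
qed

section \<open>The algebra of Dirichlet series\<close>

lemma has_series_cong: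
  assumes "\<And>s. Re s > 0 \<Longrightarrow> F s = G s" "\<And>n. n \<ge> 1 \<Longrightarrow> a n = b n"
  shows "has_dirichlet_series F a \<longleftrightarrow> has_dirichlet_series G b"
proof -
  have "dirichlet_partial a = dirichlet_partial b"
    using assms(2) by (auto simp: fun_eq_iff intro!: dirichlet_partial_cong)
  moreover have "uniform_limit {s. Re s > e} (dirichlet_partial b) F sequentially \<longleftrightarrow>
     uniform_limit {s. Re s > e} (dirichlet_partial b) G sequentially" if "e > 0" for e
    using assms(1) that by (intro uniform_limit_cong') auto
  ultimately show ?thesis unfolding has_dirichlet_series_def by auto
qed

lemma has_series_unique:
  assumes "has_dirichlet_series F a" "has_dirichlet_series F b" "n \<ge> 1" shows "a n = b n"
  using dirichlet_coeff_eq[OF assms(1)] dirichlet_coeff_eq[OF assms(2)] assms(3)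
  by (metis fun_upd_other not_one_le_zero)

lemma has_series_fun_unique:
  assumes "has_dirichlet_series F a" "has_dirichlet_series G b" "\<And>n. n \<ge> 1 \<Longrightarrow> a n = b n" "Re s > 0"
  shows "F s = G s"
proof -
  have "has_dirichlet_series F b" using assms(1,3) has_series_cong[of F F a b] by simp
  from has_series_tendsto[OF this assms(4)] has_series_tendsto[OF assms(2,4)]
  show ?thesis by (rule LIMSEQ_unique)
qed

lemma has_series_dirichlet_coeff:
  assumes "has_dirichlet_series F a"
  shows "has_dirichlet_series F (dirichlet_coeff F)" and "n \<ge> 1 \<Longrightarrow> dirichlet_coeff F n = a n"
proof -
  show eq: "dirichlet_coeff F n = a n" if "n \<ge> 1" for n
    using dirichlet_coeff_eq[OF assms] that by simp
  show "has_dirichlet_series F (dirichlet_coeff F)"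
    using assms has_series_cong[of F F "dirichlet_coeff F" a] eq by simp
qed

lemma open_right_halfplane: "open right_halfplane"
  unfolding right_halfplane_def by (rule open_halfspace_Re_gt)

lemma convex_right_halfplane: "convex right_halfplane"
  unfolding right_halfplane_def by (rule convex_halfspace_Re_gt)

lemma dirichlet_partial_holomorphic: "dirichlet_partial a N holomorphic_on A"
  unfolding dirichlet_partial_def by (intro holomorphic_intros)

lemma has_series_holomorphic:
  assumes "has_dirichlet_series F a"
  shows "F holomorphic_on right_halfplane"
proof (rule holomorphic_uniform_sequence[OF open_right_halfplane])
  show "dirichlet_partial a N holomorphic_on right_halfplane" for N
    by (rule dirichlet_partial_holomorphic)
  fix z assume z: "z \<in> right_halfplane"
  define d where "d = Re z / 2"
  have d: "d > 0" using z by (simp add: d_def right_halfplane_def)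
  have sub: "cball z (d/2) \<subseteq> {s. Re s > d}"
  proof
    fix s assume "s \<in> cball z (d/2)"
    hence "\<bar>Re (z - s)\<bar> \<le> d/2" using abs_Re_le_cmod[of "z - s"] by (simp add: dist_norm)
    hence "Re z - Re s \<le> d/2" unfolding minus_complex.sel by linarith
    moreover have "Re z = 2 * d" by (simp add: d_def)
    ultimately show "s \<in> {s. Re s > d}" using d by simp
  qed
  have "uniform_limit (cball z (d/2)) (dirichlet_partial a) F sequentially"
    using assms d sub uniform_limit_on_subset unfolding has_dirichlet_series_def by blast
  moreover have "cball z (d/2) \<subseteq> right_halfplane" using sub d by (auto simp: right_halfplane_def)
  ultimately show "\<exists>d>0. cball z d \<subseteq> right_halfplane \<and> uniform_limit (cball z d) (dirichlet_partial a) F sequentially"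
    using d by (intro exI[of _ "d/2"]) auto
qed

lemma has_series_lincomb:
  assumes "has_dirichlet_series F a" "has_dirichlet_series G b"
  shows "has_dirichlet_series (\<lambda>s. c * F s + d * G s) (\<lambda>n. c * a n + d * b n)"
  unfolding has_dirichlet_series_def
proof safe
  fix e :: real assume "e > 0"
  hence "uniform_limit {s. Re s > e} (\<lambda>N s. c * dirichlet_partial a N s + d * dirichlet_partial b N s) (\<lambda>s. c * F s + d * G s) sequentially"
    using assms unfolding has_dirichlet_series_def
    by (intro uniform_limit_add bounded_linear.uniform_limit[OF bounded_linear_mult_right]) auto
  moreover have "c * dirichlet_partial a N s + d * dirichlet_partial b N s = dirichlet_partial (\<lambda>n. c * a n + d * b n) N s" for N s
    by (simp add: dirichlet_partial_def sum_distrib_left sum.distrib algebra_simps)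
  ultimately show "uniform_limit {s. Re s > e} (dirichlet_partial (\<lambda>n. c * a n + d * b n)) (\<lambda>s. c * F s + d * G s) sequentially"
    by (simp add: fun_eq_iff)
qed

lemma has_series_diff:
  "has_dirichlet_series F a \<Longrightarrow> has_dirichlet_series G b \<Longrightarrow> has_dirichlet_series (\<lambda>s. F s - G s) (\<lambda>n. a n - b n)"
  using has_series_lincomb[of F a G b 1 "-1"] by simp

lemma has_series_poly: "has_dirichlet_series (dirichlet_partial a N) (trunc N a)"
  unfolding has_dirichlet_series_def
proof safe
  fix e :: real
  have "\<forall>\<^sub>F K in sequentially. \<forall>s\<in>{s. Re s > e}. dirichlet_partial (trunc N a) K s = dirichlet_partial a N s"
    using dirichlet_partial_trunc unfolding eventually_sequentially by blast
  thus "uniform_limit {s. Re s > e} (dirichlet_partial (trunc N a)) (dirichlet_partial a N) sequentially"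
    using uniform_limit_const by (subst uniform_limit_cong) auto
qed

lemma has_series_const: "has_dirichlet_series (\<lambda>_. c) (\<lambda>n. if n = 1 then c else 0)"
proof -
  define a where "a = (\<lambda>n::nat. if n = 1 then c else 0 :: complex)"
  have "dirichlet_partial a 1 = (\<lambda>_. c)" by (auto simp: dirichlet_partial_def a_def)
  moreover have "trunc 1 a = a" by (auto simp: trunc_def a_def)
  ultimately show ?thesis using has_series_poly[of a 1] by (simp add: a_def)
qed

text \<open>The converse of \<open>has_series_dap_shift\<close>: membership in \<^const>\<open>Ou\<close> can be tested on the shifts, where it is
stable under products, exponentials and logarithms. The series of different shifts fit together by uniqueness.\<close>
theorem dap_shifts_has_series:
  assumes "\<And>t. t > 0 \<Longrightarrow> dap UNIV (\<lambda>s. F (s + of_real t))"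
  shows "\<exists>a. has_dirichlet_series F a"
proof -
  have "\<exists>a. has_dirichlet_series (\<lambda>s. F (s + of_real t)) a" if "t > 0" for t :: real
    using dap_has_series[OF assms[OF that]] by blast
  then obtain A where A: "\<And>t::real. t > 0 \<Longrightarrow> has_dirichlet_series (\<lambda>s. F (s + of_real t)) (A t)" by metis
  \<comment> \<open>read off from the shift by 1 and undo that shift\<close>
  define a where "a = (\<lambda>n. A 1 n * of_nat n)"
  have a_eq: "A t n = a n * of_nat n powr (- of_real t)" if t: "0 < t" "t \<le> 1" and n: "n \<ge> 1" for t n
  proof -
    have "has_dirichlet_series (\<lambda>s. F (s + of_real (1 - t) + of_real t)) (\<lambda>n. A t n * of_nat n powr (- of_real (1 - t)))"
      using has_series_shift[OF A[OF t(1)], of "1 - t"] t by simp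
    moreover have "(\<lambda>s. F (s + of_real (1 - t) + of_real t)) = (\<lambda>s. F (s + of_real 1))"
      by (auto simp: algebra_simps)
    ultimately have "A 1 n = A t n * of_nat n powr (- of_real (1 - t))"
      using has_series_unique[OF A[of 1] _ n] by simp
    moreover have "of_nat n powr (- of_real (1 - t)) * of_nat n powr (of_real (1 - t)) = (1 :: complex)"
      using n by (simp only: powr_add[symmetric]) simp
    ultimately have "A 1 n * of_nat n powr (of_real (1 - t)) = A t n"
      by (simp only: mult.assoc) simp
    moreover have "of_nat n powr (of_real (1 - t)) = (of_nat n * of_nat n powr (- of_real t) :: complex)"
      using n by (simp add: powr_diff powr_minus divide_inverse)
    ultimately show ?thesis by (simp add: a_def mult.assoc)
  qed
  have "has_dirichlet_series F a"
    unfolding has_dirichlet_series_def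
  proof safe
    fix e :: real assume e: "e > 0"
    define t where "t = min 1 (e / 2)"
    have t: "0 < t" "t \<le> 1" "t < e" using e by (auto simp: t_def)
    have "uniform_limit {s. Re s > e - t} (dirichlet_partial (A t)) (\<lambda>s. F (s + of_real t)) sequentially"
      using A[OF t(1)] t unfolding has_dirichlet_series_def by simp
    hence "uniform_limit {s. Re s > e} (\<lambda>N s. dirichlet_partial (A t) N (s - of_real t)) (\<lambda>s. F (s - of_real t + of_real t)) sequentially"
      by (rule uniform_limit_compose') auto
    moreover have "dirichlet_partial (A t) N (s - of_real t) = dirichlet_partial a N s" for N s
    proof -
      have "dirichlet_partial (A t) N (s - of_real t) = dirichlet_partial (\<lambda>n. a n * of_nat n powr (- of_real t)) N (s - of_real t)"
        by (rule dirichlet_partial_cong) (use a_eq t in auto)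
      also have "\<dots> = dirichlet_partial a N s" by (simp add: dirichlet_partial_shift[symmetric])
      finally show ?thesis .
    qed
    ultimately show "uniform_limit {s. Re s > e} (dirichlet_partial a) F sequentially" by simp
  qed
  thus ?thesis by blast
qed

definition dconv :: "(nat \<Rightarrow> complex) \<Rightarrow> (nat \<Rightarrow> complex) \<Rightarrow> nat \<Rightarrow> complex" where
  "dconv a b n = (\<Sum>d | d dvd n. a d * b (n div d))"

lemma poly_conv_eq_dconv:
  assumes "1 \<le> n" "n \<le> N" "n \<le> K"
  shows "poly_conv N K a b n = dconv a b n"
  unfolding poly_conv_def dconv_def
proof (rule sum.reindex_bij_witness[of _ "\<lambda>d. (d, n div d)" fst])
  fix p assume p: "p \<in> {p \<in> {1..N} \<times> {1..K}. fst p * snd p = n}"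
  show "(fst p, n div fst p) = p" using p by auto
  show "fst p \<in> {d. d dvd n}" using p by auto
  show "a (fst p) * b (n div fst p) = a (fst p) * b (snd p)" using p by auto
next
  fix d assume "d \<in> {d. d dvd n}"
  then obtain k where k: "n = d * k" by auto
  hence dk: "d \<ge> 1" "k \<ge> 1" "d \<le> n" "k \<le> n" using assms(1) by (auto simp: Suc_le_eq)
  hence "d \<le> N" "k \<le> K" using assms by linarith+
  thus "(d, n div d) \<in> {p \<in> {1..N} \<times> {1..K}. fst p * snd p = n}" using k dk by auto
qed auto

lemma dconv_cong:
  assumes "n \<ge> 1" "\<And>d. d dvd n \<Longrightarrow> a d = a' d" "\<And>d. d dvd n \<Longrightarrow> b d = b' d"
  shows "dconv a b n = dconv a' b' n"
  unfolding dconv_def using assms by (intro sum.cong) (auto simp: div_dvd_iff_mult)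

lemma dconv_mult_char:
  assumes "n \<ge> 1" "\<And>d e. d * e = n \<Longrightarrow> ch d * ch e = (ch n :: complex)"
  shows "dconv (\<lambda>n. a n * ch n) (\<lambda>n. b n * ch n) n = dconv a b n * ch n"
  unfolding dconv_def sum_distrib_right
proof (rule sum.cong)
  fix d assume "d \<in> {d. d dvd n}"
  thus "a d * ch d * (b (n div d) * ch (n div d)) = a d * b (n div d) * ch n"
    using assms(2)[of d "n div d"] by (simp add: mult_ac flip: assms(2)[of d "n div d"])
qed auto

text \<open>The product has some Dirichlet series because its shifts are almost periodic. Its coefficients are found by comparison with products of partial sums, since coefficients depend continuously on
the function.\<close>
theorem has_series_mult:
  assumes F: "has_dirichlet_series F a" and G: "has_dirichlet_series G b"
  shows "has_dirichlet_series (\<lambda>s. F s * G s) (dconv a b)"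
proof -
  have "\<exists>c. has_dirichlet_series (\<lambda>s. F s * G s) c"
    by (rule dap_shifts_has_series) (rule dap_mult[OF mult_closed_UNIV has_series_dap_shift[OF F] has_series_dap_shift[OF G]])
  then obtain c where c: "has_dirichlet_series (\<lambda>s. F s * G s) c" ..
  have "c n = dconv a b n" if n: "n \<ge> 1" for n
  proof -
    define ch where "ch = (\<lambda>n::nat. of_nat n powr (- of_real 1) :: complex)"
    have ch: "ch n \<noteq> 0" using n by (simp add: ch_def)
    obtain C where C: "C \<ge> 0" "\<And>F a B n. has_dirichlet_series F a \<Longrightarrow>
      (\<And>s. Re s > 0 \<Longrightarrow> cmod (F s) \<le> B) \<Longrightarrow> n \<ge> 1 \<Longrightarrow> cmod (a n) \<le> C * real n powr 1 * B"
      using series_coeff_bound[of 1] by auto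
    define F1 G1 where "F1 = (\<lambda>s. F (s + of_real 1))" and "G1 = (\<lambda>s. G (s + of_real 1))"
    obtain B where B: "B > 0" "\<And>s. Re s > 0 \<Longrightarrow> cmod (F1 s) \<le> B"
      using dap_bound[OF has_series_dap_shift[OF F, of 1]] unfolding F1_def by auto
    obtain B' where B': "B' > 0" "\<And>s. Re s > 0 \<Longrightarrow> cmod (G1 s) \<le> B'"
      using dap_bound[OF has_series_dap_shift[OF G, of 1]] unfolding G1_def by auto
    have key: "cmod (c n * ch n - dconv a b n * ch n) \<le> C * real n * e" if e: "e > 0" for e
    proof -
      obtain h where h: "h > 0" "h * B' + (B + h) * h \<le> e"
        by (rule mult_error[of e B B']) (use e B B' in auto)
      define a' b' where "a' = (\<lambda>n. a n * ch n)" and "b' = (\<lambda>n. b n * ch n)"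
      obtain N1 where N1: "\<And>N s. N \<ge> N1 \<Longrightarrow> Re s > 0 \<Longrightarrow> cmod (F1 s - dirichlet_partial a' N s) < h"
        using has_series_approx[OF F, of 1 h] h unfolding F1_def a'_def ch_def by auto
      obtain N2 where N2: "\<And>N s. N \<ge> N2 \<Longrightarrow> Re s > 0 \<Longrightarrow> cmod (G1 s - dirichlet_partial b' N s) < h"
        using has_series_approx[OF G, of 1 h] h unfolding G1_def b'_def ch_def by auto
      define N where "N = Max {N1, N2, n}"
      have N: "N1 \<le> N" "N2 \<le> N" "n \<le> N" by (auto simp: N_def)
      define H where "H = (\<lambda>s. F1 s * G1 s - dirichlet_partial (poly_conv N N a' b') (N * N) s)"
      have "has_dirichlet_series (\<lambda>s. F1 s * G1 s) (\<lambda>n. c n * ch n)"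
        using has_series_shift[OF c, of 1] unfolding F1_def G1_def ch_def by simp
      hence H: "has_dirichlet_series H (\<lambda>n. c n * ch n - trunc (N * N) (poly_conv N N a' b') n)"
        unfolding H_def by (intro has_series_diff has_series_poly)
      have "cmod (H s) \<le> e" if s: "Re s > 0" for s
      proof -
        define P Q where "P = dirichlet_partial a' N s" and "Q = dirichlet_partial b' N s"
        have PF: "cmod (F1 s - P) \<le> h" and QG: "cmod (G1 s - Q) \<le> h"
          using N1[OF N(1) s] N2[OF N(2) s] by (simp_all add: P_def Q_def)
        have P: "cmod P \<le> B + h"
          using norm_triangle_ineq4[of "F1 s" "F1 s - P"] PF B(2)[OF s] by simp
        have "H s = F1 s * G1 s - P * Q"
          unfolding H_def P_def Q_def dirichlet_partial_mult(1) ..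
        also have "\<dots> = (F1 s - P) * G1 s + P * (G1 s - Q)" by (simp add: algebra_simps)
        also have "cmod \<dots> \<le> cmod (F1 s - P) * cmod (G1 s) + cmod P * cmod (G1 s - Q)"
          by (metis norm_mult norm_triangle_ineq)
        also have "\<dots> \<le> h * B' + (B + h) * h"
          using PF QG P B'(2)[OF s] h B B' by (intro add_mono mult_mono) auto
        finally show ?thesis using h by simp
      qed
      from C(2)[OF H this n] have "cmod (c n * ch n - trunc (N * N) (poly_conv N N a' b') n) \<le> C * real n * e"
        using n by simp
      also have "trunc (N * N) (poly_conv N N a' b') n = poly_conv N N a' b' n"
      proof -
        have "n \<le> N * N" using N(3) le_square[of N] by (rule order_trans)
        thus ?thesis by (simp add: trunc_def)
      qed
      also have "\<dots> = dconv a' b' n" by (rule poly_conv_eq_dconv) (use N n in auto)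
      also have "\<dots> = dconv a b n * ch n"
        unfolding a'_def b'_def using n by (intro dconv_mult_char) (auto simp: ch_def npow_mult simp del: of_nat_mult)
      finally show ?thesis .
    qed
    have "cmod (c n * ch n - dconv a b n * ch n) \<le> 0 + h" if h: "h > 0" for h
    proof -
      have D: "C * real n + 1 > 0" using C by (intro add_nonneg_pos) auto
      have "cmod (c n * ch n - dconv a b n * ch n) \<le> C * real n * (h / (C * real n + 1))"
        using D h by (intro key) auto
      also have "\<dots> \<le> h" using D h by (simp add: field_simps)
      finally show ?thesis by simp
    qed
    hence "cmod (c n * ch n - dconv a b n * ch n) \<le> 0" by (rule field_le_epsilon)
    thus ?thesis using ch by (simp flip: left_diff_distrib)
  qed
  with c show ?thesis using has_series_cong[of "\<lambda>s. F s * G s" "\<lambda>s. F s * G s" c "dconv a b"] by simp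
qed

fun dpow :: "(nat \<Rightarrow> complex) \<Rightarrow> nat \<Rightarrow> nat \<Rightarrow> complex" where
  "dpow a 0 = (\<lambda>n. if n = 1 then 1 else 0)"
| "dpow a (Suc k) = dconv a (dpow a k)"

lemma has_series_power:
  "has_dirichlet_series F a \<Longrightarrow> has_dirichlet_series (\<lambda>s. F s ^ k) (dpow a k)"
  using has_series_const[of 1] by (induction k) (auto simp: has_series_mult)

lemma has_series_exp_partial:
  assumes "has_dirichlet_series F a"
  shows "has_dirichlet_series (\<lambda>s. \<Sum>k<K. F s ^ k / fact k) (\<lambda>n. \<Sum>k<K. dpow a k n / fact k)"
proof (induction K)
  case 0
  thus ?case using has_series_const[of 0] by simp
next
  case (Suc K)
  show ?case
    using has_series_lincomb[OF Suc.IH has_series_power[OF assms, of K], of 1 "inverse (fact K)"]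
    by (simp add: divide_inverse mult.commute)
qed

lemma exp_remainder_bound:
  fixes z :: complex
  assumes "cmod z \<le> B"
  shows "cmod (exp z - (\<Sum>k<K. z ^ k / fact k)) \<le> exp B - (\<Sum>k<K. B ^ k / fact k)"
proof -
  have sz: "(\<lambda>k. z ^ k / fact k) sums exp z"
    using exp_converges[of z] by (simp add: scaleR_conv_of_real divide_inverse mult.commute)
  have sB: "(\<lambda>k. B ^ k / fact k) sums exp B"
    using exp_converges[of B] by (simp add: divide_inverse mult.commute)
  have tz: "(\<lambda>k. z ^ (k + K) / fact (k + K)) sums (exp z - (\<Sum>k<K. z ^ k / fact k))"
    by (rule sums_split_initial_segment[OF sz])
  have tB: "(\<lambda>k. B ^ (k + K) / fact (k + K)) sums (exp B - (\<Sum>k<K. B ^ k / fact k))"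
    by (rule sums_split_initial_segment[OF sB])
  have "cmod (\<Sum>k. z ^ (k + K) / fact (k + K)) \<le> (\<Sum>k. B ^ (k + K) / fact (k + K))"
    using assms by (intro norm_suminf_le sums_summable[OF tB]) (auto simp: norm_divide norm_power intro!: divide_right_mono power_mono)
  thus ?thesis using tz tB by (simp add: sums_iff)
qed

lemma exp_remainder_tendsto: "(\<lambda>K. exp B - (\<Sum>k<K. B ^ k / fact k)) \<longlonglongrightarrow> (0::real)"
proof -
  have "(\<lambda>k. B ^ k / fact k) sums exp B"
    using exp_converges[of B] by (simp add: divide_inverse mult.commute)
  from tendsto_diff[OF tendsto_const this[unfolded sums_def], of "exp B"] show ?thesis by simp
qed

text \<open>That a series exists follows from the shifts; the formula follows from the uniform convergence of the
exponential series on a smaller half-plane, as coefficients are continuous. It reduces all statements about exponentials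
to formal computations with coefficients.\<close>
theorem has_series_exp:
  assumes F: "has_dirichlet_series F a"
  shows "\<exists>c. has_dirichlet_series (\<lambda>s. exp (F s)) c \<and> (\<forall>n\<ge>1. (\<lambda>k. dpow a k n / fact k) sums c n)"
proof -
  have "\<exists>c. has_dirichlet_series (\<lambda>s. exp (F s)) c"
    by (rule dap_shifts_has_series) (rule dap_exp[OF mult_closed_UNIV has_series_dap_shift[OF F]])
  then obtain c where c: "has_dirichlet_series (\<lambda>s. exp (F s)) c" ..
  have "(\<lambda>k. dpow a k n / fact k) sums c n" if n: "n \<ge> 1" for n
  proof -
    define x where "x = (of_nat n powr (- of_real 1) :: complex)"
    have x: "x \<noteq> 0" using n by (simp add: x_def)
    obtain C where C: "C \<ge> 0" "\<And>F a B n. has_dirichlet_series F a \<Longrightarrow>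
      (\<And>s. Re s > 0 \<Longrightarrow> cmod (F s) \<le> B) \<Longrightarrow> n \<ge> 1 \<Longrightarrow> cmod (a n) \<le> C * real n powr 1 * B"
      using series_coeff_bound[of 1] by auto
    obtain B where B: "B > 0" "\<And>s. Re s > 0 \<Longrightarrow> cmod (F (s + of_real 1)) \<le> B"
      using dap_bound[OF has_series_dap_shift[OF F, of 1]] by auto
    have *: "cmod ((c n - (\<Sum>k<K. dpow a k n / fact k)) * x) \<le> C * real n * (exp B - (\<Sum>k<K. B ^ k / fact k))" for K
    proof -
      have "has_dirichlet_series (\<lambda>s. exp (F (s + of_real 1)) - (\<Sum>k<K. F (s + of_real 1) ^ k / fact k))
         (\<lambda>n. (c n - (\<Sum>k<K. dpow a k n / fact k)) * of_nat n powr (- of_real 1))"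
        using has_series_shift[OF has_series_diff[OF c has_series_exp_partial[OF F, of K]], of 1] by simp
      from C(2)[OF this exp_remainder_bound[OF B(2)] n] show ?thesis using n by (simp add: x_def)
    qed
    have "(\<lambda>K. C * real n * (exp B - (\<Sum>k<K. B ^ k / fact k))) \<longlonglongrightarrow> C * real n * 0"
      by (intro tendsto_intros exp_remainder_tendsto)
    hence "(\<lambda>K. C * real n * (exp B - (\<Sum>k<K. B ^ k / fact k))) \<longlonglongrightarrow> 0" by simp
    hence "(\<lambda>K. (c n - (\<Sum>k<K. dpow a k n / fact k)) * x) \<longlonglongrightarrow> 0"
      by (rule Lim_null_comparison[OF always_eventually, rotated]) (use * in auto)
    from tendsto_diff[OF tendsto_const tendsto_divide[OF this tendsto_const x], of "c n"] x
    show ?thesis by (simp add: sums_def)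
  qed
  with c show ?thesis by blast
qed

section \<open>Twisting by completely multiplicative functions\<close>

text \<open>The completely multiplicative function with prescribed values \<open>w p\<close> at the primes. Twisting coefficients by it covers
the dilations (constant \<open>w\<close>, also complex) and the comparison of a dilation with a shift.\<close>
definition charval :: "(nat \<Rightarrow> complex) \<Rightarrow> nat \<Rightarrow> complex" where
  "charval w n = (\<Prod>p\<in>#prime_factorization n. w p)"

lemma charval_1 [simp]: "charval w (Suc 0) = 1"
  by (simp add: charval_def)

lemma charval_mult: "m > 0 \<Longrightarrow> n > 0 \<Longrightarrow> charval w (m * n) = charval w m * charval w n"
  by (simp add: charval_def prime_factorization_mult)

lemma charval_const: "charval (\<lambda>_. z) n = z ^ size (prime_factorization n)"
  by (simp add: charval_def)

lemma charval_eqI: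
  assumes n: "n \<ge> 1" and one: "f 1 = (1 :: complex)"
    and mult: "\<And>m k. m > 0 \<Longrightarrow> k > 0 \<Longrightarrow> f (m * k) = f m * f k"
    and w: "\<And>p. prime p \<Longrightarrow> p dvd n \<Longrightarrow> f p = w p"
  shows "f n = charval w n"
  using n w
proof (induction n rule: less_induct)
  case (less n)
  show ?case
  proof (cases "n = 1")
    case False
    then obtain p k where p: "prime p" "n = p * k" using prime_factor_nat by blast
    hence k: "k > 0" "k < n" "k \<ge> 1" using less.prems(1) prime_gt_1_nat[OF p(1)] by (auto intro!: gr0I)
    have "f k = charval w k" by (rule less.IH) (use k p less.prems in auto)
    moreover have "f p = w p" using p less.prems by auto
    moreover have "charval w p = w p" using p(1) by (simp add: charval_def prime_factorization_prime)
    ultimately show ?thesis using p k prime_gt_0_nat[OF p(1)] by (simp add: mult charval_mult)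
  qed (use one in simp)
qed

lemma charval_npow: "n \<ge> 1 \<Longrightarrow> charval (\<lambda>p. of_nat p powr z) n = of_nat n powr z"
  by (rule charval_eqI[symmetric]) (auto simp: npow_mult simp del: of_nat_mult)

lemma tendsto_charval:
  assumes "\<And>p. prime p \<Longrightarrow> p dvd n \<Longrightarrow> ((\<lambda>k. v k p) \<longlongrightarrow> w p) A"
  shows "((\<lambda>k. charval (v k) n) \<longlongrightarrow> charval w n) A"
proof -
  have "((\<lambda>k. \<Prod>p\<in>#X. v k p) \<longlongrightarrow> (\<Prod>p\<in>#X. w p)) A" if "\<And>p. p \<in># X \<Longrightarrow> ((\<lambda>k. v k p) \<longlongrightarrow> w p) A" for X
    using that by (induction X) (auto intro!: tendsto_mult)
  thus ?thesis unfolding charval_def using assms by (auto dest: in_prime_factors_imp_prime in_prime_factors_imp_dvd)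
qed

lemma charval_update_holomorphic: "(\<lambda>z. charval (w(q := z)) n) holomorphic_on A"
proof -
  have "(\<lambda>z. \<Prod>p\<in>#X. (w(q := z)) p) holomorphic_on A" for X
  proof (induction X)
    case (add p X)
    have "(\<lambda>z. (w(q := z)) p) holomorphic_on A" by (cases "p = q") auto
    from holomorphic_on_mult[OF this add.IH] show ?case by simp
  qed simp
  thus ?thesis unfolding charval_def .
qed

text \<open>Unique factorisation: an integer relation between logarithms of primes is an equality of two products of
prime powers. The factor \<open>c\<close> allows for the normalisation in Kronecker's theorem.\<close>
lemma independent_ln_primes:
  assumes h: "bij_betw h {..<m::nat} Q" and Q: "\<And>p. p \<in> Q \<Longrightarrow> prime (p::nat)" and c: "c \<noteq> 0"
  defines "\<theta> \<equiv> (\<lambda>i. c * ln (real (h i)))"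
  shows "inj_on \<theta> {..<m}" and "module.independent (\<lambda>r. (*) (real_of_int r)) (\<theta> ` {..<m})"
proof -
  have hp: "prime (h i)" if "i < m" for i using h Q that by (auto simp: bij_betw_def)
  have h_inj: "inj_on h {..<m}" using h by (simp add: bij_betw_def)
  show inj: "inj_on \<theta> {..<m}"
  proof (rule inj_onI)
    fix i j assume ij: "i \<in> {..<m}" "j \<in> {..<m}" "\<theta> i = \<theta> j"
    hence "ln (real (h i)) = ln (real (h j))" using c by (simp add: \<theta>_def)
    hence "h i = h j" using hp[of i] hp[of j] ij prime_gt_0_nat by (simp add: ln_inj_iff)
    thus "i = j" using h_inj ij by (auto dest: inj_onD)
  qed
  interpret Modules.module "(\<lambda>r. (*) (real_of_int r))"
    by (simp add: Modules.module.intro distrib_left mult.commute)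
  show "independent (\<theta> ` {..<m})"
    unfolding independent_explicit_module
  proof (intro allI impI)
    fix T u v assume T: "finite T" "T \<subseteq> \<theta> ` {..<m}" "(\<Sum>v\<in>T. real_of_int (u v) * v) = 0" "v \<in> T"
    define I where "I = {i. i < m \<and> \<theta> i \<in> T}"
    have I: "finite I" "T = \<theta> ` I" "inj_on \<theta> I" using T(2) inj by (auto simp: I_def intro: inj_on_subset)
    define x where "x = (\<lambda>i. u (\<theta> i))"
    have "(\<Sum>i\<in>I. real_of_int (x i) * (c * ln (real (h i)))) = 0"
      using T(3) unfolding I(2) sum.reindex[OF I(3)] by (simp add: x_def \<theta>_def)
    hence "c * (\<Sum>i\<in>I. real_of_int (x i) * ln (real (h i))) = 0" by (simp add: sum_distrib_left mult_ac)
    hence 0: "(\<Sum>i\<in>I. real_of_int (x i) * ln (real (h i))) = 0" using c by simp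
    \<comment> \<open>move the negative exponents to the other side\<close>
    define e1 e2 where "e1 = (\<lambda>i. nat (x i))" and "e2 = (\<lambda>i. nat (- x i))"
    have x_eq: "real_of_int (x i) = real (e1 i) - real (e2 i)" for i by (simp add: e1_def e2_def)
    have pos: "real (h i) > 0" if "i \<in> I" for i using hp[of i] that prime_gt_0_nat by (simp add: I_def)
    have "(\<Sum>i\<in>I. real (e1 i) * ln (real (h i))) = (\<Sum>i\<in>I. real (e2 i) * ln (real (h i)))"
      using 0 unfolding x_eq left_diff_distrib sum_subtractf by simp
    hence "(\<Sum>i\<in>I. ln (real (h i) ^ e1 i)) = (\<Sum>i\<in>I. ln (real (h i) ^ e2 i))"
      using pos by (simp add: ln_realpow)
    hence "ln (\<Prod>i\<in>I. real (h i) ^ e1 i) = ln (\<Prod>i\<in>I. real (h i) ^ e2 i)"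
      using pos I(1) by (subst (1 2) ln_prod) auto
    hence "(\<Prod>i\<in>I. real (h i) ^ e1 i) = (\<Prod>i\<in>I. real (h i) ^ e2 i)"
      using pos by (subst (asm) ln_inj_iff) (auto intro!: prod_pos)
    hence "real (\<Prod>i\<in>I. h i ^ e1 i) = real (\<Prod>i\<in>I. h i ^ e2 i)" by simp
    hence eq: "(\<Prod>i\<in>I. h i ^ e1 i) = (\<Prod>i\<in>I. h i ^ e2 i)" by (simp only: of_nat_eq_iff)
    have mult: "multiplicity (h j) (\<Prod>i\<in>I. h i ^ e i) = e j" if j: "j \<in> I" for j e
    proof -
      have hI: "inj_on h I" using h_inj by (rule inj_on_subset) (auto simp: I_def)
      define g where "g = (\<lambda>p. e (the_inv_into I h p))"
      have g: "g (h i) = e i" if "i \<in> I" for i using that hI by (simp add: g_def the_inv_into_f_f)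
      have "(\<Prod>i\<in>I. h i ^ e i) = (\<Prod>p\<in>h ` I. p ^ g p)"
        unfolding prod.reindex[OF hI] by (intro prod.cong) (auto simp: g)
      moreover have "multiplicity (h j) (\<Prod>p\<in>h ` I. p ^ g p) = (if h j \<in> h ` I then g (h j) else 0)"
        using hp j I(1) by (intro multiplicity_prod_prime_powers) (auto simp: I_def)
      ultimately show ?thesis using j g by simp
    qed
    obtain j where j: "j \<in> I" "v = \<theta> j" using T(4) I(2) by auto
    have "e1 j = e2 j" using mult[OF j(1), of e1] mult[OF j(1), of e2] eq by simp
    hence "x j = 0" by (auto simp: e1_def e2_def)
    thus "u v = 0" by (simp add: x_def j)
  qed
qed

text \<open>Kronecker's theorem for the numbers \<open>- ln p / (2 * pi)\<close>: vertical shifts approximate arbitrary unimodular twists.\<close>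
lemma vertical_shift_approx:
  assumes w: "\<And>p. prime p \<Longrightarrow> p \<le> N \<Longrightarrow> cmod (w p) = 1" and e: "e > 0"
  shows "\<exists>t::real. \<forall>p. prime p \<longrightarrow> p \<le> N \<longrightarrow> cmod (of_nat p powr (- (\<i> * of_real t)) - w p) \<le> e"
proof -
  define Q where "Q = {p. prime p \<and> p \<le> N}"
  have "finite Q" by (simp add: Q_def)
  from ex_bij_betw_nat_finite[OF this] obtain h where h: "bij_betw h {..<card Q} Q"
    by (auto simp: atLeast0LessThan)
  define \<theta> where "\<theta> = (\<lambda>i. - (1 / (2 * pi)) * ln (real (h i)))"
  have ind: "inj_on \<theta> {..<card Q}" "module.independent (\<lambda>r. (*) (real_of_int r)) (\<theta> ` {..<card Q})"
    using independent_ln_primes[OF h, of "- (1 / (2 * pi))"] unfolding \<theta>_def by (auto simp: Q_def)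
  define close where "close = (\<lambda>t (k :: nat \<Rightarrow> int). \<forall>i<card Q.
     \<bar>t * \<theta> i - of_int (k i) - Arg (w (h i)) / (2 * pi)\<bar> < e / (2 * pi))"
  have "\<exists>t k. close t k"
  proof (rule Kronecker_thm_1[OF ind(2,1), of "e / (2 * pi)" "\<lambda>i. Arg (w (h i)) / (2 * pi)"])
    show "e / (2 * pi) > 0" using e by simp
  next
    fix t k assume *: "\<And>i. i < card Q \<Longrightarrow> \<bar>t * \<theta> i - of_int (k i) - Arg (w (h i)) / (2 * pi)\<bar> < e / (2 * pi)"
    have "close t k" unfolding close_def by (intro allI impI) (rule *)
    thus "\<exists>t k. close t k" by blast
  qed
  then obtain t k where "close t k" by blast
  note tk = this[unfolded close_def]
  have "cmod (of_nat p powr (- (\<i> * of_real t)) - w p) \<le> e" if p: "prime p" "p \<le> N" for p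
  proof -
    have "h ` {..<card Q} = Q" using h by (simp add: bij_betw_def)
    moreover have "p \<in> Q" using p by (simp add: Q_def)
    ultimately have "p \<in> h ` {..<card Q}" by simp
    then obtain i where i: "i < card Q" "h i = p" by (elim imageE) auto
    define y where "y = 2 * pi * (t * \<theta> i - of_int (k i) - Arg (w p) / (2 * pi))"
    have "\<bar>y\<bar> = 2 * pi * \<bar>t * \<theta> i - of_int (k i) - Arg (w p) / (2 * pi)\<bar>" by (simp add: y_def abs_mult)
    also have "\<dots> \<le> 2 * pi * (e / (2 * pi))" using tk[rule_format, OF i(1)] i by (intro mult_left_mono) auto
    finally have y: "\<bar>y\<bar> \<le> e" by simp
    have w_eq: "w p = exp (\<i> * of_real (Arg (w p)))"
      using w[OF p] Arg_eq[of "w p"] by (cases "w p = 0") auto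
    have "of_nat p powr (- (\<i> * of_real t)) = exp (\<i> * of_real (2 * pi * (t * \<theta> i)))"
      using prime_gt_0_nat[OF p(1)] by (simp add: powr_def \<theta>_def i(2) Ln_of_nat mult_ac)
    also have "2 * pi * (t * \<theta> i) = y + Arg (w p) + 2 * pi * of_int (k i)"
      by (simp add: y_def field_simps)
    also have "exp (\<i> * of_real \<dots>) = exp (\<i> * of_real y) * exp (\<i> * of_real (Arg (w p))) * exp (2 * of_int (k i) * of_real pi * \<i>)"
      by (simp add: exp_add[symmetric] algebra_simps)
    also have "exp (2 * of_int (k i) * of_real pi * \<i>) = 1"
      using exp_integer_2pi[of "of_int (k i)"] by (simp add: mult_ac)
    finally have "of_nat p powr (- (\<i> * of_real t)) - w p = (exp (\<i> * of_real y) - 1) * w p"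
      using w_eq by (simp add: algebra_simps)
    hence "cmod (of_nat p powr (- (\<i> * of_real t)) - w p) = cmod (exp (\<i> * of_real y) - 1)"
      using w[OF p] by (simp add: norm_mult)
    also have "\<dots> \<le> \<bar>y\<bar>" using dist_exp_i_1[of y] abs_sin_x_le_abs_x[of "y/2"] by simp
    finally show ?thesis using y by simp
  qed
  thus ?thesis by blast
qed

text \<open>A unimodular twist is a limit of vertical shifts.\<close>
lemma twist_unimodular:
  assumes w: "\<And>p. prime p \<Longrightarrow> p \<le> N \<Longrightarrow> cmod (w p) = 1"
    and B: "\<And>s. Re s > 0 \<Longrightarrow> cmod (dirichlet_partial a N s) \<le> B" and s: "Re s > 0"
  shows "cmod (dirichlet_partial (\<lambda>n. charval w n * a n) N s) \<le> B"
proof -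
  have "\<exists>t::real. \<forall>p. prime p \<longrightarrow> p \<le> N \<longrightarrow> cmod (of_nat p powr (- (\<i> * of_real t)) - w p) \<le> 1 / real (Suc k)" for k
    by (rule vertical_shift_approx[OF w]) auto
  then obtain t where t: "\<And>k p. prime p \<Longrightarrow> p \<le> N \<Longrightarrow> cmod (of_nat p powr (- (\<i> * of_real (t k))) - w p) \<le> 1 / real (Suc k)"
    by metis
  have lim_p: "(\<lambda>k. of_nat p powr (- (\<i> * of_real (t k)))) \<longlonglongrightarrow> w p" if "prime p" "p \<le> N" for p
  proof -
    have "(\<lambda>k. of_nat p powr (- (\<i> * of_real (t k))) - w p) \<longlonglongrightarrow> 0"
      by (rule Lim_null_comparison[OF always_eventually LIMSEQ_Suc[OF lim_1_over_n]]) (use t that in auto)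
    thus ?thesis by (simp add: LIM_zero_iff)
  qed
  have lim_n: "(\<lambda>k. of_nat n powr (- (\<i> * of_real (t k)))) \<longlonglongrightarrow> charval w n" if n: "1 \<le> n" "n \<le> N" for n
  proof -
    have "(\<lambda>k. charval (\<lambda>p. of_nat p powr (- (\<i> * of_real (t k)))) n) \<longlonglongrightarrow> charval w n"
    proof (rule tendsto_charval)
      fix p assume p: "prime p" "p dvd n"
      hence "p \<le> N" using n dvd_imp_le[of p n] by auto
      thus "(\<lambda>k. of_nat p powr (- (\<i> * of_real (t k)))) \<longlonglongrightarrow> w p" using p(1) by (intro lim_p)
    qed
    thus ?thesis using n by (simp add: charval_npow)
  qed
  have "(\<lambda>k. dirichlet_partial (\<lambda>n. a n * of_nat n powr (- (\<i> * of_real (t k)))) N s) \<longlonglongrightarrow> dirichlet_partial (\<lambda>n. a n * charval w n) N s"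
    unfolding dirichlet_partial_def by (intro tendsto_intros lim_n) auto
  hence "(\<lambda>k. cmod (dirichlet_partial a N (s + \<i> * of_real (t k)))) \<longlonglongrightarrow> cmod (dirichlet_partial (\<lambda>n. a n * charval w n) N s)"
    unfolding dirichlet_partial_shift by (rule tendsto_norm)
  hence "cmod (dirichlet_partial (\<lambda>n. a n * charval w n) N s) \<le> B"
    by (rule LIMSEQ_le_const2) (use B s in auto)
  thus ?thesis by (simp add: mult.commute)
qed

text \<open>In the value \<open>w q\<close> at a single prime the twisted polynomial is holomorphic, so by the maximum principle one prime after
the other may be moved from the unit circle into the disc.\<close>
theorem twist_poly_bound:
  assumes w: "\<And>p. prime p \<Longrightarrow> p \<le> N \<Longrightarrow> cmod (w p) \<le> 1"
    and B: "\<And>s. Re s > 0 \<Longrightarrow> cmod (dirichlet_partial a N s) \<le> B" and s: "Re s > 0"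
  shows "cmod (dirichlet_partial (\<lambda>n. charval w n * a n) N s) \<le> B"
proof -
  have "cmod (dirichlet_partial (\<lambda>n. charval w n * a n) N s) \<le> B"
    if "finite Q" "\<And>p. prime p \<Longrightarrow> p \<le> N \<Longrightarrow> cmod (w p) \<le> 1"
      "\<And>p. prime p \<Longrightarrow> p \<le> N \<Longrightarrow> p \<notin> Q \<Longrightarrow> cmod (w p) = 1" for Q w
    using that
  proof (induction Q arbitrary: w rule: finite_induct)
    case empty
    show ?case by (rule twist_unimodular[OF _ B s]) (use empty in auto)
  next
    case (insert q Q w)
    \<comment> \<open>the value at \<open>q\<close> becomes a complex variable\<close>
    define f where "f = (\<lambda>z. dirichlet_partial (\<lambda>n. charval (w(q := z)) n * a n) N s)"
    have hol: "f holomorphic_on A" for A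
      unfolding f_def dirichlet_partial_def
      by (intro holomorphic_intros charval_update_holomorphic)
    show ?case
    proof (cases "prime q \<and> q \<le> N")
      case True
      have "cmod (f (w q)) \<le> B"
      proof (rule maximum_modulus_frontier[of f "cball 0 1"])
        show "f holomorphic_on interior (cball 0 1)" by (rule hol)
        show "continuous_on (closure (cball 0 1)) f" by (rule holomorphic_on_imp_continuous_on[OF hol])
        show "w q \<in> cball 0 1" using insert.prems True by simp
        fix z :: complex assume "z \<in> frontier (cball 0 1)"
        hence z: "cmod z = 1" by simp
        show "cmod (f z) \<le> B" unfolding f_def
          by (rule insert.IH) (use insert.prems z in auto)
      qed auto
      thus ?thesis by (simp add: f_def)
    next
      case False
      show ?thesis by (rule insert.IH) (use insert.prems False in auto)
    qed
  qed
  from this[of "{..N}" w] w show ?thesis by simp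
qed

text \<open>Twisted partial sums are partial sums of the twisted series, so the contraction property carries the uniform
Cauchy condition over.\<close>
theorem twist_has_series:
  assumes F: "has_dirichlet_series F a" and w: "\<And>p. prime p \<Longrightarrow> cmod (w p) \<le> 1"
  shows "has_dirichlet_series (dirichlet_limit (\<lambda>n. charval w n * a n)) (\<lambda>n. charval w n * a n)"
  unfolding has_dirichlet_series_def
proof safe
  fix e :: real assume e: "e > 0"
  define b where "b = (\<lambda>n. charval w n * a n)"
  have "uniformly_Cauchy_on {s. Re s > e} (dirichlet_partial b)"
  proof (rule uniformly_Cauchy_onI)
    fix h :: real assume h: "h > 0"
    obtain N0 where N0: "\<And>N s. N \<ge> N0 \<Longrightarrow> Re s > 0 \<Longrightarrow> cmod (F (s + of_real e) - dirichlet_partial (\<lambda>n. a n * of_nat n powr (- of_real e)) N s) < h/3"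
      using has_series_approx[OF F e, of "h/3"] h by auto
    have "dist (dirichlet_partial b M s) (dirichlet_partial b N s) < h" if s: "Re s > e" and MN: "M \<ge> N0" "N \<ge> N0" for M N s
    proof -
      define K where "K = max M N"
      define c where "c = (\<lambda>n. (trunc M a n - trunc N a n) * of_nat n powr (- of_real e))"
      have c_eq: "dirichlet_partial c K z = dirichlet_partial (\<lambda>n. a n * of_nat n powr (- of_real e)) M z - dirichlet_partial (\<lambda>n. a n * of_nat n powr (- of_real e)) N z" for z
        unfolding c_def dirichlet_partial_shift[symmetric] dirichlet_partial_diff[symmetric]
        by (simp add: dirichlet_partial_trunc K_def)
      have c_le: "cmod (dirichlet_partial c K z) \<le> 2 * h/3" if z: "Re z > 0" for z
        using norm_triangle_ineq4[of "F (z + of_real e) - dirichlet_partial (\<lambda>n. a n * of_nat n powr (- of_real e)) N z"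
            "F (z + of_real e) - dirichlet_partial (\<lambda>n. a n * of_nat n powr (- of_real e)) M z"]
            N0[OF MN(1) z] N0[OF MN(2) z] by (simp add: c_eq)
      have "dirichlet_partial b M s - dirichlet_partial b N s = dirichlet_partial (\<lambda>n. trunc M b n - trunc N b n) K s"
        unfolding dirichlet_partial_diff[symmetric] by (simp add: dirichlet_partial_trunc K_def)
      also have "\<dots> = dirichlet_partial (\<lambda>n. trunc M b n - trunc N b n) K ((s - of_real e) + of_real e)" by simp
      also have "\<dots> = dirichlet_partial (\<lambda>n. charval w n * c n) K (s - of_real e)"
        unfolding dirichlet_partial_shift by (rule dirichlet_partial_cong) (auto simp: b_def c_def trunc_def)
      also have "cmod \<dots> \<le> 2 * h/3"
        by (rule twist_poly_bound) (use w c_le s in auto)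
      finally show ?thesis using h by (simp add: dist_norm)
    qed
    thus "\<exists>M. \<forall>x\<in>{s. e < Re s}. \<forall>m\<ge>M. \<forall>n\<ge>M. dist (dirichlet_partial b m x) (dirichlet_partial b n x) < h"
      by blast
  qed
  hence "uniform_limit {s. Re s > e} (dirichlet_partial b) (\<lambda>s. lim (\<lambda>N. dirichlet_partial b N s)) sequentially"
    using Cauchy_uniformly_convergent uniformly_convergent_uniform_limit_iff by blast
  also have "?this \<longleftrightarrow> uniform_limit {s. Re s > e} (dirichlet_partial b) (dirichlet_limit b) sequentially"
    using e by (intro uniform_limit_cong') (auto simp: dirichlet_limit_def right_halfplane_def)
  finally show "uniform_limit {s. e < Re s} (dirichlet_partial (\<lambda>n. charval w n * a n)) (dirichlet_limit (\<lambda>n. charval w n * a n)) sequentially"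
    unfolding b_def .
qed

text \<open>The partial sums converge uniformly on a slightly smaller half-plane, so the bound for polynomials applies there
with an arbitrarily small loss.\<close>
theorem twist_bound:
  assumes F: "has_dirichlet_series F a" and w: "\<And>p. prime p \<Longrightarrow> cmod (w p) \<le> 1"
    and G: "has_dirichlet_series G (\<lambda>n. charval w n * a n)"
    and B: "\<And>s. Re s > 0 \<Longrightarrow> cmod (F s) \<le> B" and s: "Re s > 0"
  shows "cmod (G s) \<le> B"
proof (rule field_le_epsilon)
  fix h :: real assume h: "h > 0"
  define t where "t = Re s / 2"
  have t: "t > 0" using s by (simp add: t_def)
  obtain N0 where N0: "\<And>N s. N \<ge> N0 \<Longrightarrow> Re s > 0 \<Longrightarrow> cmod (F (s + of_real t) - dirichlet_partial (\<lambda>n. a n * of_nat n powr (- of_real t)) N s) < h"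
    using has_series_approx[OF F t h] by auto
  define b where "b = (\<lambda>n. a n * of_nat n powr (- of_real t))"
  have bb: "cmod (dirichlet_partial b N z) \<le> B + h" if z: "Re z > 0" and N: "N \<ge> N0" for N z
    using N0[OF N z] B[of "z + of_real t"] z t norm_triangle_ineq4[of "F (z + of_real t)" "F (z + of_real t) - dirichlet_partial b N z"]
    by (simp add: b_def)
  have "cmod (dirichlet_partial (\<lambda>n. charval w n * a n) N s) \<le> B + h" if N: "N \<ge> N0" for N
  proof -
    have "dirichlet_partial (\<lambda>n. charval w n * a n) N s = dirichlet_partial (\<lambda>n. charval w n * a n) N ((s - of_real t) + of_real t)" by simp
    also have "\<dots> = dirichlet_partial (\<lambda>n. charval w n * b n) N (s - of_real t)"
      unfolding dirichlet_partial_shift by (simp add: b_def mult_ac)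
    also have "cmod \<dots> \<le> B + h"
      by (rule twist_poly_bound) (use w bb[OF _ N] s in \<open>auto simp: t_def\<close>)
    finally show ?thesis .
  qed
  thus "cmod (G s) \<le> B + h"
    using LIMSEQ_le_const2[OF tendsto_norm[OF has_series_tendsto[OF G s]]] by blast
qed

section \<open>Uniqueness of logarithms and permutations of the primes\<close>

lemma dpow_cong:
  assumes "n \<ge> 1" "\<And>d. d dvd n \<Longrightarrow> a d = b d"
  shows "dpow a k n = dpow b k n"
  using assms
proof (induction k arbitrary: n)
  case (Suc k)
  have "dpow a k d = dpow b k d" if "d dvd n" for d
    using that Suc.prems by (intro Suc.IH) (auto intro: dvd_trans gr0I simp: Suc_le_eq)
  thus ?case using Suc.prems by (auto intro!: dconv_cong)
qed auto

lemma dpow_1: "dpow a k (Suc 0) = a (Suc 0) ^ k"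
  by (induction k) (auto simp: dconv_def)

lemma dpow_mult_char:
  assumes one: "ch 1 = (1 :: complex)" and mult: "\<And>d e. d > 0 \<Longrightarrow> e > 0 \<Longrightarrow> ch (d * e) = ch d * ch e" and n: "n \<ge> 1"
  shows "dpow (\<lambda>n. a n * ch n) k n = dpow a k n * ch n"
  using n
proof (induction k arbitrary: n)
  case (Suc k)
  have "dconv (\<lambda>n. a n * ch n) (dpow (\<lambda>n. a n * ch n) k) n = dconv (\<lambda>n. a n * ch n) (\<lambda>n. dpow a k n * ch n) n"
    using Suc.prems by (intro dconv_cong Suc.IH) (auto intro: gr0I simp: Suc_le_eq)
  also have "\<dots> = dconv a (dpow a k) n * ch n"
  proof (rule dconv_mult_char)
    fix d e assume "d * e = n"
    hence "d > 0" "e > 0" using Suc.prems by (auto intro!: gr0I)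
    thus "ch d * ch e = ch n" using mult[of d e] \<open>d * e = n\<close> by simp
  qed (use Suc.prems in auto)
  finally show ?case by simp
qed (use one in auto)

text \<open>In \<open>dpow a k n\<close> the coefficient \<open>a n\<close> occurs linearly, with factor \<open>k * a 1 ^ (k-1)\<close>; everything else involves proper
divisors of \<open>n\<close>.\<close>
lemma dpow_leading_difference:
  assumes n: "n > 1" and eq: "\<And>d. d dvd n \<Longrightarrow> d \<noteq> n \<Longrightarrow> a d = b d"
  shows "dpow a k n - dpow b k n = of_nat k * a 1 ^ (k - 1) * (a n - b n)"
proof (induction k)
  case (Suc k)
  \<comment> \<open>the part of the convolution in which neither factor sits at \<open>n\<close>\<close>
  define R where "R = (\<lambda>x::nat \<Rightarrow> complex. \<Sum>d\<in>{d. d dvd n} - {1, n}. x d * dpow x k (n div d))"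
  have split: "dpow x (Suc k) n = x 1 * dpow x k n + x n * x 1 ^ k + R x" for x
  proof -
    have fin: "finite {d. d dvd n}" using n by simp
    have "(\<Sum>d | d dvd n. x d * dpow x k (n div d)) = x 1 * dpow x k (n div 1) + (\<Sum>d\<in>{d. d dvd n} - {1}. x d * dpow x k (n div d))"
      using fin by (intro sum.remove) auto
    also have "(\<Sum>d\<in>{d. d dvd n} - {1}. x d * dpow x k (n div d)) = x n * dpow x k (n div n) + (\<Sum>d\<in>{d. d dvd n} - {1} - {n}. x d * dpow x k (n div d))"
      using fin n by (intro sum.remove) auto
    also have "{d. d dvd n} - {1} - {n} = {d. d dvd n} - {1, n}" by auto
    finally have "(\<Sum>d | d dvd n. x d * dpow x k (n div d)) = x 1 * dpow x k (n div 1) + (x n * dpow x k (n div n) + R x)"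
      by (simp add: R_def)
    thus ?thesis using n by (simp add: dconv_def dpow_1)
  qed
  have "R a = R b" unfolding R_def
  proof (rule sum.cong)
    fix d assume d: "d \<in> {d. d dvd n} - {1, n}"
    then obtain m where m: "n = d * m" by auto
    have dm: "d > 0" "m > 0" "d \<noteq> 1" "m \<noteq> n" using n d m by (auto intro!: gr0I)
    have "dpow a k m = dpow b k m"
    proof (rule dpow_cong)
      fix e assume "e dvd m"
      moreover from this have "e \<noteq> n" using dm m dvd_imp_le[of e m] by auto
      ultimately show "a e = b e" using m by (intro eq) auto
    qed (use dm in auto)
    thus "a d * dpow a k (n div d) = b d * dpow b k (n div d)" using eq d m dm by auto
  qed auto
  moreover have "a 1 = b 1" using n by (intro eq) auto
  ultimately have "dpow a (Suc k) n - dpow b (Suc k) n = a 1 * (dpow a k n - dpow b k n) + (a n - b n) * a 1 ^ k"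
    unfolding split by (simp add: algebra_simps)
  also have "\<dots> = of_nat (Suc k) * a 1 ^ (Suc k - 1) * (a n - b n)"
    unfolding Suc.IH by (cases k) (auto simp: algebra_simps)
  finally show ?case .
qed simp

text \<open>By induction over divisors. If \<open>a\<close> and \<open>b\<close> agree at the proper divisors of \<open>n\<close>, the difference of the two exponential
series at \<open>n\<close> is \<open>exp (a 1) * (a n - b n)\<close>.\<close>
theorem exp_coefficients_inject:
  assumes a: "\<And>n. n \<ge> 1 \<Longrightarrow> (\<lambda>k. dpow a k n / fact k) sums c n"
    and b: "\<And>n. n \<ge> 1 \<Longrightarrow> (\<lambda>k. dpow b k n / fact k) sums c n"
    and 1: "a 1 = b 1" and n: "n \<ge> 1"
  shows "a n = b n"
  using n
proof (induction n rule: less_induct)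
  case (less n)
  show ?case
  proof (cases "n = 1")
    case False
    hence n1: "n > 1" using less.prems by simp
    have "a d = b d" if "d dvd n" "d \<noteq> n" for d
      using that n1 dvd_imp_le[of d n] by (intro less.IH) (auto intro!: gr0I simp: Suc_le_eq)
    note diff = dpow_leading_difference[OF n1 this]
    have "(\<lambda>k. dpow a k n / fact k - dpow b k n / fact k) sums (c n - c n)"
      by (intro sums_diff a b less.prems)
    hence "(\<lambda>k. of_nat k * a 1 ^ (k - 1) * (a n - b n) / fact k) sums 0"
      by (simp add: diff flip: diff_divide_distrib)
    moreover have "(\<lambda>k. of_nat k * a 1 ^ (k - 1) * (a n - b n) / fact k) sums (exp (a 1) * (a n - b n))"
    proof -
      have "(\<lambda>k. a 1 ^ k /\<^sub>R fact k * (a n - b n)) sums (exp (a 1) * (a n - b n))"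
        by (intro sums_mult2 exp_converges)
      moreover have "a 1 ^ k /\<^sub>R fact k * (a n - b n) = of_nat (Suc k) * a 1 ^ (Suc k - 1) * (a n - b n) / fact (Suc k)" for k
        by (simp add: scaleR_conv_of_real divide_simps del: of_nat_Suc)
      ultimately have "(\<lambda>k. of_nat (Suc k) * a 1 ^ (Suc k - 1) * (a n - b n) / fact (Suc k)) sums (exp (a 1) * (a n - b n))"
        by simp
      from sums_Suc[OF this] show ?thesis by simp
    qed
    ultimately have "exp (a 1) * (a n - b n) = 0" by (rule sums_unique2[symmetric])
    thus ?thesis by simp
  qed (use 1 in simp)
qed

lemma bij_nth_prime: "bij_betw nth_prime {1..} {p. prime p}"
proof -
  have "bij_betw (enumerate {p::nat. prime p}) UNIV {p. prime p}"
    by (rule bij_enumerate[OF primes_infinite])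
  moreover have "bij_betw (\<lambda>i. i - 1) {1..} (UNIV :: nat set)"
    by (rule bij_betwI[of _ _ _ Suc]) auto
  ultimately show ?thesis
    using bij_betw_trans[of "\<lambda>i. i - 1" "{1..}" UNIV "enumerate {p. prime p}" "{p. prime p}"]
    by (simp add: nth_prime_def[abs_def] o_def)
qed

text \<open>The action of \<open>\<sigma>\<close> on the primes themselves rather than on their indices.\<close>
definition prime_perm :: "(nat \<Rightarrow> nat) \<Rightarrow> nat \<Rightarrow> nat" where
  "prime_perm \<sigma> p = nth_prime (\<sigma> (the_inv_into {1..} nth_prime p))"

lemma bij_prime_perm:
  assumes "bij_betw \<sigma> {1..} {1..}" shows "bij_betw (prime_perm \<sigma>) {p. prime p} {p. prime p}"
proof -
  have "bij_betw (nth_prime \<circ> (\<sigma> \<circ> the_inv_into {1..} nth_prime)) {p. prime p} {p. prime p}"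
    by (rule bij_betw_trans[OF bij_betw_trans[OF bij_betw_the_inv_into[OF bij_nth_prime] assms] bij_nth_prime])
  thus ?thesis by (simp add: prime_perm_def[abs_def] o_def)
qed

lemma prime_prime_perm: "bij_betw \<sigma> {1..} {1..} \<Longrightarrow> prime p \<Longrightarrow> prime (prime_perm \<sigma> p)"
  using bij_betwE[OF bij_prime_perm[of \<sigma>]] by simp

lemma perm_hat_eq:
  assumes "n \<ge> 1"
  shows "perm_hat \<sigma> n = (\<Prod>p\<in>#prime_factorization n. prime_perm \<sigma> p)"
proof -
  have inj: "inj_on nth_prime {1..}" and im: "nth_prime ` {1..} = {p. prime p}"
    using bij_nth_prime by (auto simp: bij_betw_def)
  have "(\<Prod>p\<in>#prime_factorization n. prime_perm \<sigma> p) = (\<Prod>p\<in>prime_factors n. prime_perm \<sigma> p ^ multiplicity p n)"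
    unfolding image_prod_mset_multiplicity
    by (intro prod.cong) (auto simp: count_prime_factorization_prime in_prime_factors_imp_prime)
  also have "prime_factors n = nth_prime ` {i. i \<ge> 1 \<and> nth_prime i dvd n}"
  proof (intro equalityI subsetI)
    fix p assume "p \<in> prime_factors n"
    hence p: "prime p" "p dvd n" by (auto simp: in_prime_factors_imp_prime in_prime_factors_imp_dvd)
    hence "p \<in> nth_prime ` {1..}" using im by simp
    thus "p \<in> nth_prime ` {i. i \<ge> 1 \<and> nth_prime i dvd n}" using p by auto
  next
    fix p assume "p \<in> nth_prime ` {i. i \<ge> 1 \<and> nth_prime i dvd n}"
    then obtain i where "i \<ge> 1" "p = nth_prime i" "p dvd n" by auto
    moreover from this have "prime p" using im by blast
    ultimately show "p \<in> prime_factors n" using assms by (simp add: prime_factors_dvd)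
  qed
  also have "(\<Prod>p\<in>\<dots>. prime_perm \<sigma> p ^ multiplicity p n) = perm_hat \<sigma> n"
    unfolding perm_hat_def
  proof (subst prod.reindex)
    show "inj_on nth_prime {i. i \<ge> 1 \<and> nth_prime i dvd n}" using inj by (rule inj_on_subset) auto
    have "the_inv_into {Suc 0..} nth_prime (nth_prime i) = i" if "i \<ge> Suc 0" for i
      using the_inv_into_f_f[OF inj, of i] that by simp
    thus "(\<Prod>i | i \<ge> 1 \<and> nth_prime i dvd n. ((\<lambda>p. prime_perm \<sigma> p ^ multiplicity p n) \<circ> nth_prime) i)
        = (\<Prod>i | i \<ge> 1 \<and> nth_prime i dvd n. nth_prime (\<sigma> i) ^ multiplicity (nth_prime i) n)"
      by (auto simp: prime_perm_def intro!: prod.cong)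
  qed
  finally show ?thesis ..
qed

lemma prime_factorization_perm_hat:
  assumes "bij_betw \<sigma> {1..} {1..}" "n \<ge> 1"
  shows "prime_factorization (perm_hat \<sigma> n) = image_mset (prime_perm \<sigma>) (prime_factorization n)"
  unfolding perm_hat_eq[OF assms(2)]
  by (intro prime_factorization_prod_mset_primes) (auto intro: prime_prime_perm[OF assms(1)] in_prime_factors_imp_prime)

lemma prime_factorization_inject:
  fixes m n :: nat
  assumes "m \<ge> 1" "n \<ge> 1" "prime_factorization m = prime_factorization n"
  shows "m = n"
proof -
  have "m = prod_mset (prime_factorization m)"
    by (rule prod_mset_prime_factorization_nat[symmetric]) (use assms(1) in simp)
  also have "\<dots> = prod_mset (prime_factorization n)" by (simp only: assms(3))
  also have "\<dots> = n"
    by (rule prod_mset_prime_factorization_nat) (use assms(2) in simp)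
  finally show ?thesis .
qed

lemma perm_hat_props:
  assumes \<sigma>: "bij_betw \<sigma> {1..} {1..}"
  shows "perm_hat \<sigma> 1 = 1"
    and "m \<ge> 1 \<Longrightarrow> n \<ge> 1 \<Longrightarrow> perm_hat \<sigma> (m * n) = perm_hat \<sigma> m * perm_hat \<sigma> n"
    and "bij_betw (perm_hat \<sigma>) {1..} {1..}"
    and "n \<ge> 1 \<Longrightarrow> size (prime_factorization (perm_hat \<sigma> n)) = size (prime_factorization n)"
proof -
  note bij = bij_prime_perm[OF \<sigma>]
  show "perm_hat \<sigma> 1 = 1" by (simp add: perm_hat_eq)
  show "perm_hat \<sigma> (m * n) = perm_hat \<sigma> m * perm_hat \<sigma> n" if "m \<ge> 1" "n \<ge> 1"
    using that perm_hat_eq[of "m * n" \<sigma>] by (simp add: perm_hat_eq prime_factorization_mult)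
  show "size (prime_factorization (perm_hat \<sigma> n)) = size (prime_factorization n)" if "n \<ge> 1"
    using prime_factorization_perm_hat[OF \<sigma> that] by simp
  have pos: "perm_hat \<sigma> n \<ge> 1" if "n \<ge> 1" for n
  proof -
    have "0 \<notin># image_mset (prime_perm \<sigma>) (prime_factorization n)"
    proof
      assume "0 \<in># image_mset (prime_perm \<sigma>) (prime_factorization n)"
      then obtain p where p: "p \<in># prime_factorization n" "prime_perm \<sigma> p = 0" by auto
      from prime_prime_perm[OF \<sigma> in_prime_factors_imp_prime[OF p(1)]] p(2) show False by simp
    qed
    hence "perm_hat \<sigma> n \<noteq> 0" unfolding perm_hat_eq[OF that] by (simp add: prod_mset_zero_iff)
    thus ?thesis by simp
  qed
  show "bij_betw (perm_hat \<sigma>) {1..} {1..}"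
  proof (rule bij_betwI')
    fix m n :: nat assume mn: "m \<in> {1..}" "n \<in> {1..}"
    show "perm_hat \<sigma> m = perm_hat \<sigma> n \<longleftrightarrow> m = n"
    proof
      assume "perm_hat \<sigma> m = perm_hat \<sigma> n"
      hence "prime_factorization (perm_hat \<sigma> m) = prime_factorization (perm_hat \<sigma> n)" by (rule arg_cong)
      hence eq: "image_mset (prime_perm \<sigma>) (prime_factorization m) = image_mset (prime_perm \<sigma>) (prime_factorization n)"
        using mn by (subst (asm) (1 2) prime_factorization_perm_hat[OF \<sigma>]) auto
      define g where "g = the_inv_into {p. prime p} (prime_perm \<sigma>)"
      have g: "image_mset g (image_mset (prime_perm \<sigma>) (prime_factorization k)) = prime_factorization k" for k
      proof -
        have "image_mset (\<lambda>p. g (prime_perm \<sigma> p)) (prime_factorization k) = image_mset (\<lambda>p. p) (prime_factorization k)"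
          using bij by (intro image_mset_cong) (auto simp: g_def bij_betw_def the_inv_into_f_f dest: in_prime_factors_imp_prime)
        thus ?thesis by (simp add: image_mset.compositionality o_def)
      qed
      have "prime_factorization m = prime_factorization n" using arg_cong[OF eq, of "image_mset g"] by (simp only: g)
      with mn show "m = n" by (intro prime_factorization_inject) auto
    qed simp
  next
    fix n :: nat assume "n \<in> {1..}"
    thus "perm_hat \<sigma> n \<in> {1..}" using pos by simp
  next
    fix n :: nat assume n: "n \<in> {1..}"
    define g where "g = the_inv_into {p. prime p} (prime_perm \<sigma>)"
    have g: "prime (g p)" "prime_perm \<sigma> (g p) = p" if "prime p" for p
    proof -
      show "prime (g p)" using bij_betwE[OF bij_betw_the_inv_into[OF bij]] that by (simp add: g_def)
      show "prime_perm \<sigma> (g p) = p" unfolding g_def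
        by (rule f_the_inv_into_f_bij_betw[OF bij]) (use that in auto)
    qed
    define m where "m = (\<Prod>p\<in>#prime_factorization n. g p)"
    have pm: "prime_factorization m = image_mset g (prime_factorization n)"
      unfolding m_def using g by (intro prime_factorization_prod_mset_primes) (auto dest: in_prime_factors_imp_prime)
    have "0 \<notin># image_mset g (prime_factorization n)"
    proof
      assume "0 \<in># image_mset g (prime_factorization n)"
      then obtain p where p: "p \<in># prime_factorization n" "g p = 0" by auto
      from g(1)[OF in_prime_factors_imp_prime[OF p(1)]] p(2) show False by simp
    qed
    hence "m \<noteq> 0" unfolding m_def by (simp add: prod_mset_zero_iff)
    hence m: "m \<ge> 1" by simp
    have "prime_factorization (perm_hat \<sigma> m) = image_mset (\<lambda>p. prime_perm \<sigma> (g p)) (prime_factorization n)"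
      unfolding prime_factorization_perm_hat[OF \<sigma> m] pm by (simp add: image_mset.compositionality o_def)
    also have "\<dots> = image_mset (\<lambda>p. p) (prime_factorization n)"
      using g by (intro image_mset_cong) (auto dest: in_prime_factors_imp_prime)
    finally have "prime_factorization (perm_hat \<sigma> m) = prime_factorization n" by simp
    hence "perm_hat \<sigma> m = n"
      by (rule prime_factorization_inject[rotated 2]) (use pos[OF m] n in auto)
    thus "\<exists>m\<in>{1..}. n = perm_hat \<sigma> m" using m by auto
  qed
qed

text \<open>A multiplicative bijection maps the divisors of \<open>n\<close> onto the divisors of \<open>\<pi> n\<close>.\<close>
lemma dconv_perm:
  assumes bij: "bij_betw \<pi> {1..} {1..}" and mult: "\<And>m n. m \<ge> 1 \<Longrightarrow> n \<ge> 1 \<Longrightarrow> \<pi> (m * n) = \<pi> m * \<pi> n" and n: "n \<ge> 1"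
  shows "dconv (\<lambda>n. a (\<pi> n)) (\<lambda>n. b (\<pi> n)) n = dconv a b (\<pi> n)"
proof -
  have pos: "\<pi> m \<ge> 1" if "m \<ge> 1" for m using bij that by (auto simp: bij_betw_def)
  have inj: "x = y" if "\<pi> x = \<pi> y" "x \<ge> 1" "y \<ge> 1" for x y
    using bij that by (auto simp: bij_betw_def dest: inj_onD)
  have bij': "bij_betw \<pi> {d. d dvd n} {d. d dvd \<pi> n}"
  proof (rule bij_betwI')
    fix x y assume "x \<in> {d. d dvd n}" "y \<in> {d. d dvd n}"
    hence "x \<ge> 1" "y \<ge> 1" using n by (auto intro!: gr0I simp: Suc_le_eq)
    thus "\<pi> x = \<pi> y \<longleftrightarrow> x = y" using inj by auto
  next
    fix x assume "x \<in> {d. d dvd n}"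
    then obtain k where k: "n = x * k" by auto
    hence "x \<ge> 1" "k \<ge> 1" using n by (auto intro!: gr0I simp: Suc_le_eq)
    thus "\<pi> x \<in> {d. d dvd \<pi> n}" using mult k by auto
  next
    fix y assume "y \<in> {d. d dvd \<pi> n}"
    then obtain k where k: "\<pi> n = y * k" by auto
    hence yk: "y \<ge> 1" "k \<ge> 1" using pos[OF n] by (auto intro!: gr0I simp: Suc_le_eq)
    have "y \<in> \<pi> ` {1..}" "k \<in> \<pi> ` {1..}" using yk bij by (auto simp: bij_betw_def)
    then obtain x z where x: "x \<ge> 1" "y = \<pi> x" "z \<ge> 1" "k = \<pi> z" by auto
    have "\<pi> n = \<pi> (x * z)" using k x mult[of x z] by simp
    moreover have "x * z \<ge> 1" using x by simp
    ultimately have "n = x * z" using inj n by blast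
    thus "\<exists>x\<in>{d. d dvd n}. y = \<pi> x" using x(2) by (intro bexI[of _ x]) auto
  qed
  have "dconv (\<lambda>n. a (\<pi> n)) (\<lambda>n. b (\<pi> n)) n = (\<Sum>d | d dvd n. a (\<pi> d) * b (\<pi> n div \<pi> d))"
    unfolding dconv_def
  proof (rule sum.cong)
    fix d assume "d \<in> {d. d dvd n}"
    then obtain k where k: "n = d * k" by auto
    hence dk: "d \<ge> 1" "k \<ge> 1" using n by (auto intro!: gr0I simp: Suc_le_eq)
    have "\<pi> n div \<pi> d = \<pi> k" using mult[OF dk] k pos[OF dk(1)] by simp
    moreover have "n div d = k" using k dk by simp
    ultimately show "a (\<pi> d) * b (\<pi> (n div d)) = a (\<pi> d) * b (\<pi> n div \<pi> d)" by simp
  qed simp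
  also have "\<dots> = dconv a b (\<pi> n)"
    unfolding dconv_def by (rule sum.reindex_bij_betw[OF bij'])
  finally show ?thesis .
qed

lemma dpow_perm:
  assumes bij: "bij_betw \<pi> {1..} {1..}" and mult: "\<And>m n. m \<ge> 1 \<Longrightarrow> n \<ge> 1 \<Longrightarrow> \<pi> (m * n) = \<pi> m * \<pi> n"
    and one: "\<pi> 1 = 1" and n: "n \<ge> 1"
  shows "dpow (\<lambda>n. a (\<pi> n)) k n = dpow a k (\<pi> n)"
  using n
proof (induction k arbitrary: n)
  case 0
  have "\<pi> n = 1 \<longleftrightarrow> n = 1"
    using bij one 0 inj_onD[of \<pi> "{1..}" n 1] by (auto simp: bij_betw_def)
  thus ?case by simp
next
  case (Suc k)
  have "dconv (\<lambda>n. a (\<pi> n)) (dpow (\<lambda>n. a (\<pi> n)) k) n = dconv (\<lambda>n. a (\<pi> n)) (\<lambda>n. dpow a k (\<pi> n)) n"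
    using Suc.prems by (intro dconv_cong Suc.IH) (auto intro!: gr0I simp: Suc_le_eq)
  also have "\<dots> = dconv a (dpow a k) (\<pi> n)" by (rule dconv_perm[OF bij mult Suc.prems])
  finally show ?case by simp
qed

section \<open>The algebras in terms of approximation\<close>

lemma mem_right_halfplane [simp]: "s \<in> right_halfplane \<longleftrightarrow> Re s > 0"
  by (simp add: right_halfplane_def)

abbreviation onH :: "(complex \<Rightarrow> complex) \<Rightarrow> complex \<Rightarrow> complex" where
  "onH F \<equiv> restrict F right_halfplane"

lemma has_series_onH: "has_dirichlet_series (onH F) a \<longleftrightarrow> has_dirichlet_series F a"
  by (rule has_series_cong) auto

lemma dap_onH: "dap S (onH F) \<longleftrightarrow> dap S F"
  by (rule dap_cong) auto

lemma wap_onH: "wap S M (onH F) \<longleftrightarrow> wap S M F"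
  by (rule wap_cong) auto

lemma extensional_eqI:
  "f \<in> extensional right_halfplane \<Longrightarrow> g \<in> extensional right_halfplane \<Longrightarrow>
    (\<And>s. Re s > 0 \<Longrightarrow> f s = g s) \<Longrightarrow> f = g"
  by (rule extensionalityI) auto

lemma OuD:
  assumes "f \<in> Ou"
  shows "f \<in> extensional right_halfplane" "has_dirichlet_series f (dirichlet_coeff f)"
  using assms has_series_dirichlet_coeff(1) by (auto simp: Ou_def)

lemma OuI:
  assumes "f \<in> extensional right_halfplane" "has_dirichlet_series f a" shows "f \<in> Ou"
  unfolding Ou_def using assms has_series_holomorphic by blast

lemma Ou_onH: "has_dirichlet_series F a \<Longrightarrow> onH F \<in> Ou"
  by (rule OuI) (auto simp: has_series_onH)

lemma bounded_right_halfplane_iff: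
  "bounded (f ` right_halfplane) \<longleftrightarrow> (\<exists>B. \<forall>s. Re s > 0 \<longrightarrow> cmod (f s) \<le> B)"
  unfolding bounded_iff right_halfplane_def by simp

lemma right_halfplane_nonempty: "right_halfplane \<noteq> {}"
proof -
  have "1 \<in> right_halfplane" by simp
  thus ?thesis by blast
qed

lemma sup_norm_le: "(\<And>s. Re s > 0 \<Longrightarrow> cmod (f s) \<le> B) \<Longrightarrow> sup_norm f \<le> B"
  unfolding sup_norm_def by (rule cSUP_least[OF right_halfplane_nonempty]) auto

lemma le_sup_norm:
  assumes "\<And>s. Re s > 0 \<Longrightarrow> cmod (f s) \<le> B" "Re s > 0" shows "cmod (f s) \<le> sup_norm f"
  unfolding sup_norm_def by (rule cSUP_upper) (use assms in \<open>auto intro!: bdd_aboveI2[of _ _ B]\<close>)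

lemma sup_norm_nonneg:
  assumes "\<And>s. Re s > 0 \<Longrightarrow> cmod (f s) \<le> B" shows "sup_norm f \<ge> 0"
  using order_trans[OF norm_ge_zero le_sup_norm[of f B 1]] assms by simp

lemma INF_pos_iff:
  "(INF s\<in>right_halfplane. cmod (f s)) > 0 \<longleftrightarrow> (\<exists>\<delta>>0. \<forall>s. Re s > 0 \<longrightarrow> cmod (f s) \<ge> \<delta>)"
proof
  assume pos: "(INF s\<in>right_halfplane. cmod (f s)) > 0"
  have "(INF s\<in>right_halfplane. cmod (f s)) \<le> cmod (f s)" if "Re s > 0" for s
    by (rule cINF_lower) (use that in \<open>auto intro!: bdd_belowI2[of _ 0]\<close>)
  with pos show "\<exists>\<delta>>0. \<forall>s. Re s > 0 \<longrightarrow> cmod (f s) \<ge> \<delta>" by blast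
next
  assume "\<exists>\<delta>>0. \<forall>s. Re s > 0 \<longrightarrow> cmod (f s) \<ge> \<delta>"
  then obtain \<delta> where \<delta>: "\<delta> > 0" "\<And>s. Re s > 0 \<Longrightarrow> cmod (f s) \<ge> \<delta>" by blast
  have "\<delta> \<le> (INF s\<in>right_halfplane. cmod (f s))"
    by (rule cINF_greatest[OF right_halfplane_nonempty]) (use \<delta> in auto)
  with \<delta>(1) show "(INF s\<in>right_halfplane. cmod (f s)) > 0" by simp
qed

lemma Hinf_iff: "f \<in> Hinf \<longleftrightarrow> f \<in> Ou \<and> (\<exists>B. \<forall>s. Re s > 0 \<longrightarrow> cmod (f s) \<le> B)"
  by (simp add: Hinf_def bounded_right_halfplane_iff)

text \<open>The two descriptions of the Wiener algebra agree: one direction truncates the series, the other is Bohr's theorem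
with the bound on the coefficient sums.\<close>
lemma Wie_iff: "f \<in> Wie \<longleftrightarrow> f \<in> extensional right_halfplane \<and> (\<exists>M. wap UNIV M f)"
proof
  assume "f \<in> Wie"
  then obtain a where a: "f = dirichlet_limit a" "summable (\<lambda>n. cmod (a n))" by (auto simp: Wie_def)
  have part: "(\<Sum>n=1..N. g n) = (\<Sum>n<Suc N. g n) - g 0" for g :: "nat \<Rightarrow> 'x::ab_group_add" and N
    by (simp add: lessThan_Suc_atMost atMost_atLeast0 sum.atLeast_Suc_atMost[of 0])
  have "wap UNIV (\<Sum>n. cmod (a n)) f"
  proof (rule wapI_series)
    fix s :: complex assume s: "Re s > 0"
    have "summable (\<lambda>n. if n = 0 then 0 else a n * of_nat n powr (-s))"
      by (rule summable_comparison_test'[OF a(2), of 1])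
         (use s in \<open>auto simp: norm_mult intro!: mult_left_le norm_npow_le_1\<close>)
    hence "convergent (\<lambda>N. \<Sum>n<N. if n = 0 then 0 else a n * of_nat n powr (-s))"
      by (simp add: summable_iff_convergent)
    hence "convergent (\<lambda>N. \<Sum>n<Suc N. if n = 0 then 0 else a n * of_nat n powr (-s))"
      by (subst convergent_Suc_iff)
    also have "(\<lambda>N. \<Sum>n<Suc N. if n = 0 then 0 else a n * of_nat n powr (-s)) = (\<lambda>N. dirichlet_partial a N s)"
    proof
      fix N
      show "(\<Sum>n<Suc N. if n = 0 then 0 else a n * of_nat n powr (-s)) = dirichlet_partial a N s"
        using part[of "\<lambda>n. if n = 0 then 0 else a n * of_nat n powr (-s)" N] by (simp add: dirichlet_partial_def)
    qed
    finally show "(\<lambda>N. dirichlet_partial a N s) \<longlonglongrightarrow> f s"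
      using s by (simp add: a(1) dirichlet_limit_def convergent_LIMSEQ_iff)
  next
    fix N
    show "(\<Sum>n=1..N. cmod (a n)) \<le> (\<Sum>n. cmod (a n))" by (rule sum_le_suminf[OF a(2)]) auto
  qed auto
  thus "f \<in> extensional right_halfplane \<and> (\<exists>M. wap UNIV M f)"
    by (auto simp: a(1) dirichlet_limit_def)
next
  assume f: "f \<in> extensional right_halfplane \<and> (\<exists>M. wap UNIV M f)"
  then obtain M where "wap UNIV M f" by blast
  then obtain a where a: "has_dirichlet_series f a" "\<And>K. (\<Sum>n=1..K. cmod (a n)) \<le> M"
    using wap_has_series by blast
  define b where "b = a(0 := 0)"
  have "summable (\<lambda>n. cmod (b n))"
  proof (rule summableI_nonneg_bounded)
    show "(\<Sum>n<K. cmod (b n)) \<le> M" for K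
    proof -
      have "(\<Sum>n<K. cmod (b n)) \<le> (\<Sum>n=0..K. cmod (b n))" by (rule sum_mono2) auto
      also have "\<dots> = (\<Sum>n=1..K. cmod (a n))"
        by (rule sum.mono_neutral_cong_right) (auto simp: b_def Suc_le_eq)
      finally show ?thesis using a(2)[of K] by simp
    qed
  qed auto
  moreover have "f = dirichlet_limit b"
  proof (rule extensional_eqI)
    show "f \<in> extensional right_halfplane" using f by blast
    show "dirichlet_limit b \<in> extensional right_halfplane" by (auto simp: dirichlet_limit_def)
    fix s :: complex assume s: "Re s > 0"
    have "(\<lambda>N. dirichlet_partial b N s) \<longlonglongrightarrow> f s"
      using has_series_tendsto[OF a(1) s] dirichlet_partial_cong[of _ b a] by (simp add: b_def)
    thus "f s = dirichlet_limit b s" using s by (simp add: dirichlet_limit_def limI)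
  qed
  ultimately show "f \<in> Wie" unfolding Wie_def by blast
qed

lemma dap_imp_Ou: "f \<in> extensional right_halfplane \<Longrightarrow> dap S f \<Longrightarrow> f \<in> Ou"
  using dap_has_series OuI by blast

text \<open>Here Bohr's theorem is essential: it shows that a uniform limit of Dirichlet polynomials has a uniformly convergent
Dirichlet series on smaller half-planes, hence lies in \<^const>\<open>Hinf\<close>.\<close>
lemma Adir_iff: "f \<in> Adir \<longleftrightarrow> f \<in> extensional right_halfplane \<and> dap UNIV f"
proof
  assume f: "f \<in> Adir"
  hence "f \<in> Hinf" by (simp add: Adir_def)
  then obtain B where B: "\<And>s. Re s > 0 \<Longrightarrow> cmod (f s) \<le> B" and ext: "f \<in> extensional right_halfplane"
    using OuD by (auto simp: Hinf_iff)
  have "dap UNIV f"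
  proof (rule dap_limit)
    fix e :: real assume "e > 0"
    then obtain g where g: "g \<in> Wie" "sup_norm (\<lambda>s\<in>right_halfplane. f s - g s) < e"
      using f by (auto simp: Adir_def)
    then obtain M where M: "wap UNIV M g" by (auto simp: Wie_iff)
    have "cmod (f s - g s) \<le> e" if s: "Re s > 0" for s
    proof -
      have "cmod (onH (\<lambda>s. f s - g s) s) \<le> sup_norm (onH (\<lambda>s. f s - g s))"
        by (rule le_sup_norm[of _ "B + M"])
           (use B wap_bound[OF M] s in \<open>auto intro!: norm_triangle_le_diff add_mono\<close>)
      thus ?thesis using g(2) s by simp
    qed
    thus "\<exists>G. dap UNIV G \<and> (\<forall>s. Re s > 0 \<longrightarrow> cmod (f s - G s) \<le> e)"
      using wap_imp_dap[OF M] by blast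
  qed
  with ext show "f \<in> extensional right_halfplane \<and> dap UNIV f" by blast
next
  assume f: "f \<in> extensional right_halfplane \<and> dap UNIV f"
  hence "f \<in> Hinf" using dap_imp_Ou dap_bound[of UNIV f] unfolding Hinf_iff by meson
  moreover have "\<exists>g\<in>Wie. sup_norm (\<lambda>s\<in>right_halfplane. f s - g s) < e" if e: "e > 0" for e
  proof -
    have "\<exists>M. near UNIV M (e/2) f" using f e unfolding dap_def by simp
    then obtain a N where a: "\<And>s. Re s > 0 \<Longrightarrow> cmod (f s - dirichlet_partial a N s) \<le> e/2"
      unfolding near_def by blast
    have "wap UNIV (\<Sum>n=1..N. cmod (a n)) (dirichlet_partial a N)"
      unfolding wap_def by (intro allI impI near_poly) auto
    hence "onH (dirichlet_partial a N) \<in> Wie" unfolding Wie_iff by (auto simp: wap_onH)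
    moreover have "sup_norm (\<lambda>s\<in>right_halfplane. f s - onH (dirichlet_partial a N) s) \<le> e/2"
      by (rule sup_norm_le) (use a in auto)
    ultimately show ?thesis using e by (intro bexI[of _ "onH (dirichlet_partial a N)"]) auto
  qed
  ultimately show "f \<in> Adir" by (simp add: Adir_def)
qed

lemma Hinf_imp_Ou: "f \<in> Hinf \<Longrightarrow> f \<in> Ou" by (simp add: Hinf_def)
lemma Ob_imp_Ou: "f \<in> Ob \<Longrightarrow> f \<in> Ou" by (simp add: Ob_def)
lemma Adir_imp_Ou: "f \<in> Adir \<Longrightarrow> f \<in> Ou" by (simp add: Adir_def Hinf_def)
lemma Wie_imp_Ou: "f \<in> Wie \<Longrightarrow> f \<in> Ou" unfolding Wie_iff using wap_imp_dap dap_imp_Ou by blast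

lemma wap_l1_norm:
  assumes "wap UNIV M f"
  shows "l1_norm f \<le> M" and "n \<ge> 1 \<Longrightarrow> cmod (dirichlet_coeff f n) \<le> l1_norm f" and "l1_norm f \<ge> 0"
proof -
  obtain a where a: "has_dirichlet_series f a" "\<And>K. (\<Sum>n=1..K. cmod (a n)) \<le> M"
    using wap_has_series[OF assms] by blast
  have eq: "dirichlet_coeff f = a(0 := 0)" by (rule dirichlet_coeff_eq[OF a(1)])
  have le: "(\<Sum>n<K. cmod (dirichlet_coeff f n)) \<le> M" for K
  proof -
    have "(\<Sum>n<K. cmod (dirichlet_coeff f n)) \<le> (\<Sum>n=0..K. cmod (dirichlet_coeff f n))" by (rule sum_mono2) auto
    also have "\<dots> = (\<Sum>n=1..K. cmod (a n))"
      by (rule sum.mono_neutral_cong_right) (auto simp: eq Suc_le_eq)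
    finally show ?thesis using a(2)[of K] by simp
  qed
  have sm: "summable (\<lambda>n. cmod (dirichlet_coeff f n))" by (rule summableI_nonneg_bounded[OF _ le]) auto
  show "l1_norm f \<le> M" unfolding l1_norm_def by (rule suminf_le_const[OF sm le])
  show "cmod (dirichlet_coeff f n) \<le> l1_norm f"
    unfolding l1_norm_def using sum_le_suminf[OF sm, of "{n}"] by simp
  show "l1_norm f \<ge> 0" unfolding l1_norm_def by (rule suminf_nonneg[OF sm]) auto
qed

lemma dilate_eq: "dilate r f = dirichlet_limit (\<lambda>n. charval (\<lambda>_. of_real r) n * dirichlet_coeff f n)"
  by (simp add: dilate_def charval_const)

lemma dilate_extensional: "dilate r f \<in> extensional right_halfplane"
  by (auto simp: dilate_def dirichlet_limit_def)

lemma dilate_has_series: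
  assumes "has_dirichlet_series f a" "0 < r" "r < 1"
  shows "has_dirichlet_series (dilate r f) (\<lambda>n. charval (\<lambda>_. of_real r) n * a n)"
proof -
  have "has_dirichlet_series (dilate r f) (\<lambda>n. charval (\<lambda>_. of_real r) n * dirichlet_coeff f n)"
    unfolding dilate_eq
    by (rule twist_has_series[OF has_series_dirichlet_coeff(1)[OF assms(1)]]) (use assms in auto)
  thus ?thesis using has_series_dirichlet_coeff(2)[OF assms(1)]
    by (subst has_series_cong[of _ "dilate r f" _ "\<lambda>n. charval (\<lambda>_. of_real r) n * dirichlet_coeff f n"]) auto
qed

lemma dilate_Ou: "f \<in> Ou \<Longrightarrow> 0 < r \<Longrightarrow> r < 1 \<Longrightarrow> dilate r f \<in> Ou"
  using OuI[OF dilate_extensional dilate_has_series[OF OuD(2)]] by blast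

lemma Ob_iff:
  "f \<in> Ob \<longleftrightarrow> f \<in> Ou \<and> (\<forall>r. 0 < r \<longrightarrow> r < 1 \<longrightarrow> (\<exists>B. \<forall>s. Re s > 0 \<longrightarrow> cmod (dilate r f s) \<le> B))"
  by (auto simp: Ob_def bounded_right_halfplane_iff)

section \<open>Logarithms in the larger algebras\<close>

text \<open>Twisting commutes with Dirichlet convolution, hence with the exponential series of coefficients.\<close>
theorem exp_twist:
  assumes F: "has_dirichlet_series F a" and E: "has_dirichlet_series (\<lambda>s. exp (F s)) c"
    and G: "has_dirichlet_series G (\<lambda>n. charval w n * a n)"
  shows "has_dirichlet_series (\<lambda>s. exp (G s)) (\<lambda>n. charval w n * c n)"
proof -
  obtain c' where c': "has_dirichlet_series (\<lambda>s. exp (F s)) c'" "\<And>n. n \<ge> 1 \<Longrightarrow> (\<lambda>k. dpow a k n / fact k) sums c' n"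
    using has_series_exp[OF F] by blast
  obtain d where d: "has_dirichlet_series (\<lambda>s. exp (G s)) d"
      "\<And>n. n \<ge> 1 \<Longrightarrow> (\<lambda>k. dpow (\<lambda>n. charval w n * a n) k n / fact k) sums d n"
    using has_series_exp[OF G] by blast
  have "d n = charval w n * c n" if n: "n \<ge> 1" for n
  proof -
    have "c' n = c n" by (rule has_series_unique[OF c'(1) E n])
    hence "(\<lambda>k. charval w n * (dpow a k n / fact k)) sums (charval w n * c n)"
      using sums_mult[OF c'(2)[OF n], of "charval w n"] by simp
    moreover have "dpow (\<lambda>n. charval w n * a n) k n = charval w n * dpow a k n" for k
      using dpow_mult_char[of "charval w" n a k] n by (simp add: charval_mult mult.commute)
    ultimately have "(\<lambda>k. dpow (\<lambda>n. charval w n * a n) k n / fact k) sums (charval w n * c n)" by simp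
    thus ?thesis using d(2)[OF n] sums_unique2 by blast
  qed
  thus ?thesis using d(1) has_series_cong[of "\<lambda>s. exp (G s)" "\<lambda>s. exp (G s)" d] by simp
qed

text \<open>A holomorphic logarithm exists because the half-plane is contractible. On each shifted half-plane it differs from the almost periodic
logarithm of \<open>dap_log\<close> by a continuous function with values in \<open>2 * pi * \<i> * \<int>\<close>, that is, by a constant.\<close>
theorem has_series_log:
  assumes F: "has_dirichlet_series F c"
    and low: "\<And>t. t > 0 \<Longrightarrow> \<exists>\<delta>>0. \<forall>s. Re s > 0 \<longrightarrow> cmod (F (s + of_real t)) \<ge> \<delta>"
  shows "\<exists>A a. has_dirichlet_series A a \<and> (\<forall>s. Re s > 0 \<longrightarrow> F s = exp (A s))"
proof -
  have nz: "F s \<noteq> 0" if "s \<in> right_halfplane" for s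
  proof -
    from that have s: "Re s > 0" by simp
    obtain \<delta> where "\<delta> > 0" "\<And>z. Re z > 0 \<Longrightarrow> cmod (F (z + of_real (Re s / 2))) \<ge> \<delta>"
      using low[of "Re s / 2"] s by auto
    from this(2)[of "s - of_real (Re s / 2)"] this(1) s show ?thesis by auto
  qed
  obtain A where A: "A holomorphic_on right_halfplane" "\<And>s. s \<in> right_halfplane \<Longrightarrow> F s = exp (A s)"
    using contractible_imp_holomorphic_log[OF has_series_holomorphic[OF F] convex_imp_contractible[OF convex_right_halfplane] nz]
    by blast
  have "dap UNIV (\<lambda>s. A (s + of_real t))" if t: "t > 0" for t
  proof -
    obtain \<delta> where \<delta>: "\<delta> > 0" "\<And>s. Re s > 0 \<Longrightarrow> cmod (F (s + of_real t)) \<ge> \<delta>" using low[OF t] by blast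
    obtain b where b: "dap UNIV b" "\<And>s. Re s > 0 \<Longrightarrow> F (s + of_real t) = exp (b s)"
      using dap_log[OF mult_closed_UNIV has_series_dap_shift[OF F t] \<delta>] by blast
    define g where "g = (\<lambda>s. A (s + of_real t) - b s)"
    obtain bc where "has_dirichlet_series b bc" using dap_has_series[OF b(1)] by blast
    hence "b holomorphic_on right_halfplane" by (rule has_series_holomorphic)
    moreover have "(A \<circ> (\<lambda>s. s + of_real t)) holomorphic_on right_halfplane"
      by (rule holomorphic_on_compose_gen[OF _ A(1)]) (use t in \<open>auto intro!: holomorphic_intros\<close>)
    ultimately have "g holomorphic_on right_halfplane"
      unfolding g_def by (intro holomorphic_intros) (auto simp: o_def)
    hence cont: "continuous_on right_halfplane g" by (rule holomorphic_on_imp_continuous_on)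
    have g1: "exp (g s) = 1" if "Re s > 0" for s
      using A(2)[of "s + of_real t"] b(2)[OF that] that t by (simp add: g_def exp_diff)
    have "g constant_on right_halfplane"
    proof (rule continuous_discrete_range_constant[OF convex_connected[OF convex_right_halfplane] cont])
      fix x assume x: "x \<in> right_halfplane"
      show "\<exists>e>0. \<forall>y. y \<in> right_halfplane \<and> g y \<noteq> g x \<longrightarrow> e \<le> cmod (g y - g x)"
      proof (intro exI[of _ "2 * pi"] conjI allI impI)
        fix y assume y: "y \<in> right_halfplane \<and> g y \<noteq> g x"
        have "exp (g y - g x) = 1" using g1 x y by (simp add: exp_diff)
        then obtain m :: int where m: "Re (g y - g x) = 0" "Im (g y - g x) = of_int (2 * m) * pi"
          by (auto simp: exp_eq_1)
        have "m \<noteq> 0" using m y by (auto simp: complex_eq_iff)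
        hence "1 \<le> \<bar>m\<bar>" by linarith
        hence "1 * (2 * pi) \<le> \<bar>of_int m\<bar> * (2 * pi)"
          by (intro mult_right_mono) (simp_all flip: of_int_abs)
        also have "\<dots> = \<bar>Im (g y - g x)\<bar>" unfolding m(2) by (simp add: abs_mult)
        also have "\<dots> \<le> cmod (g y - g x)" by (rule abs_Im_le_cmod)
        finally show "2 * pi \<le> cmod (g y - g x)" by simp
      qed simp
    qed
    then obtain k where k: "\<And>s. Re s > 0 \<Longrightarrow> g s = k" unfolding constant_on_def by auto
    have "dap UNIV (\<lambda>s. b s + k)" by (rule dap_add[OF b(1) dap_const]) simp
    thus ?thesis by (subst dap_cong[of _ "\<lambda>s. b s + k"]) (use k in \<open>auto simp: g_def algebra_simps\<close>)
  qed
  from dap_shifts_has_series[OF this] obtain a where "has_dirichlet_series A a" by blast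
  with A(2) show ?thesis by auto
qed

text \<open>The Schwarz lemma, applied to the composition of \<open>h - h 0\<close> with the Moebius map that sends the half-plane
\<open>Re w < A\<close> to the disc.\<close>
lemma borel_caratheodory:
  assumes hol: "h holomorphic_on ball 0 1" and K: "\<And>z. cmod z < 1 \<Longrightarrow> Re (h z) \<le> K" and z: "cmod z < 1"
  shows "cmod (h z) \<le> cmod (h 0) + 2 * (K + 1 - Re (h 0)) * cmod z / (1 - cmod z)"
proof -
  define A where "A = K + 1 - Re (h 0)"
  have A: "A > 0" using K[of 0] by (simp add: A_def)
  define w where "w = (\<lambda>z. h z - h 0)"
  have w_Re: "Re (w z) < A" if "cmod z < 1" for z using K[OF that] by (simp add: w_def A_def)
  have less: "cmod (w z) < cmod (2 * of_real A - w z)" if "cmod z < 1" for z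
  proof -
    have "(cmod (2 * of_real A - w z))\<^sup>2 - (cmod (w z))\<^sup>2 = 4 * A * (A - Re (w z))"
      unfolding cmod_power2 by (simp add: power2_eq_square algebra_simps)
    also have "\<dots> > 0" using A w_Re[OF that] by simp
    finally show ?thesis by (simp add: power_less_imp_less_base)
  qed
  define \<phi> where "\<phi> = (\<lambda>z. w z / (2 * of_real A - w z))"
  have nz: "2 * of_real A - w z \<noteq> 0" if "cmod z < 1" for z using less[OF that] by auto
  have "cmod (\<phi> z) \<le> cmod z"
  proof (rule Schwarz_Lemma(1)[OF _ _ _ z])
    show "\<phi> holomorphic_on ball 0 1"
      unfolding \<phi>_def w_def by (intro holomorphic_intros hol) (use nz in \<open>auto simp: w_def\<close>)
    show "\<phi> 0 = 0" by (simp add: \<phi>_def w_def)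
    show "cmod (\<phi> z) < 1" if "cmod z < 1" for z
      using less[OF that] nz[OF that] by (simp add: \<phi>_def norm_divide divide_less_eq)
  qed
  have "w z * (1 + \<phi> z) = 2 * of_real A * \<phi> z"
    using nz[OF z] by (simp add: \<phi>_def field_simps)
  hence "cmod (w z) * cmod (1 + \<phi> z) = 2 * A * cmod (\<phi> z)"
    using A by (metis norm_mult norm_of_real norm_numeral abs_of_pos)
  moreover have "cmod (1 + \<phi> z) \<ge> 1 - cmod z"
    using norm_triangle_ineq4[of "1 + \<phi> z" "\<phi> z"] \<open>cmod (\<phi> z) \<le> cmod z\<close> by simp
  ultimately have "cmod (w z) * (1 - cmod z) \<le> 2 * A * cmod z"
    using \<open>cmod (\<phi> z) \<le> cmod z\<close> A by (smt (verit) mult_left_mono norm_ge_zero)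
  hence "cmod (w z) \<le> 2 * A * cmod z / (1 - cmod z)" using z by (simp add: pos_le_divide_eq)
  moreover have "cmod (h z) \<le> cmod (h 0) + cmod (w z)"
    using norm_triangle_ineq[of "h 0" "w z"] by (simp add: w_def)
  ultimately show ?thesis by (simp add: A_def)
qed

text \<open>The twisted partial sums are polynomials in \<open>z\<close>. By the contraction property they converge uniformly for \<open>z\<close> in the
unit disc.\<close>
lemma twist_holomorphic_parameter:
  assumes F: "has_dirichlet_series F b" and s: "Re s > 0"
  shows "(\<lambda>z. dirichlet_limit (\<lambda>n. charval (\<lambda>_. z) n * b n) s) holomorphic_on ball 0 1"
proof (rule holomorphic_uniform_sequence[OF open_ball])
  let ?T = "\<lambda>N z. dirichlet_partial (\<lambda>n. charval (\<lambda>_. z) n * b n) N s"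
  show "?T N holomorphic_on ball 0 1" for N
    unfolding dirichlet_partial_def charval_const by (intro holomorphic_intros)
  have unif: "uniform_limit (ball 0 1) ?T (\<lambda>z. dirichlet_limit (\<lambda>n. charval (\<lambda>_. z) n * b n) s) sequentially"
  proof (rule uniform_limitI)
    fix h :: real assume h: "h > 0"
    define e where "e = Re s / 2"
    have e: "e > 0" "Re (s - of_real e) > 0" using s by (auto simp: e_def)
    define b' where "b' = (\<lambda>n. b n * of_nat n powr (- of_real e))"
    obtain N0 where N0: "\<And>N u. N \<ge> N0 \<Longrightarrow> Re u > 0 \<Longrightarrow> cmod (F (u + of_real e) - dirichlet_partial b' N u) < h/2"
      using has_series_approx[OF F e(1), of "h/2"] h unfolding b'_def by auto
    have "dist (?T N z) (dirichlet_limit (\<lambda>n. charval (\<lambda>_. z) n * b n) s) < h" if N: "N \<ge> N0" and z: "z \<in> ball 0 1" for N z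
    proof -
      have w: "cmod z \<le> 1" using z by simp
      define T where "T = dirichlet_limit (\<lambda>n. charval (\<lambda>_. z) n * b n)"
      have T: "has_dirichlet_series T (\<lambda>n. charval (\<lambda>_. z) n * b n)"
        unfolding T_def by (rule twist_has_series[OF F w])
      have E: "has_dirichlet_series (\<lambda>u. F (u + of_real e) - dirichlet_partial b' N u) (\<lambda>n. b' n - trunc N b' n)"
        using has_series_diff[OF has_series_shift[OF F less_imp_le[OF e(1)]] has_series_poly[of b' N]] by (simp add: b'_def)
      define c where "c = (\<lambda>n. charval (\<lambda>_. z) n * b' n)"
      have "has_dirichlet_series (\<lambda>u. T (u + of_real e) - dirichlet_partial c N u) (\<lambda>n. c n - trunc N c n)"
        using has_series_diff[OF has_series_shift[OF T less_imp_le[OF e(1)]] has_series_poly[of c N]]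
        by (simp add: b'_def c_def mult.assoc)
      also have "(\<lambda>n. c n - trunc N c n) = (\<lambda>n. charval (\<lambda>_. z) n * (b' n - trunc N b' n))"
        by (auto simp: c_def trunc_def fun_eq_iff)
      finally have "cmod (T ((s - of_real e) + of_real e) - dirichlet_partial c N (s - of_real e)) \<le> h/2"
        by (rule twist_bound[OF E w _ less_imp_le[OF N0[OF N]] e(2)])
      moreover have "dirichlet_partial c N (s - of_real e) = ?T N z"
        using dirichlet_partial_shift[of "\<lambda>n. charval (\<lambda>_. z) n * b n" N "s - of_real e" "of_real e"]
        by (simp add: c_def b'_def mult.assoc)
      ultimately show ?thesis using h by (simp add: dist_norm norm_minus_commute flip: T_def)
    qed
    thus "\<forall>\<^sub>F N in sequentially. \<forall>z\<in>ball 0 1. dist (?T N z) (dirichlet_limit (\<lambda>n. charval (\<lambda>_. z) n * b n) s) < h"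
      unfolding eventually_sequentially by blast
  qed
  fix x :: complex assume "x \<in> ball 0 1"
  then obtain d where d: "d > 0" "cball x d \<subseteq> ball 0 1"
    using open_contains_cball[of "ball 0 1 :: complex set"] open_ball by blast
  with uniform_limit_on_subset[OF unif d(2)]
  show "\<exists>d>0. cball x d \<subseteq> ball 0 1 \<and> uniform_limit (cball x d) ?T (\<lambda>z. dirichlet_limit (\<lambda>n. charval (\<lambda>_. z) n * b n) s) sequentially"
    by blast
qed

text \<open>The modulus of \<open>f\<close> bounds only the real part of its logarithm. For fixed \<open>s\<close> consider the dilations of \<open>A\<close> by \<open>z * \<rho>\<close> with
complex \<open>z\<close> in the unit disc: a holomorphic function of \<open>z\<close> with real part at most \<open>K = ln (max 1 B)\<close>, since twisting
does not increase the supremum \<open>B\<close> of the dilation of \<open>f\<close> by \<open>\<rho>\<close>. Its value at 0 is the first coefficient of \<open>A\<close> for every \<open>s\<close>, so the Borel-Caratheodory inequality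
at \<open>z = r / \<rho>\<close> gives a bound that is uniform in \<open>s\<close>.\<close>
theorem Ob_log_bounded:
  assumes f: "f \<in> Ob" and A: "has_dirichlet_series A a" and fA: "\<And>s. Re s > 0 \<Longrightarrow> f s = exp (A s)"
  shows "onH A \<in> Ob"
  unfolding Ob_iff
proof (intro conjI allI impI)
  show "onH A \<in> Ou" by (rule Ou_onH[OF A])
  fix r :: real assume r: "0 < r" "r < 1"
  \<comment> \<open>any number strictly between \<open>r\<close> and 1\<close>
  define \<rho> where "\<rho> = (r + 1) / 2"
  have \<rho>: "0 < \<rho>" "\<rho> < 1" "r < \<rho>" using r by (auto simp: \<rho>_def)
  define x where "x = r / \<rho>"
  have x: "0 < x" "x < 1" "r = x * \<rho>" using r \<rho> by (auto simp: x_def)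
  note fs = OuD(2)[OF Ob_imp_Ou[OF f]]
  define c where "c = dirichlet_coeff f"
  have EA: "has_dirichlet_series (\<lambda>s. exp (A s)) c"
    using fs has_series_cong[of f "\<lambda>s. exp (A s)" c c] fA by (simp add: c_def)
  obtain B where "\<And>s. Re s > 0 \<Longrightarrow> cmod (dilate \<rho> f s) \<le> B" using f \<rho> unfolding Ob_iff by blast
  hence B: "cmod (dilate \<rho> f s) \<le> max 1 B" if "Re s > 0" for s
    using that by (simp add: le_max_iff_disj)
  define K where "K = ln (max 1 B)"
  define b where "b = (\<lambda>n. charval (\<lambda>_. of_real \<rho>) n * a n)"
  have A\<rho>: "has_dirichlet_series (dilate \<rho> A) b" unfolding b_def by (rule dilate_has_series[OF A \<rho>(1,2)])
  have f\<rho>: "has_dirichlet_series (dilate \<rho> f) (\<lambda>n. charval (\<lambda>_. of_real \<rho>) n * c n)"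
    unfolding c_def by (rule dilate_has_series[OF fs \<rho>(1,2)])
  have E\<rho>: "has_dirichlet_series (\<lambda>s. exp (dilate \<rho> A s)) (\<lambda>n. charval (\<lambda>_. of_real \<rho>) n * c n)"
    by (rule exp_twist[OF A EA A\<rho>[unfolded b_def]])
  define T where "T = (\<lambda>z. dirichlet_limit (\<lambda>n. charval (\<lambda>_. z) n * b n))"
  have T: "has_dirichlet_series (T z) (\<lambda>n. charval (\<lambda>_. z) n * b n)" if "cmod z < 1" for z
    unfolding T_def by (rule twist_has_series[OF A\<rho>]) (use that in simp)
  have T_Re: "Re (T z s) \<le> K" if z: "cmod z < 1" and s: "Re s > 0" for z s
  proof -
    have "has_dirichlet_series (\<lambda>s. exp (T z s)) (\<lambda>n. charval (\<lambda>_. z) n * (charval (\<lambda>_. of_real \<rho>) n * c n))"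
      by (rule exp_twist[OF A\<rho> E\<rho> T[OF z]])
    from twist_bound[OF f\<rho> _ this B s] z have "cmod (exp (T z s)) \<le> max 1 B" by simp
    hence "exp (Re (T z s)) \<le> exp K" unfolding norm_exp_eq_Re K_def by simp
    thus ?thesis by simp
  qed
  have T0: "T 0 s = a 1" if s: "Re s > 0" for s
  proof (rule has_series_fun_unique[OF T[of 0] has_series_const[of "a 1"] _ s])
    fix n :: nat assume n: "n \<ge> 1"
    show "charval (\<lambda>_. 0) n * b n = (if n = 1 then a 1 else 0)"
    proof (cases "n = 1")
      case False
      hence "prime_factorization n \<noteq> {#}" using n by (simp add: prime_factorization_empty_iff)
      hence "size (prime_factorization n) \<noteq> 0" by simp
      hence "charval (\<lambda>_. 0) n = 0" unfolding charval_const by (simp only: power_0_left if_False)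
      thus ?thesis using False by simp
    qed (simp add: b_def)
  qed simp
  have dil: "dilate r (onH A) s = T (of_real x) s" if s: "Re s > 0" for s
  proof (rule has_series_fun_unique[OF dilate_has_series[OF _ r, of "onH A" a] T _ s])
    show "has_dirichlet_series (onH A) a" using A by (simp add: has_series_onH)
    show "cmod (of_real x) < 1" using x by simp
    show "charval (\<lambda>_. of_real r) n * a n = charval (\<lambda>_. of_real x) n * b n" for n
      unfolding b_def charval_const x(3) by (simp add: power_mult_distrib mult.assoc)
  qed
  have "cmod (T (of_real x) s) \<le> cmod (a 1) + 2 * (K + 1 - Re (a 1)) * x / (1 - x)" if s: "Re s > 0" for s
    using borel_caratheodory[of "\<lambda>z. T z s" K "of_real x"] twist_holomorphic_parameter[OF A\<rho> s, folded T_def]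
      T_Re[OF _ s] x T0[OF s] by (simp add: T_def)
  thus "\<exists>B. \<forall>s. Re s > 0 \<longrightarrow> cmod (dilate r (onH A) s) \<le> B" using dil by auto
qed

section \<open>Invariance under permutations of the primes\<close>

lemma subgroup_BijGroup_bij:
  assumes "subgroup G (BijGroup {1::nat..})" "\<sigma> \<in> G" shows "bij_betw \<sigma> {1..} {1..}"
  using subgroup.subset[OF assms(1)] assms(2) by (auto simp: BijGroup_def Bij_def)

lemma perm_hat_ge_1: "bij_betw \<sigma> {1..} {1..} \<Longrightarrow> n \<ge> 1 \<Longrightarrow> perm_hat \<sigma> n \<ge> 1"
  using bij_betwE[OF perm_hat_props(3)] by simp

lemma invariants_iff:
  assumes G: "\<And>\<sigma>. \<sigma> \<in> G \<Longrightarrow> bij_betw \<sigma> {1..} {1..}" and f: "has_dirichlet_series f a"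
  shows "f \<in> invariants G X \<longleftrightarrow> f \<in> X \<and> (\<forall>\<sigma>\<in>G. \<forall>n\<ge>1. a (perm_hat \<sigma> n) = a n)"
  unfolding invariants_def using has_series_dirichlet_coeff(2)[OF f] perm_hat_ge_1[OF G] by auto

text \<open>If the exponential is invariant, \<open>a\<close> and its permutation have the same exponential coefficients and the same first coefficient, because
\<open>perm_hat \<sigma> 1 = 1\<close>; so they agree.\<close>
theorem exp_invariant_iff:
  assumes \<sigma>: "bij_betw \<sigma> {1..} {1..}" and A: "has_dirichlet_series A a"
    and E: "has_dirichlet_series (\<lambda>s. exp (A s)) c"
  shows "(\<forall>n\<ge>1. c (perm_hat \<sigma> n) = c n) \<longleftrightarrow> (\<forall>n\<ge>1. a (perm_hat \<sigma> n) = a n)"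
proof -
  obtain c' where c': "has_dirichlet_series (\<lambda>s. exp (A s)) c'" "\<And>n. n \<ge> 1 \<Longrightarrow> (\<lambda>k. dpow a k n / fact k) sums c' n"
    using has_series_exp[OF A] by blast
  have c: "(\<lambda>k. dpow a k n / fact k) sums c n" if "n \<ge> 1" for n
    using c'(2)[OF that] has_series_unique[OF c'(1) E that] by simp
  have ge: "perm_hat \<sigma> n \<ge> 1" if "n \<ge> 1" for n by (rule perm_hat_ge_1[OF \<sigma> that])
  have perm: "dpow (\<lambda>n. a (perm_hat \<sigma> n)) k n = dpow a k (perm_hat \<sigma> n)" if "n \<ge> 1" for k n
    by (rule dpow_perm[OF perm_hat_props(3)[OF \<sigma>] perm_hat_props(2)[OF \<sigma>] perm_hat_props(1)[OF \<sigma>] that])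
  show ?thesis
  proof
    assume inv: "\<forall>n\<ge>1. c (perm_hat \<sigma> n) = c n"
    have "(\<lambda>k. dpow (\<lambda>n. a (perm_hat \<sigma> n)) k n / fact k) sums c n" if "n \<ge> 1" for n
      using c[OF ge[OF that]] inv that by (simp add: perm)
    hence "a n = a (perm_hat \<sigma> n)" if "n \<ge> 1" for n
      using exp_coefficients_inject[of a c "\<lambda>n. a (perm_hat \<sigma> n)" n] c that perm_hat_props(1)[OF \<sigma>] by simp
    thus "\<forall>n\<ge>1. a (perm_hat \<sigma> n) = a n" by simp
  next
    assume inv: "\<forall>n\<ge>1. a (perm_hat \<sigma> n) = a n"
    show "\<forall>n\<ge>1. c (perm_hat \<sigma> n) = c n"
    proof (intro allI impI)
      fix n :: nat assume n: "n \<ge> 1"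
      have "dpow a k (perm_hat \<sigma> n) = dpow a k n" for k
      proof -
        have "dpow (\<lambda>n. a (perm_hat \<sigma> n)) k n = dpow a k n"
        proof (rule dpow_cong[OF n])
          fix d assume "d dvd n"
          hence "d \<ge> 1" using n by (auto intro!: gr0I simp: Suc_le_eq)
          thus "a (perm_hat \<sigma> d) = a d" using inv by blast
        qed
        thus ?thesis using perm[OF n] by simp
      qed
      hence "(\<lambda>k. dpow a k n / fact k) sums c (perm_hat \<sigma> n)" using c[OF ge[OF n]] by simp
      thus "c (perm_hat \<sigma> n) = c n" using c[OF n] sums_unique2 by blast
    qed
  qed
qed

section \<open>Units and exponentials\<close>

lemma Units_fun_ring:
  "f \<in> Units (fun_ring X) \<longleftrightarrow> f \<in> X \<and> (\<exists>g\<in>X. \<forall>s. Re s > 0 \<longrightarrow> f s * g s = 1)"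
  unfolding Units_def fun_ring_def
  by (auto simp: fun_eq_iff restrict_def mult.commute split: if_splits)

text \<open>Every inverse in the main theorem is obtained as \<open>exp (- A)\<close>. Invariance passes from \<open>f\<close> to \<open>A\<close>, and from there to \<open>exp (- A)\<close>.\<close>
lemma Units_invariants_exp:
  assumes G: "\<And>\<sigma>. \<sigma> \<in> G \<Longrightarrow> bij_betw \<sigma> {1..} {1..}" and f: "f \<in> invariants G X" and X: "X \<subseteq> Ou"
    and A: "has_dirichlet_series A a" and fA: "\<And>s. Re s > 0 \<Longrightarrow> f s = exp (A s)"
    and inv: "onH (\<lambda>s. exp (- A s)) \<in> X"
  shows "f \<in> Units (fun_ring (invariants G X))"
    and "\<And>Y. onH A \<in> Y \<Longrightarrow> onH A \<in> invariants G Y"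
proof -
  have fO: "f \<in> Ou" using f X by (auto simp: invariants_def)
  define c where "c = dirichlet_coeff f"
  have fs: "has_dirichlet_series f c" using OuD(2)[OF fO] by (simp add: c_def)
  have E: "has_dirichlet_series (\<lambda>s. exp (A s)) c"
    using fs has_series_cong[of f "\<lambda>s. exp (A s)" c c] fA by simp
  have "\<forall>\<sigma>\<in>G. \<forall>n\<ge>1. c (perm_hat \<sigma> n) = c n" using f invariants_iff[OF G fs] by blast
  hence a_inv: "\<forall>\<sigma>\<in>G. \<forall>n\<ge>1. a (perm_hat \<sigma> n) = a n"
    using exp_invariant_iff[OF G A E] by blast
  show "onH A \<in> invariants G Y" if "onH A \<in> Y" for Y
    using invariants_iff[OF G, of G "onH A" a Y] A a_inv that by (simp add: has_series_onH)
  have A': "has_dirichlet_series (\<lambda>s. - A s) (\<lambda>n. - a n)"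
    using has_series_lincomb[OF A A, of "-1" 0] by simp
  obtain d where d: "has_dirichlet_series (\<lambda>s. exp (- A s)) d" using has_series_exp[OF A'] by blast
  have "\<forall>\<sigma>\<in>G. \<forall>n\<ge>1. d (perm_hat \<sigma> n) = d n"
    using exp_invariant_iff[OF G A' d] a_inv by simp
  hence "onH (\<lambda>s. exp (- A s)) \<in> invariants G X"
    using invariants_iff[OF G, of G "onH (\<lambda>s. exp (- A s))" d X] d inv by (simp add: has_series_onH)
  moreover have "f s * onH (\<lambda>s. exp (- A s)) s = 1" if "Re s > 0" for s
    using fA[OF that] that by (simp add: exp_minus)
  ultimately show "f \<in> Units (fun_ring (invariants G X))" using f unfolding Units_fun_ring by blast
qed

lemma Wie_subset_Adir: "Wie \<subseteq> Adir"
  using wap_imp_dap by (auto simp: Wie_iff Adir_iff)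

lemma Adir_subset_Hinf: "Adir \<subseteq> Hinf"
  by (auto simp: Adir_def)

lemma Units_bounded_below:
  assumes "f \<in> Units (fun_ring (invariants G X))" "X \<subseteq> Hinf"
  shows "\<exists>\<delta>>0. \<forall>s. Re s > 0 \<longrightarrow> cmod (f s) \<ge> \<delta>"
proof -
  obtain g where g: "g \<in> X" "\<And>s. Re s > 0 \<Longrightarrow> f s * g s = 1"
    using assms(1) unfolding Units_fun_ring invariants_def by blast
  have "g \<in> Hinf" using g(1) assms(2) by blast
  then obtain B where B: "\<And>s. Re s > 0 \<Longrightarrow> cmod (g s) \<le> B" unfolding Hinf_iff by blast
  have "cmod (f s) \<ge> 1 / max 1 B" if s: "Re s > 0" for s
  proof -
    have "1 = cmod (f s) * cmod (g s)" using g(2)[OF s] by (metis norm_mult norm_one)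
    also have "\<dots> \<le> cmod (f s) * max 1 B" using B[OF s] by (intro mult_left_mono) auto
    finally show ?thesis by (simp add: pos_divide_le_eq)
  qed
  thus ?thesis by (intro exI[of _ "1 / max 1 B"]) auto
qed

lemma Wie_log:
  assumes "f \<in> Wie" "\<delta> > 0" "\<And>s. Re s > 0 \<Longrightarrow> cmod (f s) \<ge> \<delta>"
  shows "\<exists>A a. has_dirichlet_series A a \<and> onH A \<in> Wie \<and> (\<forall>s. Re s > 0 \<longrightarrow> f s = exp (A s))"
proof -
  obtain M where "wap UNIV M f" using assms(1) by (auto simp: Wie_iff)
  from wap_log[OF this assms(2,3)] obtain M' A where A: "wap UNIV M' A" "\<forall>s. Re s > 0 \<longrightarrow> f s = exp (A s)" by blast
  have "onH A \<in> Wie" using A(1) by (auto simp: Wie_iff wap_onH)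
  moreover obtain a where "has_dirichlet_series A a" using wap_has_series[OF A(1)] by blast
  ultimately show ?thesis using A(2) by blast
qed

lemma Wie_exp_minus: "onH A \<in> Wie \<Longrightarrow> onH (\<lambda>s. exp (- A s)) \<in> Wie"
  using wap_exp[OF mult_closed_UNIV wap_cmult[OF mult_closed_UNIV, of _ A "-1"]]
  by (auto simp: Wie_iff wap_onH)

lemma Adir_log:
  assumes "f \<in> Adir" "\<delta> > 0" "\<And>s. Re s > 0 \<Longrightarrow> cmod (f s) \<ge> \<delta>"
  shows "\<exists>A a. has_dirichlet_series A a \<and> onH A \<in> Adir \<and> (\<forall>s. Re s > 0 \<longrightarrow> f s = exp (A s))"
proof -
  have "dap UNIV f" using assms(1) by (auto simp: Adir_iff)
  from dap_log[OF mult_closed_UNIV this assms(2,3)] obtain A where A: "dap UNIV A" "\<forall>s. Re s > 0 \<longrightarrow> f s = exp (A s)" by blast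
  have "onH A \<in> Adir" using A(1) by (auto simp: Adir_iff dap_onH)
  moreover obtain a where "has_dirichlet_series A a" using dap_has_series[OF A(1)] by blast
  ultimately show ?thesis using A(2) by blast
qed

lemma Adir_exp_minus: "onH A \<in> Adir \<Longrightarrow> onH (\<lambda>s. exp (- A s)) \<in> Adir"
  using dap_exp[OF mult_closed_UNIV dap_cmult[OF mult_closed_UNIV, of A "-1"]]
  by (auto simp: Adir_iff dap_onH)

lemma Hinf_log:
  assumes "f \<in> Hinf" "\<delta> > 0" "\<And>s. Re s > 0 \<Longrightarrow> cmod (f s) \<ge> \<delta>"
  shows "\<exists>A a. has_dirichlet_series A a \<and> onH (\<lambda>s. exp (- A s)) \<in> Hinf \<and> (\<forall>s. Re s > 0 \<longrightarrow> f s = exp (A s))"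
proof -
  have "\<exists>\<delta>>0. \<forall>s. Re s > 0 \<longrightarrow> cmod (f (s + of_real t)) \<ge> \<delta>" if "t > 0" for t
    using assms(2,3) that by (intro exI[of _ \<delta>]) auto
  from has_series_log[OF OuD(2)[OF Hinf_imp_Ou[OF assms(1)]] this]
  obtain A a where A: "has_dirichlet_series A a" "\<And>s. Re s > 0 \<Longrightarrow> f s = exp (A s)" by blast
  have "has_dirichlet_series (\<lambda>s. - A s) (\<lambda>n. - a n)"
    using has_series_lincomb[OF A(1) A(1), of "-1" 0] by simp
  then obtain d where "has_dirichlet_series (\<lambda>s. exp (- A s)) d" using has_series_exp by blast
  hence "onH (\<lambda>s. exp (- A s)) \<in> Ou" by (rule Ou_onH)
  moreover have "cmod (onH (\<lambda>s. exp (- A s)) s) \<le> 1 / \<delta>" if s: "Re s > 0" for s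
  proof -
    have "onH (\<lambda>s. exp (- A s)) s = inverse (f s)" using A(2)[OF s] s by (simp add: exp_minus)
    moreover have "inverse (cmod (f s)) \<le> inverse \<delta>" using assms(2) assms(3)[OF s] by (rule le_imp_inverse_le[rotated])
    ultimately show ?thesis by (simp add: norm_inverse divide_inverse)
  qed
  ultimately have "onH (\<lambda>s. exp (- A s)) \<in> Hinf" unfolding Hinf_iff by blast
  thus ?thesis using A by blast
qed

text \<open>A lower bound for \<open>f\<close> on the half-plane \<open>Re s > t\<close> comes from the dilation with \<open>r = 2 powr (-t)\<close>. Shifting by \<open>t\<close>
multiplies the coefficient at a prime \<open>p\<close> by \<open>p powr (-t) \<le> r\<close>, so the shift of \<open>f\<close> is a contractive twist of its dilation. The same
twist takes the inverse of the dilation to a bounded inverse of the shift.\<close>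
theorem Ob_log:
  assumes f: "f \<in> Ob" and u: "\<And>r. 0 < r \<Longrightarrow> r < 1 \<Longrightarrow> dilate r f \<in> Units (fun_ring (invariants G Hinf))"
  shows "\<exists>A a. has_dirichlet_series A a \<and> onH A \<in> Ob \<and> (\<forall>s. Re s > 0 \<longrightarrow> f s = exp (A s))"
proof -
  note fs = OuD(2)[OF Ob_imp_Ou[OF f]]
  define c where "c = dirichlet_coeff f"
  have "\<exists>\<delta>>0. \<forall>s. Re s > 0 \<longrightarrow> cmod (f (s + of_real t)) \<ge> \<delta>" if t: "t > 0" for t
  proof -
    define r where "r = 2 powr (-t)"
    have r: "0 < r" "r < 1" using t powr_less_mono[of "-t" 0 2] by (auto simp: r_def)
    obtain g where g: "g \<in> Hinf" "\<And>s. Re s > 0 \<Longrightarrow> dilate r f s * g s = 1"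
      using u[OF r] unfolding Units_fun_ring invariants_def by blast
    obtain B where B: "\<And>s. Re s > 0 \<Longrightarrow> cmod (g s) \<le> B" using g(1) by (auto simp: Hinf_iff)
    note gs = OuD(2)[OF Hinf_imp_Ou[OF g(1)]]
    define d where "d = dirichlet_coeff g"
    \<comment> \<open>the twist that turns the dilation by \<open>r\<close> into the shift by \<open>t\<close>\<close>
    define w where "w = (\<lambda>p::nat. of_real (real p powr (-t) / r) :: complex)"
    have w: "cmod (w p) \<le> 1" if "prime p" for p
    proof -
      have "real p powr (-t) \<le> 2 powr (-t)" using prime_ge_2_nat[OF that] t by (intro powr_mono2') auto
      thus ?thesis using r unfolding w_def norm_of_real by (simp add: r_def)
    qed
    have wr: "charval w n * charval (\<lambda>_. of_real r) n = of_nat n powr (- of_real t)" if n: "n \<ge> 1" for n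
    proof -
      have "charval w n * charval (\<lambda>_. of_real r) n = charval (\<lambda>p. w p * of_real r) n"
        unfolding charval_def by (simp add: prod_mset.distrib)
      also have "(\<lambda>p. w p * of_real r) = (\<lambda>p. of_nat p powr (- of_real t))"
        using r by (auto simp: w_def powr_of_real[symmetric])
      also have "charval \<dots> n = of_nat n powr (- of_real t)" by (rule charval_npow[OF n])
      finally show ?thesis .
    qed
    define Tg where "Tg = dirichlet_limit (\<lambda>n. charval w n * d n)"
    have Tg: "has_dirichlet_series Tg (\<lambda>n. charval w n * d n)"
      unfolding Tg_def d_def by (rule twist_has_series[OF gs w])
    have fr: "has_dirichlet_series (dilate r f) (\<lambda>n. charval (\<lambda>_. of_real r) n * c n)"
      unfolding c_def by (rule dilate_has_series[OF fs r])
    have "has_dirichlet_series (\<lambda>s. dilate r f s * g s) (dconv (\<lambda>n. charval (\<lambda>_. of_real r) n * c n) d)"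
      unfolding d_def by (rule has_series_mult[OF fr gs])
    moreover have "has_dirichlet_series (\<lambda>s. dilate r f s * g s) (\<lambda>n. if n = 1 then 1 else 0)"
      using has_series_const[of 1] by (subst has_series_cong) (use g(2) in auto)
    ultimately have one: "dconv (\<lambda>n. charval (\<lambda>_. of_real r) n * c n) d n = (if n = 1 then 1 else 0)" if "n \<ge> 1" for n
      using has_series_unique that by blast
    have prod: "f (s + of_real t) * Tg s = 1" if s: "Re s > 0" for s
    proof (rule has_series_fun_unique[OF has_series_mult[OF has_series_shift[OF fs less_imp_le[OF t]] Tg] has_series_const[of 1] _ s])
      fix n :: nat assume n: "n \<ge> 1"
      have "dconv (\<lambda>n. dirichlet_coeff f n * of_nat n powr (- of_real t)) (\<lambda>n. charval w n * d n) n
          = dconv (\<lambda>n. (charval (\<lambda>_. of_real r) n * c n) * charval w n) (\<lambda>n. d n * charval w n) n"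
      proof (rule dconv_cong[OF n])
        fix k assume "k dvd n"
        hence "k \<ge> 1" using n by (auto intro!: gr0I simp: Suc_le_eq)
        thus "dirichlet_coeff f k * of_nat k powr (- of_real t) = charval (\<lambda>_. of_real r) k * c k * charval w k"
          using wr[of k] by (simp add: c_def mult_ac flip: wr)
      qed (simp add: mult.commute)
      also have "\<dots> = dconv (\<lambda>n. charval (\<lambda>_. of_real r) n * c n) d n * charval w n"
      proof (rule dconv_mult_char[OF n])
        fix k m assume "k * m = n"
        moreover from this have "k > 0" "m > 0" using n by (auto intro!: gr0I)
        ultimately show "charval w k * charval w m = charval w n" by (auto simp: charval_mult)
      qed
      also have "\<dots> = (if n = 1 then 1 else 0)" using one[OF n] by simp
      finally show "dconv (\<lambda>n. dirichlet_coeff f n * of_nat n powr (- of_real t)) (\<lambda>n. charval w n * d n) n = (if n = 1 then 1 else 0)" .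
    qed
    have Tg_le: "cmod (Tg s) \<le> B" if "Re s > 0" for s
      by (rule twist_bound[OF gs w _ B that]) (use Tg in \<open>simp_all add: d_def\<close>)
    have "cmod (f (s + of_real t)) \<ge> 1 / max 1 B" if s: "Re s > 0" for s
    proof -
      have "1 = cmod (f (s + of_real t)) * cmod (Tg s)" using prod[OF s] by (metis norm_mult norm_one)
      also have "\<dots> \<le> cmod (f (s + of_real t)) * max 1 B" using Tg_le[OF s] by (intro mult_left_mono) auto
      finally show ?thesis by (simp add: pos_divide_le_eq)
    qed
    thus ?thesis by (intro exI[of _ "1 / max 1 B"]) auto
  qed
  from has_series_log[OF fs this] obtain A a where A: "has_dirichlet_series A a" "\<And>s. Re s > 0 \<Longrightarrow> f s = exp (A s)" by blast
  from Ob_log_bounded[OF f A] A show ?thesis by blast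
qed

lemma dilate_exp:
  assumes A: "has_dirichlet_series A a" and fA: "\<And>s. Re s > 0 \<Longrightarrow> f s = exp (A s)" and r: "0 < r" "r < 1" and s: "Re s > 0"
  shows "dilate r f s = exp (dilate r A s)"
proof -
  obtain c where c: "has_dirichlet_series (\<lambda>s. exp (A s)) c" using has_series_exp[OF A] by blast
  have "has_dirichlet_series f c" using c fA has_series_cong[of f "\<lambda>s. exp (A s)" c c] by simp
  from has_series_fun_unique[OF dilate_has_series[OF this r] exp_twist[OF A c dilate_has_series[OF A r]] refl s]
  show ?thesis .
qed

lemma dilate_onH: "has_dirichlet_series A a \<Longrightarrow> dilate r (onH A) = dilate r A"
  using dirichlet_coeff_eq[of A a] dirichlet_coeff_eq[of "onH A" a] by (simp add: dilate_def has_series_onH)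

lemma Ob_exp_minus:
  assumes "onH A \<in> Ob" "has_dirichlet_series A a" shows "onH (\<lambda>s. exp (- A s)) \<in> Ob"
  unfolding Ob_iff
proof (intro conjI allI impI)
  have A': "has_dirichlet_series (\<lambda>s. - A s) (\<lambda>n. - a n)"
    using has_series_lincomb[OF assms(2) assms(2), of "-1" 0] by simp
  obtain d where d: "has_dirichlet_series (\<lambda>s. exp (- A s)) d" using has_series_exp[OF A'] by blast
  show "onH (\<lambda>s. exp (- A s)) \<in> Ou" by (rule Ou_onH[OF d])
  fix r :: real assume r: "0 < r" "r < 1"
  obtain B where B: "\<And>s. Re s > 0 \<Longrightarrow> cmod (dilate r A s) \<le> B"
    using assms(1) r unfolding Ob_iff dilate_onH[OF assms(2)] by blast
  have "cmod (dilate r (onH (\<lambda>s. exp (- A s))) s) \<le> exp B" if s: "Re s > 0" for s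
  proof -
    have "dilate r (\<lambda>s. - A s) s = - dilate r A s"
      using has_series_fun_unique[OF dilate_has_series[OF A' r] has_series_lincomb[OF dilate_has_series[OF assms(2) r] has_series_const[of 0], of "-1" 0] _ s]
      by simp
    hence "dilate r (onH (\<lambda>s. exp (- A s))) s = exp (- dilate r A s)"
      using dilate_exp[OF A' _ r s, of "onH (\<lambda>s. exp (- A s))"] by simp
    also have "cmod \<dots> \<le> exp (cmod (- dilate r A s))" by (rule norm_exp)
    also have "\<dots> \<le> exp B" using B[OF s] by simp
    finally show ?thesis .
  qed
  thus "\<exists>B. \<forall>s. Re s > 0 \<longrightarrow> cmod (dilate r (onH (\<lambda>s. exp (- A s))) s) \<le> B" by blast
qed

section \<open>Convergence of the exponential series\<close>

lemma wap_exp_remainder: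
  assumes S: "mult_closed S" and F: "wap S M F"
  shows "wap S (exp M - (\<Sum>k<K. M ^ k / fact k)) (\<lambda>s. exp (F s) - (\<Sum>k<K. F s ^ k / fact k))"
proof -
  have tail: "(\<lambda>k. z ^ (k + K) / fact (k + K)) sums (exp z - (\<Sum>k<K. z ^ k / fact k))" for z :: "'x::{banach,real_normed_field}"
  proof (rule sums_split_initial_segment)
    show "(\<lambda>k. z ^ k / fact k) sums exp z"
      using exp_converges[of z] by (simp add: scaleR_conv_of_real divide_inverse mult.commute)
  qed
  have "wap S (\<Sum>k. M ^ (k + K) / fact (k + K)) (\<lambda>s. \<Sum>k. F s ^ (k + K) / fact (k + K))"
  proof (rule wap_series[OF S])
    show "wap S (M ^ (k + K) / fact (k + K)) (\<lambda>s. F s ^ (k + K) / fact (k + K))" for k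
      using wap_cmult[OF S wap_power[OF S F, of "k + K"], of "inverse (fact (k + K))"]
      by (simp add: norm_inverse divide_inverse mult.commute)
    show "summable (\<lambda>k. M ^ (k + K) / fact (k + K))" by (rule sums_summable[OF tail])
  qed
  moreover have "(\<Sum>k. M ^ (k + K) / fact (k + K)) = exp M - (\<Sum>k<K. M ^ k / fact k)"
    by (rule sums_unique[OF tail, symmetric])
  moreover have "(\<Sum>k. F s ^ (k + K) / fact (k + K)) = exp (F s) - (\<Sum>k<K. F s ^ k / fact k)" for s
    by (rule sums_unique[OF tail, symmetric])
  ultimately show ?thesis by (simp only:)
qed

text \<open>Convergence of the exponential series in any of the three topologies implies convergence of each coefficient,
and this already determines the sum.\<close>
lemma exp_from_coefficients:
  assumes f: "has_dirichlet_series f c" and A: "has_dirichlet_series A a"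
    and lim: "\<And>n. n \<ge> 1 \<Longrightarrow> (\<lambda>N. c n - (\<Sum>k<N. dpow a k n / fact k)) \<longlonglongrightarrow> 0" and s: "Re s > 0"
  shows "f s = exp (A s)"
proof -
  obtain c' where c': "has_dirichlet_series (\<lambda>s. exp (A s)) c'" "\<And>n. n \<ge> 1 \<Longrightarrow> (\<lambda>k. dpow a k n / fact k) sums c' n"
    using has_series_exp[OF A] by blast
  have "c n = c' n" if n: "n \<ge> 1" for n
  proof -
    have "(\<lambda>N. \<Sum>k<N. dpow a k n / fact k) \<longlonglongrightarrow> c n"
      using tendsto_diff[OF tendsto_const lim[OF n], of "c n"] by simp
    thus ?thesis using c'(2)[OF n] LIMSEQ_unique unfolding sums_def by blast
  qed
  thus ?thesis using has_series_fun_unique[OF f c'(1) _ s] by blast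
qed

lemma remainder_has_series:
  assumes "has_dirichlet_series f c" "has_dirichlet_series A a"
  shows "has_dirichlet_series (\<lambda>s\<in>right_halfplane. f s - (\<Sum>k<N. A s ^ k / fact k)) (\<lambda>n. c n - (\<Sum>k<N. dpow a k n / fact k))"
  unfolding has_series_onH by (intro has_series_diff has_series_exp_partial assms)

lemma dilate_remainder:
  assumes "has_dirichlet_series f c" "has_dirichlet_series A a" "0 < r" "r < 1" "Re s > 0"
  shows "dilate r (\<lambda>s\<in>right_halfplane. f s - (\<Sum>k<N. A s ^ k / fact k)) s = dilate r f s - (\<Sum>k<N. dilate r A s ^ k / fact k)"
proof (rule has_series_fun_unique[OF dilate_has_series[OF remainder_has_series[OF assms(1,2)] assms(3,4)]
    has_series_diff[OF dilate_has_series[OF assms(1,3,4)] has_series_exp_partial[OF dilate_has_series[OF assms(2,3,4)]]] _ assms(5)])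
  fix n :: nat assume n: "n \<ge> 1"
  have "dpow (\<lambda>n. charval (\<lambda>_. of_real r) n * a n) k n = charval (\<lambda>_. of_real r) n * dpow a k n" for k
    using dpow_mult_char[of "charval (\<lambda>_. of_real r)" n a k] n by (simp add: charval_mult mult.commute)
  thus "charval (\<lambda>_. of_real r) n * (c n - (\<Sum>k<N. dpow a k n / fact k)) =
     charval (\<lambda>_. of_real r) n * c n - (\<Sum>k<N. dpow (\<lambda>n. charval (\<lambda>_. of_real r) n * a n) k n / fact k)"
    by (simp add: right_diff_distrib sum_distrib_left)
qed

lemma is_exp_Wie_iff:
  assumes f: "f \<in> Wie" and A: "A \<in> Wie"
  shows "is_exp {l1_norm} A f \<longleftrightarrow> (\<forall>s. Re s > 0 \<longrightarrow> f s = exp (A s))"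
proof
  let ?R = "\<lambda>N. \<lambda>s\<in>right_halfplane. f s - (\<Sum>k<N. A s ^ k / fact k)"
  obtain M where M: "wap UNIV M A" using A by (auto simp: Wie_iff)
  obtain M' where M': "wap UNIV M' f" using f by (auto simp: Wie_iff)
  note fs = OuD(2)[OF Wie_imp_Ou[OF f]] and As = OuD(2)[OF Wie_imp_Ou[OF A]]
  {
    assume "is_exp {l1_norm} A f"
    hence lim: "(\<lambda>N. l1_norm (?R N)) \<longlonglongrightarrow> 0" by (simp add: is_exp_def)
    have R: "\<exists>m. wap UNIV m (?R N)" for N
    proof -
      have "wap UNIV (\<Sum>k<N. M ^ k / fact k) (\<lambda>s. \<Sum>k<N. A s ^ k / fact k)"
      proof (rule wap_sum[OF mult_closed_UNIV])
        show "wap UNIV (M ^ k / fact k) (\<lambda>s. A s ^ k / fact k)" for k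
          using wap_cmult[OF mult_closed_UNIV wap_power[OF mult_closed_UNIV M, of k], of "inverse (fact k)"]
          by (simp add: norm_inverse divide_inverse mult.commute)
      qed
      from wap_add[OF M' wap_cmult[OF mult_closed_UNIV this, of "-1"]]
      show ?thesis unfolding wap_onH by auto
    qed
    show "\<forall>s. Re s > 0 \<longrightarrow> f s = exp (A s)"
    proof (intro allI impI exp_from_coefficients[OF fs As])
      fix n :: nat assume n: "n \<ge> 1"
      have "cmod (dirichlet_coeff f n - (\<Sum>k<N. dpow (dirichlet_coeff A) k n / fact k)) \<le> l1_norm (?R N)" for N
      proof -
        obtain m where "wap UNIV m (?R N)" using R[of N] by blast
        from wap_l1_norm(2)[OF this n] show ?thesis
          unfolding has_series_dirichlet_coeff(2)[OF remainder_has_series[OF fs As, of N] n] .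
      qed
      note * = this
      show "(\<lambda>N. dirichlet_coeff f n - (\<Sum>k<N. dpow (dirichlet_coeff A) k n / fact k)) \<longlonglongrightarrow> 0"
        by (rule Lim_null_comparison[OF always_eventually lim]) (use * in blast)
    qed
  }
  {
    assume eq: "\<forall>s. Re s > 0 \<longrightarrow> f s = exp (A s)"
    have R: "wap UNIV (exp M - (\<Sum>k<N. M ^ k / fact k)) (?R N)" for N
    proof -
      have "wap UNIV (exp M - (\<Sum>k<N. M ^ k / fact k)) (\<lambda>s. f s - (\<Sum>k<N. A s ^ k / fact k))"
        using wap_exp_remainder[OF mult_closed_UNIV M, of N] eq
        by (subst wap_cong[of _ "\<lambda>s. exp (A s) - (\<Sum>k<N. A s ^ k / fact k)"]) auto
      thus ?thesis by (simp only: wap_onH)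
    qed
    have "(\<lambda>N. l1_norm (?R N)) \<longlonglongrightarrow> 0"
      by (rule tendsto_sandwich[OF _ _ tendsto_const exp_remainder_tendsto[of M]])
         (intro always_eventually allI wap_l1_norm[OF R])+
    thus "is_exp {l1_norm} A f" by (simp add: is_exp_def)
  }
qed

lemma is_exp_Adir_iff:
  assumes f: "f \<in> Adir" and A: "A \<in> Adir"
  shows "is_exp {sup_norm} A f \<longleftrightarrow> (\<forall>s. Re s > 0 \<longrightarrow> f s = exp (A s))"
proof
  let ?R = "\<lambda>N. \<lambda>s\<in>right_halfplane. f s - (\<Sum>k<N. A s ^ k / fact k)"
  obtain B where B: "B > 0" "\<And>s. Re s > 0 \<Longrightarrow> cmod (A s) \<le> B" using A dap_bound[of UNIV A] by (auto simp: Adir_iff)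
  obtain B' where B': "\<And>s. Re s > 0 \<Longrightarrow> cmod (f s) \<le> B'" using f dap_bound[of UNIV f] by (auto simp: Adir_iff)
  note fs = OuD(2)[OF Adir_imp_Ou[OF f]] and As = OuD(2)[OF Adir_imp_Ou[OF A]]
  {
    assume "is_exp {sup_norm} A f"
    hence lim: "(\<lambda>N. sup_norm (?R N)) \<longlonglongrightarrow> 0" by (simp add: is_exp_def)
    have R: "cmod (?R N s) \<le> B' + (\<Sum>k<N. B ^ k / fact k)" if s: "Re s > 0" for N s
    proof -
      have "cmod (\<Sum>k<N. A s ^ k / fact k) \<le> (\<Sum>k<N. B ^ k / fact k)"
        by (rule sum_norm_le) (use B(2)[OF s] in \<open>simp add: norm_divide norm_power divide_right_mono power_mono\<close>)
      thus ?thesis using B'[OF s] s by (simp add: norm_triangle_le_diff add_mono)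
    qed
    obtain C where C: "C \<ge> 0" "\<And>F a B n. has_dirichlet_series F a \<Longrightarrow>
      (\<And>s. Re s > 0 \<Longrightarrow> cmod (F s) \<le> B) \<Longrightarrow> n \<ge> 1 \<Longrightarrow> cmod (a n) \<le> C * real n powr 1 * B"
      using series_coeff_bound[of 1] by auto
    show "\<forall>s. Re s > 0 \<longrightarrow> f s = exp (A s)"
    proof (intro allI impI exp_from_coefficients[OF fs As])
      fix n :: nat assume n: "n \<ge> 1"
      have *: "\<forall>N. cmod (dirichlet_coeff f n - (\<Sum>k<N. dpow (dirichlet_coeff A) k n / fact k)) \<le> C * real n powr 1 * sup_norm (?R N)"
        by (intro allI C(2)[OF remainder_has_series[OF fs As] le_sup_norm[OF R] n])
      have lim': "(\<lambda>N. C * real n powr 1 * sup_norm (?R N)) \<longlonglongrightarrow> 0" by (rule tendsto_mult_right_zero[OF lim])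
      show "(\<lambda>N. dirichlet_coeff f n - (\<Sum>k<N. dpow (dirichlet_coeff A) k n / fact k)) \<longlonglongrightarrow> 0"
        by (rule Lim_null_comparison[OF always_eventually[OF *] lim'])
    qed
  }
  {
    assume eq: "\<forall>s. Re s > 0 \<longrightarrow> f s = exp (A s)"
    have R: "cmod (?R N s) \<le> exp B - (\<Sum>k<N. B ^ k / fact k)" if s: "Re s > 0" for N s
      using exp_remainder_bound[OF B(2)[OF s], of N] eq s by simp
    have "(\<lambda>N. sup_norm (?R N)) \<longlonglongrightarrow> 0"
    proof (rule tendsto_sandwich[OF always_eventually always_eventually tendsto_const exp_remainder_tendsto[of B]]; rule allI)
      fix N
      show "0 \<le> sup_norm (?R N)" by (rule sup_norm_nonneg[of "?R N", OF R])
      show "sup_norm (?R N) \<le> exp B - (\<Sum>k<N. B ^ k / fact k)" by (rule sup_norm_le[of "?R N", OF R])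
    qed
    thus "is_exp {sup_norm} A f" by (simp add: is_exp_def)
  }
qed

lemma is_exp_Ob_iff:
  assumes f: "f \<in> Ob" and A: "A \<in> Ob"
  shows "is_exp (dilate_seminorm ` {0<..<1}) A f \<longleftrightarrow> (\<forall>s. Re s > 0 \<longrightarrow> f s = exp (A s))"
proof
  let ?R = "\<lambda>N. \<lambda>s\<in>right_halfplane. f s - (\<Sum>k<N. A s ^ k / fact k)"
  note fs = OuD(2)[OF Ob_imp_Ou[OF f]] and As = OuD(2)[OF Ob_imp_Ou[OF A]]
  {
    assume "is_exp (dilate_seminorm ` {0<..<1}) A f"
    \<comment> \<open>one dilation is enough to recover the coefficients\<close>
    moreover define r :: real where "r = 1/2"
    ultimately have lim: "(\<lambda>N. sup_norm (dilate r (?R N))) \<longlonglongrightarrow> 0"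
      by (auto simp: is_exp_def dilate_seminorm_def)
    have r: "0 < r" "r < 1" by (auto simp: r_def)
    obtain B where B: "\<And>s. Re s > 0 \<Longrightarrow> cmod (dilate r A s) \<le> B" using A r unfolding Ob_iff by blast
    obtain B' where B': "\<And>s. Re s > 0 \<Longrightarrow> cmod (dilate r f s) \<le> B'" using f r unfolding Ob_iff by blast
    have R: "cmod (dilate r (?R N) s) \<le> B' + (\<Sum>k<N. B ^ k / fact k)" if s: "Re s > 0" for N s
    proof -
      have "cmod (\<Sum>k<N. dilate r A s ^ k / fact k) \<le> (\<Sum>k<N. B ^ k / fact k)"
        by (rule sum_norm_le) (use B[OF s] in \<open>simp add: norm_divide norm_power divide_right_mono power_mono\<close>)
      thus ?thesis unfolding dilate_remainder[OF fs As r s] using B'[OF s] by (simp add: norm_triangle_le_diff add_mono)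
    qed
    obtain C where C: "C \<ge> 0" "\<And>F a B n. has_dirichlet_series F a \<Longrightarrow>
      (\<And>s. Re s > 0 \<Longrightarrow> cmod (F s) \<le> B) \<Longrightarrow> n \<ge> 1 \<Longrightarrow> cmod (a n) \<le> C * real n powr 1 * B"
      using series_coeff_bound[of 1] by auto
    show "\<forall>s. Re s > 0 \<longrightarrow> f s = exp (A s)"
    proof (intro allI impI exp_from_coefficients[OF fs As])
      fix n :: nat assume n: "n \<ge> 1"
      define x where "x = charval (\<lambda>_. of_real r) n"
      have x: "x \<noteq> 0" unfolding x_def charval_const using r by simp
      have *: "\<forall>N. cmod (x * (dirichlet_coeff f n - (\<Sum>k<N. dpow (dirichlet_coeff A) k n / fact k))) \<le> C * real n powr 1 * sup_norm (dilate r (?R N))"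
        unfolding x_def by (intro allI C(2)[OF dilate_has_series[OF remainder_has_series[OF fs As] r] le_sup_norm[OF R] n])
      have lim': "(\<lambda>N. C * real n powr 1 * sup_norm (dilate r (?R N))) \<longlonglongrightarrow> 0" by (rule tendsto_mult_right_zero[OF lim])
      have "(\<lambda>N. x * (dirichlet_coeff f n - (\<Sum>k<N. dpow (dirichlet_coeff A) k n / fact k))) \<longlonglongrightarrow> 0"
        by (rule Lim_null_comparison[OF always_eventually[OF *] lim'])
      from tendsto_mult_right_zero[OF this, of "inverse x"] x
      show "(\<lambda>N. dirichlet_coeff f n - (\<Sum>k<N. dpow (dirichlet_coeff A) k n / fact k)) \<longlonglongrightarrow> 0"
        by (simp add: mult.assoc[symmetric])
    qed
  }
  {
    assume eq: "\<forall>s. Re s > 0 \<longrightarrow> f s = exp (A s)"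
    have "(\<lambda>N. sup_norm (dilate r (?R N))) \<longlonglongrightarrow> 0" if r: "0 < r" "r < 1" for r
    proof -
      obtain B where B: "\<And>s. Re s > 0 \<Longrightarrow> cmod (dilate r A s) \<le> B" using A r unfolding Ob_iff by blast
      have R: "cmod (dilate r (?R N) s) \<le> exp B - (\<Sum>k<N. B ^ k / fact k)" if s: "Re s > 0" for N s
        unfolding dilate_remainder[OF fs As r s]
        using exp_remainder_bound[OF B[OF s], of N] dilate_exp[OF As _ r s, of f] eq by simp
      show ?thesis
      proof (rule tendsto_sandwich[OF always_eventually always_eventually tendsto_const exp_remainder_tendsto[of B]]; rule allI)
        fix N
        show "0 \<le> sup_norm (dilate r (?R N))" by (rule sup_norm_nonneg[of "dilate r (?R N)", OF R])
        show "sup_norm (dilate r (?R N)) \<le> exp B - (\<Sum>k<N. B ^ k / fact k)" by (rule sup_norm_le[of "dilate r (?R N)", OF R])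
      qed
    qed
    thus "is_exp (dilate_seminorm ` {0<..<1}) A f" by (auto simp: is_exp_def dilate_seminorm_def)
  }
qed

text \<open>Common to the three algebras with \<open>A\<^sup>-\<^sup>1 = e\<^sup>A\<close>. The hypotheses isolate what depends on the topology: the exponential
series converges to the pointwise exponential, logarithms of units exist, and exponentials stay in the algebra.\<close>
lemma Units_eq_exp_set:
  assumes G: "\<And>\<sigma>. \<sigma> \<in> G \<Longrightarrow> bij_betw \<sigma> {1..} {1..}" and X: "X \<subseteq> Ou"
    and is_exp: "\<And>f A. f \<in> X \<Longrightarrow> A \<in> X \<Longrightarrow> is_exp P A f \<longleftrightarrow> (\<forall>s. Re s > 0 \<longrightarrow> f s = exp (A s))"
    and log: "\<And>f. f \<in> Units (fun_ring (invariants G X)) \<Longrightarrow>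
       \<exists>A a. has_dirichlet_series A a \<and> onH A \<in> X \<and> (\<forall>s. Re s > 0 \<longrightarrow> f s = exp (A s))"
    and minus: "\<And>A a. onH A \<in> X \<Longrightarrow> has_dirichlet_series A a \<Longrightarrow> onH (\<lambda>s. exp (- A s)) \<in> X"
  shows "Units (fun_ring (invariants G X)) = exp_set P (invariants G X)"
proof (intro equalityI subsetI)
  fix f assume f: "f \<in> Units (fun_ring (invariants G X))"
  hence fi: "f \<in> invariants G X" by (simp add: Units_fun_ring)
  obtain A a where A: "has_dirichlet_series A a" "onH A \<in> X" "\<And>s. Re s > 0 \<Longrightarrow> f s = exp (A s)"
    using log[OF f] by blast
  have "onH A \<in> invariants G X"
    by (rule Units_invariants_exp(2)[OF G fi X A(1,3) minus[OF A(2,1)] A(2)])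
  moreover have "is_exp P (onH A) f" using is_exp[of f "onH A"] fi A by (simp add: invariants_def)
  ultimately show "f \<in> exp_set P (invariants G X)" using fi unfolding exp_set_def by blast
next
  fix f assume "f \<in> exp_set P (invariants G X)"
  then obtain A where f: "f \<in> invariants G X" and A: "A \<in> X" "is_exp P A f" by (auto simp: exp_set_def invariants_def)
  have fA: "f s = exp (A s)" if "Re s > 0" for s using is_exp[of f A] f A that by (simp add: invariants_def)
  have AO: "A \<in> Ou" using A X by blast
  have "onH A = A" using OuD(1)[OF AO] by (rule extensional_restrict)
  hence "onH (\<lambda>s. exp (- A s)) \<in> X" using minus[OF _ OuD(2)[OF AO]] A(1) by simp
  from Units_invariants_exp(1)[OF G f X OuD(2)[OF AO] fA this]
  show "f \<in> Units (fun_ring (invariants G X))" .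
qed

text \<open>The logarithm itself may leave \<open>X\<close> (it does for \<^const>\<open>Hinf\<close>, where it can be unbounded); membership of
\<open>exp (- A)\<close> suffices.\<close>
lemma Units_eq_bounded_below:
  assumes G: "\<And>\<sigma>. \<sigma> \<in> G \<Longrightarrow> bij_betw \<sigma> {1..} {1..}" and X: "X \<subseteq> Hinf"
    and log: "\<And>f \<delta>. f \<in> X \<Longrightarrow> \<delta> > 0 \<Longrightarrow> (\<And>s. Re s > 0 \<Longrightarrow> cmod (f s) \<ge> \<delta>) \<Longrightarrow>
       \<exists>A a. has_dirichlet_series A a \<and> onH (\<lambda>s. exp (- A s)) \<in> X \<and> (\<forall>s. Re s > 0 \<longrightarrow> f s = exp (A s))"
  shows "Units (fun_ring (invariants G X)) = {f \<in> invariants G X. (INF s\<in>right_halfplane. cmod (f s)) > 0}"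
proof (intro equalityI subsetI CollectI conjI)
  fix f assume f: "f \<in> Units (fun_ring (invariants G X))"
  thus "f \<in> invariants G X" by (simp add: Units_fun_ring)
  show "(INF s\<in>right_halfplane. cmod (f s)) > 0" unfolding INF_pos_iff by (rule Units_bounded_below[OF f X])
next
  fix f assume "f \<in> {f \<in> invariants G X. (INF s\<in>right_halfplane. cmod (f s)) > 0}"
  hence f: "f \<in> invariants G X" and "\<exists>\<delta>>0. \<forall>s. Re s > 0 \<longrightarrow> cmod (f s) \<ge> \<delta>" by (auto simp: INF_pos_iff)
  then obtain \<delta> where "\<delta> > 0" "\<And>s. Re s > 0 \<Longrightarrow> cmod (f s) \<ge> \<delta>" by blast
  then obtain A a where "has_dirichlet_series A a" "onH (\<lambda>s. exp (- A s)) \<in> X" "\<And>s. Re s > 0 \<Longrightarrow> f s = exp (A s)"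
    using log[of f \<delta>] f by (auto simp: invariants_def)
  moreover have "X \<subseteq> Ou" using X Hinf_imp_Ou by blast
  ultimately show "f \<in> Units (fun_ring (invariants G X))" using Units_invariants_exp(1)[OF G f] by blast
qed

text \<open>\<open>perm_hat \<sigma>\<close> preserves the number of prime factors.\<close>
lemma dilate_invariant:
  assumes G: "\<And>\<sigma>. \<sigma> \<in> G \<Longrightarrow> bij_betw \<sigma> {1..} {1..}" and f: "f \<in> invariants G Ob" and r: "0 < r" "r < 1"
  shows "dilate r f \<in> invariants G Hinf"
proof -
  have fO: "f \<in> Ob" using f by (simp add: invariants_def)
  note fs = OuD(2)[OF Ob_imp_Ou[OF fO]]
  have "dilate r f \<in> Hinf" using fO dilate_Ou[OF Ob_imp_Ou[OF fO] r] r by (simp add: Hinf_iff Ob_iff)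
  moreover have "charval (\<lambda>_. of_real r) (perm_hat \<sigma> n) * dirichlet_coeff f (perm_hat \<sigma> n) = charval (\<lambda>_. of_real r) n * dirichlet_coeff f n"
    if "\<sigma> \<in> G" "n \<ge> 1" for \<sigma> n
    using f that perm_hat_props(4)[OF G[OF that(1)] that(2)] by (simp add: charval_const invariants_def)
  ultimately show ?thesis using invariants_iff[OF G dilate_has_series[OF fs r]] by blast
qed

lemma Units_Ob:
  assumes G: "\<And>\<sigma>. \<sigma> \<in> G \<Longrightarrow> bij_betw \<sigma> {1..} {1..}"
  shows "Units (fun_ring (invariants G Ob)) =
        {f \<in> invariants G Ob. \<forall>r\<in>{0<..<1}. dilate r f \<in> Units (fun_ring (invariants G Hinf))}"
proof (intro equalityI subsetI CollectI conjI ballI)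
  fix f assume f: "f \<in> Units (fun_ring (invariants G Ob))"
  thus fi: "f \<in> invariants G Ob" by (simp add: Units_fun_ring)
  fix r :: real assume "r \<in> {0<..<1}"
  hence r: "0 < r" "r < 1" by auto
  obtain g where g: "g \<in> invariants G Ob" "\<And>s. Re s > 0 \<Longrightarrow> f s * g s = 1" using f unfolding Units_fun_ring by blast
  have fO: "f \<in> Ob" and gO: "g \<in> Ob" using fi g by (auto simp: invariants_def)
  note fs = OuD(2)[OF Ob_imp_Ou[OF fO]] and gs = OuD(2)[OF Ob_imp_Ou[OF gO]]
  let ?w = "charval (\<lambda>_. of_real r)"
  have "has_dirichlet_series (\<lambda>s. f s * g s) (\<lambda>n. if n = 1 then 1 else 0)"
    using has_series_const[of 1] by (subst has_series_cong) (use g(2) in auto)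
  hence one: "dconv (dirichlet_coeff f) (dirichlet_coeff g) n = (if n = 1 then 1 else 0)" if "n \<ge> 1" for n
    using has_series_unique[OF has_series_mult[OF fs gs] _ that] by simp
  have "dilate r f s * dilate r g s = 1" if s: "Re s > 0" for s
  proof (rule has_series_fun_unique[OF has_series_mult[OF dilate_has_series[OF fs r] dilate_has_series[OF gs r]] has_series_const[of 1] _ s])
    fix n :: nat assume n: "n \<ge> 1"
    have "dconv (\<lambda>n. dirichlet_coeff f n * ?w n) (\<lambda>n. dirichlet_coeff g n * ?w n) n = dconv (dirichlet_coeff f) (dirichlet_coeff g) n * ?w n"
    proof (rule dconv_mult_char[OF n])
      fix k m assume "k * m = n"
      moreover from this have "k > 0" "m > 0" using n by (auto intro!: gr0I)
      ultimately show "?w k * ?w m = ?w n" by (auto simp: charval_mult)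
    qed
    thus "dconv (\<lambda>n. ?w n * dirichlet_coeff f n) (\<lambda>n. ?w n * dirichlet_coeff g n) n = (if n = 1 then 1 else 0)"
      using one[OF n] by (simp add: mult.commute)
  qed
  thus "dilate r f \<in> Units (fun_ring (invariants G Hinf))"
    unfolding Units_fun_ring using dilate_invariant[OF G fi r] dilate_invariant[OF G g(1) r] by blast
next
  fix f assume "f \<in> {f \<in> invariants G Ob. \<forall>r\<in>{0<..<1}. dilate r f \<in> Units (fun_ring (invariants G Hinf))}"
  hence f: "f \<in> invariants G Ob" and u: "\<And>r. 0 < r \<Longrightarrow> r < 1 \<Longrightarrow> dilate r f \<in> Units (fun_ring (invariants G Hinf))" by auto
  have "f \<in> Ob" using f by (simp add: invariants_def)
  from Ob_log[OF this u] obtain A a where A: "has_dirichlet_series A a" "onH A \<in> Ob" "\<And>s. Re s > 0 \<Longrightarrow> f s = exp (A s)" by blast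
  show "f \<in> Units (fun_ring (invariants G Ob))"
    by (rule Units_invariants_exp(1)[OF G f _ A(1,3) Ob_exp_minus[OF A(2,1)]]) (auto dest: Ob_imp_Ou)
qed

theorem theorem3p2:
  fixes G :: "(nat \<Rightarrow> nat) set"
  assumes "subgroup G (BijGroup {1..})"
  shows
    "(\<forall>A \<in> {invariants G Wie, invariants G Adir, invariants G Hinf}.
        Units (fun_ring A) = {f \<in> A. (INF s\<in>right_halfplane. cmod (f s)) > 0})
     \<and> Units (fun_ring (invariants G Ob)) =
        {f \<in> invariants G Ob. \<forall>r\<in>{0<..<1}. dilate r f \<in> Units (fun_ring (invariants G Hinf))}
     \<and> Units (fun_ring (invariants G Wie)) = exp_set {l1_norm} (invariants G Wie)
     \<and> Units (fun_ring (invariants G Adir)) = exp_set {sup_norm} (invariants G Adir)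
     \<and> Units (fun_ring (invariants G Ob)) =
        exp_set (dilate_seminorm ` {0<..<1}) (invariants G Ob)"
proof -
  note G = subgroup_BijGroup_bij[OF assms]
  have WH: "Wie \<subseteq> Hinf" using Wie_subset_Adir Adir_subset_Hinf by blast
  have W: "Units (fun_ring (invariants G Wie)) = {f \<in> invariants G Wie. (INF s\<in>right_halfplane. cmod (f s)) > 0}"
    by (rule Units_eq_bounded_below[OF G WH]) (use Wie_log Wie_exp_minus in blast)+
  have A: "Units (fun_ring (invariants G Adir)) = {f \<in> invariants G Adir. (INF s\<in>right_halfplane. cmod (f s)) > 0}"
    by (rule Units_eq_bounded_below[OF G Adir_subset_Hinf]) (use Adir_log Adir_exp_minus in blast)+
  have H: "Units (fun_ring (invariants G Hinf)) = {f \<in> invariants G Hinf. (INF s\<in>right_halfplane. cmod (f s)) > 0}"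
    by (rule Units_eq_bounded_below[OF G subset_refl Hinf_log])
  have We: "Units (fun_ring (invariants G Wie)) = exp_set {l1_norm} (invariants G Wie)"
  proof (rule Units_eq_exp_set[OF G _ is_exp_Wie_iff])
    fix f assume f: "f \<in> Units (fun_ring (invariants G Wie))"
    hence "f \<in> Wie" by (simp add: Units_fun_ring invariants_def)
    with Units_bounded_below[OF f WH] Wie_log
    show "\<exists>A a. has_dirichlet_series A a \<and> onH A \<in> Wie \<and> (\<forall>s. Re s > 0 \<longrightarrow> f s = exp (A s))" by blast
  qed (auto intro: Wie_imp_Ou Wie_exp_minus)
  have Ae: "Units (fun_ring (invariants G Adir)) = exp_set {sup_norm} (invariants G Adir)"
  proof (rule Units_eq_exp_set[OF G _ is_exp_Adir_iff])
    fix f assume f: "f \<in> Units (fun_ring (invariants G Adir))"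
    hence "f \<in> Adir" by (simp add: Units_fun_ring invariants_def)
    with Units_bounded_below[OF f Adir_subset_Hinf] Adir_log
    show "\<exists>A a. has_dirichlet_series A a \<and> onH A \<in> Adir \<and> (\<forall>s. Re s > 0 \<longrightarrow> f s = exp (A s))" by blast
  qed (auto intro: Adir_imp_Ou Adir_exp_minus)
  have O: "Units (fun_ring (invariants G Ob)) =
      {f \<in> invariants G Ob. \<forall>r\<in>{0<..<1}. dilate r f \<in> Units (fun_ring (invariants G Hinf))}"
    by (rule Units_Ob) (rule G)
  have Oe: "Units (fun_ring (invariants G Ob)) = exp_set (dilate_seminorm ` {0<..<1}) (invariants G Ob)"
  proof (rule Units_eq_exp_set[OF G _ is_exp_Ob_iff])
    fix f assume "f \<in> Units (fun_ring (invariants G Ob))"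
    hence "f \<in> invariants G Ob" and *: "\<forall>r\<in>{0<..<1}. dilate r f \<in> Units (fun_ring (invariants G Hinf))"
      unfolding O by blast+
    hence f: "f \<in> Ob" by (simp add: invariants_def)
    show "\<exists>A a. has_dirichlet_series A a \<and> onH A \<in> Ob \<and> (\<forall>s. Re s > 0 \<longrightarrow> f s = exp (A s))"
      by (rule Ob_log[OF f, of G]) (use * in simp)
  qed (auto intro: Ob_imp_Ou Ob_exp_minus)
  show ?thesis using W A H O We Ae Oe by (intro conjI) blast+
qed

end
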